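(* For all $\tau\in\mathbb H$, $$\theta_{10}^{24}(\tau)=E_4^3(\tau)-E_{4,4}^3(\tau,\tfrac12)-3\cdot2^4\,\eta^{12}(\tau)\theta_{10}^4(\tau)E_4(\tau),$$ and hence $$\theta_{10}^{24}(\tau)=E_4^3(\tau)-E_{4,4}^3(\tau,\tfrac12)-\tfrac{688}{45}\,E_4(\tau)\bigl(E_{8,2}(\tau,\tfrac12)-E_{8,4}(\tau,\tfrac12)\bigr).$$
   Context: Here $\mathbb H$ is the upper half-plane, $q=e^{2\pi i\tau}$, $\eta(\tau)=q^{1/24}\prod_{n\ge1}(1-q^n)$, $E_4=1+240\sum_{n\ge1}\sigma_3(n)q^n$, $\theta_{10}(\tau)=\sum_{n\in\mathbb Z}q^{(2n+1)^2/8}$. Jacobi–Eisenstein series (even $k\ge4$, $m\ge1$): $E_{k,m}(\tau,z)=\frac12\sum_{c,d\in\mathbb Z,\,(c,d)=1}\sum_{\lambda\in\mathbb Z}(c\tau+d)^{-k}e^{2\pi i m\left(\lambda^2\frac{a\tau+b}{c\tau+d}+2\lambda\frac{z}{c\tau+d}-\frac{cz^2}{c\tau+d}\right)}$, where $a,b\in\mathbb Z$ are chosen with $ad-bc=1$. *)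

theory Defs
  imports "HOL-Analysis.Analysis"
begin

(* Fractional powers q^r of the nome are read, as usual for modular forms, as e^(2 pi i r tau);
   the principal branch of powr applied to q would be a different function. *)

definition nome :: "complex \<Rightarrow> complex" where
  "nome \<tau> = exp (2 * of_real pi * \<i> * \<tau>)"

definition nome_pow :: "real \<Rightarrow> complex \<Rightarrow> complex" where
  "nome_pow r \<tau> = exp (2 * of_real pi * \<i> * of_real r * \<tau>)"

definition divisor_sum :: "nat \<Rightarrow> nat \<Rightarrow> nat" where
  "divisor_sum k n = (\<Sum>d | d dvd n. d ^ k)"

definition eta :: "complex \<Rightarrow> complex" where
  "eta \<tau> = nome_pow (1 / 24) \<tau> * (\<Prod>n. 1 - nome \<tau> ^ Suc n)"

definition E4 :: "complex \<Rightarrow> complex" where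
  "E4 \<tau> = 1 + 240 * (\<Sum>n. of_nat (divisor_sum 3 (Suc n)) * nome \<tau> ^ Suc n)"

definition theta10 :: "complex \<Rightarrow> complex" where
  "theta10 \<tau> = (\<Sum>\<^sub>\<infinity>n::int. nome_pow ((2 * of_int n + 1)\<^sup>2 / 8) \<tau>)"

(* Pairs (a, b) completing the row (c, d) to a matrix in SL_2(Z) differ by integer multiples of
   (c, d), which multiplies each summand of jacobi_eisenstein by e^(2 pi i m lambda^2 n) = 1, so
   the choice made here is irrelevant. *)
definition sl2_upper_row :: "int \<Rightarrow> int \<Rightarrow> int \<times> int" where
  "sl2_upper_row c d = (SOME (a, b). a * d - b * c = 1)"

(* Meant for even k \<ge> 4, m \<ge> 1 and Im \<tau> > 0, where the series converges absolutely. *)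
definition jacobi_eisenstein :: "nat \<Rightarrow> nat \<Rightarrow> complex \<Rightarrow> complex \<Rightarrow> complex" where
  "jacobi_eisenstein k m \<tau> z =
     1 / 2 * (\<Sum>\<^sub>\<infinity>(c, d) \<in> {(c, d). coprime c d}. \<Sum>\<^sub>\<infinity>l::int.
       (let (a, b) = sl2_upper_row c d; j = of_int c * \<tau> + of_int d in
          j powi (- int k) *
          exp (2 * of_real pi * \<i> * of_nat m *
            (of_int l ^ 2 * ((of_int a * \<tau> + of_int b) / j)
             + 2 * of_int l * (z / j)
             - of_int c * z ^ 2 / j))))"

end

theory Submission
  imports Defs "HOL-Complex_Analysis.Complex_Analysis" "HOL-Probability.Probability" "HOL-Real_Asymp.Real_Asymp"
begin

text \<open>
  Write \<open>e(x) = exp (2 \<pi> i x)\<close> and let \<open>th2, th3, th4\<close> be the Jacobi theta constants, so that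
  \<open>theta10 = th2\<close>. The product formulas give \<open>th2 th3 th4 = 2 \<eta>\<^sup>3\<close>, level one theory gives
  \<open>2 E\<^sub>4 = th2\<^sup>8 + th3\<^sup>8 + th4\<^sup>8\<close>, and Jacobi's identity is \<open>th3\<^sup>4 = th2\<^sup>4 + th4\<^sup>4\<close>. With
  \<open>a = th2\<^sup>4\<close> and \<open>s = th3\<^sup>4 th4\<^sup>4\<close> this means \<open>E\<^sub>4 = a\<^sup>2 + s\<close> and \<open>16 \<eta>\<^sup>1\<^sup>2 = a s\<close>, and both claims become
  \<open>a\<^sup>6 = (a\<^sup>2 + s)\<^sup>3 - s\<^sup>3 - 3 a\<^sup>2 s (a\<^sup>2 + s)\<close>, once the values \<open>E\<^sub>4\<^sub>,\<^sub>4(\<tau>, 1/2) = s\<close> (\<open>jacobi4_weight_4\<close>)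
  and \<open>E\<^sub>8\<^sub>,\<^sub>2(\<tau>, 1/2) - E\<^sub>8\<^sub>,\<^sub>4(\<tau>, 1/2) = (135 / 688) a\<^sup>2 s\<close> (\<open>jacobi2_minus_jacobi4_weight_8\<close>)
  are known.

  To find these values, complete the square: at \<open>z = 1/2\<close> the inner sum over \<open>\<lambda>\<close> becomes, up to a root of
  unity, a theta constant at \<open>\<gamma>\<tau>\<close> (\<open>jacobi_inner_sum\<close>), and the Jacobi-Eisenstein series becomes a sum over
  coprime pairs \<open>(c, d)\<close> of \<open>(c \<tau> + d)\<^sup>-\<^sup>k\<close> times a theta constant that depends only on \<open>\<gamma>\<close> modulo a small
  number. These sums are modular forms of small level. Instead of a valence formula for congruence
  subgroups, the proof uses the action of the Hecke operator at two, that is, the substitutions \<open>2 \<tau>\<close>,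
  \<open>\<tau>/2\<close> and \<open>(\<tau> + 1)/2\<close>, on such sums. Term by term, it expresses the index two sum through level one sums
  and one further sum, the mixed sum, and the index four sum through index two and level one sums
  (\<open>hecke_relation_jacobi2\<close>, \<open>hecke_relation_jacobi4\<close>).

  In weights four and eight the level one sums are powers of \<open>E\<^sub>4\<close>, because the difference, if not zero, divided by
  a suitable power of \<open>\<Delta>\<close> would be a modular function without poles vanishing at the cusp
  (\<open>level_one_weight_vanish\<close>). The mixed sum has level two, but a linear relation between its transforms, with
  theta constants as coefficients (\<open>theta_relation_sum\<close>), reduces it to the same argument
  (\<open>slash_sum_mixed_fam\<close>). Landen's transformations finally turn the Hecke relations into polynomial
  identities in \<open>th2\<^sup>2, th3\<^sup>2, th4\<^sup>2\<close>.

  The classical input is proved along the way: the inversion formula of \<open>th3\<close> by Poisson summation, the Jacobi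
  triple product, and the equality of the \<open>q\<close>-series \<open>E\<^sub>4\<close> with the lattice sum of weight four by
  Lipschitz's formula.
\<close>

section \<open>Series on the upper half-plane\<close>

\<comment> \<open>Two notions of absolute summability share this infix; below it is the one belonging to \<open>has_sum\<close>.\<close>
no_notation Infinite_Set_Sum.abs_summable_on (infix \<open>abs'_summable'_on\<close> 50)

abbreviation UHP :: "complex set" where "UHP \<equiv> {\<tau>. Im \<tau> > 0}"

text \<open>The filter of \<open>Im \<tau> \<rightarrow> \<infinity>\<close>, uniformly in the real part.\<close>
abbreviation at_cusp :: "complex filter" where "at_cusp \<equiv> filtercomap Im at_top"

lemma open_UHP [simp, intro]: "open UHP"
  by (rule open_halfspace_Im_gt)

lemma at_cusp_neq_bot [simp]: "at_cusp \<noteq> bot"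
proof (rule filtercomap_neq_bot_surj)
  show "surj Im" by (metis complex.sel(2) surjI)
qed auto

lemma eventually_at_cusp_UHP: "eventually (\<lambda>\<tau>. \<tau> \<in> UHP) at_cusp"
  using eventually_filtercomapI[OF eventually_gt_at_top[of 0], of Im] by simp

lemma summable_on_int_geometric:
  fixes r :: real
  assumes "0 \<le> r" "r < 1"
  shows "(\<lambda>n::int. r ^ nat \<bar>n\<bar>) summable_on UNIV"
proof -
  have s: "(\<lambda>n::nat. r ^ n) summable_on UNIV"
    using assms by (intro summable_nonneg_imp_summable_on summable_geometric) auto
  have "(\<lambda>n::int. r ^ nat \<bar>n\<bar>) summable_on (int ` UNIV)"
    using s by (subst summable_on_reindex) (auto simp: o_def inj_on_def)
  moreover have "(\<lambda>n::int. r ^ nat \<bar>n\<bar>) summable_on ((\<lambda>n. - int n) ` UNIV)"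
    using s by (subst summable_on_reindex) (auto simp: o_def inj_on_def)
  ultimately have "(\<lambda>n::int. r ^ nat \<bar>n\<bar>) summable_on (int ` UNIV \<union> (\<lambda>n. - int n) ` UNIV)"
    by (rule summable_on_union)
  also have "int ` UNIV \<union> (\<lambda>n. - int n) ` UNIV = UNIV"
  proof (intro equalityI subsetI UnCI)
    fix n :: int assume "n \<notin> (\<lambda>n. - int n) ` UNIV"
    then show "n \<in> range int" by (metis int_cases2 rangeI)
  qed auto
  finally show ?thesis .
qed

lemma holomorphic_on_infsum:
  fixes f :: "'a \<Rightarrow> complex \<Rightarrow> complex"
  assumes S: "open S" and hol: "\<And>n. n \<in> X \<Longrightarrow> f n holomorphic_on S"
    and M: "\<And>z. z \<in> S \<Longrightarrow> \<exists>r>0. \<exists>M. M summable_on X \<and> (\<forall>n\<in>X. \<forall>w\<in>cball z r \<inter> S. norm (f n w) \<le> M n)"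
  shows "(\<lambda>z. \<Sum>\<^sub>\<infinity>n\<in>X. f n z) holomorphic_on S"
proof -
  have "\<exists>r>0. (\<lambda>z. \<Sum>\<^sub>\<infinity>n\<in>X. f n z) holomorphic_on ball z r" if z: "z \<in> S" for z
  proof -
    obtain r M where r: "r > 0" and M': "M summable_on X"
      "\<And>n w. n \<in> X \<Longrightarrow> w \<in> cball z r \<inter> S \<Longrightarrow> norm (f n w) \<le> M n"
      using M[OF z] by blast
    obtain r' where r': "r' > 0" "cball z r' \<subseteq> S"
      using S z open_contains_cball_eq by blast
    define e where "e = min r r'"
    have e: "e > 0" "cball z e \<subseteq> cball z r \<inter> S"
      using r r' by (auto simp: e_def)
    have ul: "uniform_limit (cball z e) (\<lambda>Y w. \<Sum>n\<in>Y. f n w) (\<lambda>w. \<Sum>\<^sub>\<infinity>n\<in>X. f n w) (finite_subsets_at_top X)"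
    proof (rule Weierstrass_m_test_general)
      fix n w assume "n \<in> X" "w \<in> cball z e"
      then show "norm (f n w) \<le> M n" using M'(2) e(2) by blast
    qed (rule M'(1))
    have fin: "eventually (\<lambda>Y. finite Y \<and> Y \<subseteq> X) (finite_subsets_at_top X)"
      by (simp add: eventually_finite_subsets_at_top_weakI)
    have "eventually (\<lambda>Y. continuous_on (cball z e) (\<lambda>w. \<Sum>n\<in>Y. f n w) \<and>
            (\<lambda>w. \<Sum>n\<in>Y. f n w) holomorphic_on ball z e) (finite_subsets_at_top X)"
      using fin
    proof eventually_elim
      case (elim Y)
      have h: "(\<lambda>w. \<Sum>n\<in>Y. f n w) holomorphic_on cball z e"
      proof (rule holomorphic_on_sum)
        fix n assume "n \<in> Y"
        then have "f n holomorphic_on S" using elim hol by blast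
        then show "f n holomorphic_on cball z e" by (rule holomorphic_on_subset) (use e(2) in blast)
      qed
      then show ?case
        using holomorphic_on_imp_continuous_on holomorphic_on_subset[OF h ball_subset_cball] by blast
    qed
    then have "(\<lambda>w. \<Sum>\<^sub>\<infinity>n\<in>X. f n w) holomorphic_on ball z e"
      by (rule holomorphic_uniform_limit[OF _ ul]) auto
    then show ?thesis using e(1) by blast
  qed
  then have "(\<lambda>z. \<Sum>\<^sub>\<infinity>n\<in>X. f n z) field_differentiable at z within S" if "z \<in> S" for z
    using that centre_in_ball holomorphic_on_imp_differentiable_at[OF _ open_ball]
    by (metis field_differentiable_at_within)
  then show ?thesis
    unfolding holomorphic_on_def by blast
qed

text \<open>A common form for all theta constants and their quotients by their leading term, so that holomorphy, growth and
  the limit at the cusp need to be treated only once.\<close>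
definition quad_series :: "(int \<Rightarrow> real) \<Rightarrow> complex \<Rightarrow> complex" where
  "quad_series \<alpha> \<tau> = (\<Sum>\<^sub>\<infinity>n. exp (of_real pi * \<i> * of_real (\<alpha> n) * \<tau>))"

lemma norm_quad_term: "norm (exp (of_real pi * \<i> * of_real a * \<tau>)) = exp (- pi * a * Im \<tau>)"
  by (simp add: norm_exp_eq_Re)

lemma quad_term_bound:
  assumes "a \<ge> \<bar>of_int n\<bar> - (1::real)" "Im \<tau> \<ge> y" "y > 0" "a \<ge> 0"
  shows "norm (exp (of_real pi * \<i> * of_real a * \<tau>)) \<le> exp (pi * y) * exp (- pi * y) ^ nat \<bar>n\<bar>"
proof -
  have "exp (- pi * a * Im \<tau>) \<le> exp (- pi * a * y)"
    using assms by (auto intro!: mult_left_mono)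
  also have "\<dots> \<le> exp (pi * y + of_nat (nat \<bar>n\<bar>) * (- pi * y))"
  proof -
    have "(\<bar>of_int n\<bar> - 1) * (pi * y) \<le> a * (pi * y)"
      using assms by (intro mult_right_mono) auto
    then show ?thesis by (simp add: algebra_simps)
  qed
  also have "\<dots> = exp (pi * y) * exp (- pi * y) ^ nat \<bar>n\<bar>"
    by (simp only: exp_add exp_of_nat_mult)
  finally show ?thesis by (simp only: norm_quad_term)
qed

lemma quad_bound_summable:
  assumes "y > 0"
  shows "(\<lambda>n::int. exp (pi * y) * exp (- pi * y) ^ nat \<bar>n\<bar>) summable_on UNIV"
proof (rule summable_on_cmult_right, rule summable_on_int_geometric)
  have "pi * y > 0" using assms by simp
  then show "exp (- pi * y) < 1" by simp
qed simp

lemma quad_series_abs_summable: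
  assumes "\<And>n. \<alpha> n \<ge> \<bar>of_int n\<bar> - 1" "\<And>n. \<alpha> n \<ge> 0" "Im \<tau> > 0"
  shows "(\<lambda>n. exp (of_real pi * \<i> * of_real (\<alpha> n) * \<tau>)) abs_summable_on UNIV"
  using quad_bound_summable[OF assms(3)]
  by (rule Infinite_Sum.abs_summable_on_comparison_test') (rule quad_term_bound[OF assms(1) order_refl assms(3,2)])

lemma quad_series_holomorphic:
  assumes "\<And>n. \<alpha> n \<ge> \<bar>of_int n\<bar> - 1" "\<And>n. \<alpha> n \<ge> 0"
  shows "quad_series \<alpha> holomorphic_on UHP"
  unfolding quad_series_def [abs_def]
proof (rule holomorphic_on_infsum)
  fix z assume z: "z \<in> UHP"
  have *: "Im w \<ge> Im z / 2" if "w \<in> cball z (Im z / 2)" for w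
  proof -
    have "\<bar>Im z - Im w\<bar> \<le> Im z / 2"
      using that abs_Im_le_cmod[of "z - w"] by (simp add: dist_norm)
    then show ?thesis by linarith
  qed
  show "\<exists>r>0. \<exists>M. M summable_on UNIV \<and>
         (\<forall>n\<in>UNIV. \<forall>w\<in>cball z r \<inter> UHP. norm (exp (of_real pi * \<i> * of_real (\<alpha> n) * w)) \<le> M n)"
  proof (intro exI[of _ "Im z / 2"] conjI exI[of _ "\<lambda>n. exp (pi * (Im z / 2)) * exp (- pi * (Im z / 2)) ^ nat \<bar>n\<bar>"] ballI)
    fix n w assume "w \<in> cball z (Im z / 2) \<inter> UHP"
    then show "norm (exp (of_real pi * \<i> * of_real (\<alpha> n) * w)) \<le> exp (pi * (Im z / 2)) * exp (- pi * (Im z / 2)) ^ nat \<bar>n\<bar>"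
      using z by (intro quad_term_bound assms *) auto
  qed (use z quad_bound_summable[of "Im z / 2"] in auto)
qed (auto intro!: holomorphic_intros)

text \<open>Away from the zeros of the exponent the terms are dominated by \<open>exp (- \<pi> (y - 1))\<close> times the
  convergent series of their values at \<open>y = 1\<close>.\<close>
lemma quad_series_tendsto:
  assumes a: "\<And>n. \<alpha> n \<ge> \<bar>of_int n\<bar> - 1" "\<And>n. \<alpha> n = 0 \<or> \<alpha> n \<ge> 1" and Z: "finite {n. \<alpha> n = 0}"
  shows "(quad_series \<alpha> \<longlongrightarrow> of_nat (card {n. \<alpha> n = 0})) at_cusp"
proof -
  define Z where "Z = {n. \<alpha> n = 0}"
  define S where "S = (\<Sum>\<^sub>\<infinity>n\<in>-Z. exp (- pi * \<alpha> n))"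
  have a0: "\<alpha> n \<ge> 0" for n using a(2)[of n] by linarith
  have sm: "(\<lambda>n. exp (- pi * \<alpha> n)) summable_on A" for A
  proof -
    have "(\<lambda>n. norm (exp (of_real pi * \<i> * of_real (\<alpha> n) * \<i>))) summable_on UNIV"
      by (rule quad_series_abs_summable[OF a(1) a0]) simp
    then have "(\<lambda>n. exp (- pi * \<alpha> n)) summable_on UNIV"
      unfolding norm_quad_term by simp
    then show ?thesis by (rule summable_on_subset) auto
  qed
  have bound: "norm (quad_series \<alpha> \<tau> - of_nat (card Z)) \<le> exp (- pi * (Im \<tau> - 1)) * S" if t: "Im \<tau> \<ge> 1" for \<tau>
  proof -
    let ?f = "\<lambda>n. exp (of_real pi * \<i> * of_real (\<alpha> n) * \<tau>)"
    have abs: "?f abs_summable_on UNIV"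
      by (rule quad_series_abs_summable[OF a(1) a0]) (use t in simp)
    have s: "?f summable_on A" for A
      by (rule summable_on_subset_banach[OF abs_summable_summable[OF abs]]) simp
    have le: "norm (?f n) \<le> exp (- pi * (Im \<tau> - 1)) * exp (- pi * \<alpha> n)" if "n \<in> - Z" for n
    proof -
      have "\<alpha> n \<ge> 1" using a(2)[of n] that by (auto simp: Z_def)
      then have "(Im \<tau> - 1) * 1 \<le> (Im \<tau> - 1) * \<alpha> n"
        using t by (intro mult_left_mono) auto
      then have "pi * ((Im \<tau> - 1) + \<alpha> n) \<le> pi * (\<alpha> n * Im \<tau>)"
        by (intro mult_left_mono) (auto simp: algebra_simps)
      then have "- pi * \<alpha> n * Im \<tau> \<le> - pi * (Im \<tau> - 1) + (- pi * \<alpha> n)"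
        by (simp add: algebra_simps)
      then have "exp (- pi * \<alpha> n * Im \<tau>) \<le> exp (- pi * (Im \<tau> - 1) + (- pi * \<alpha> n))"
        by (simp only: exp_le_cancel_iff)
      then show ?thesis unfolding norm_quad_term exp_add .
    qed
    have "quad_series \<alpha> \<tau> = infsum ?f Z + infsum ?f (- Z)"
      unfolding quad_series_def by (subst infsum_Un_disjoint[symmetric]) (use s in auto)
    also have "infsum ?f Z = of_nat (card Z)"
      using Z by (simp add: Z_def)
    finally have "norm (quad_series \<alpha> \<tau> - of_nat (card Z)) = norm (infsum ?f (- Z))" by simp
    also have "\<dots> \<le> (\<Sum>\<^sub>\<infinity>n\<in>-Z. exp (- pi * (Im \<tau> - 1)) * exp (- pi * \<alpha> n))"
    proof (rule norm_infsum_le[OF has_sum_infsum[OF s] has_sum_infsum])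
      show "(\<lambda>n. exp (- pi * (Im \<tau> - 1)) * exp (- pi * \<alpha> n)) summable_on - Z"
        by (rule summable_on_cmult_right[OF sm])
    qed (rule le)
    also have "\<dots> = exp (- pi * (Im \<tau> - 1)) * S"
      unfolding S_def by (rule infsum_cmult_right')
    finally show ?thesis .
  qed
  have lim: "((\<lambda>\<tau>. exp (- pi * (Im \<tau> - 1)) * S) \<longlongrightarrow> 0) at_cusp"
  proof -
    have "((\<lambda>y. exp (- pi * (y - 1))) \<longlongrightarrow> 0) at_top"
      by real_asymp
    then have "((\<lambda>y. exp (- pi * (y - 1)) * S) \<longlongrightarrow> 0) at_top"
      by (rule tendsto_mult_left_zero)
    then show ?thesis by (rule filterlim_compose[OF _ filterlim_filtercomap])
  qed
  have "((\<lambda>\<tau>. quad_series \<alpha> \<tau> - of_nat (card Z)) \<longlongrightarrow> 0) at_cusp"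
  proof (rule Lim_null_comparison[OF _ lim])
    show "\<forall>\<^sub>F x in at_cusp. norm (quad_series \<alpha> x - of_nat (card Z)) \<le> exp (- pi * (Im x - 1)) * S"
      using eventually_filtercomapI[OF eventually_ge_at_top[of 1], of Im]
      by eventually_elim (use bound in auto)
  qed
  then show ?thesis unfolding Z_def by (simp add: LIM_zero_iff)
qed

section \<open>Theta constants\<close>

definition th3 :: "complex \<Rightarrow> complex" where "th3 = quad_series (\<lambda>n. (of_int n)\<^sup>2)"
definition th2 :: "complex \<Rightarrow> complex" where "th2 = quad_series (\<lambda>n. (of_int n + 1 / 2)\<^sup>2)"
text \<open>This is \<open>\<Sum>n. (- 1)\<^sup>n e(n\<^sup>2 \<tau> / 2)\<close>; as a translate of \<open>th3\<close> it inherits all properties of \<open>th3\<close>.\<close>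
definition th4 :: "complex \<Rightarrow> complex" where "th4 \<tau> = th3 (\<tau> + 1)"

lemma sq_ge_abs: "(of_int n)\<^sup>2 \<ge> \<bar>of_int n\<bar> - (1::real)" "(of_int n + 1 / 2)\<^sup>2 \<ge> \<bar>of_int n\<bar> - (1::real)"
proof -
  have "(\<bar>of_int n\<bar> - 1/2)\<^sup>2 \<ge> (0::real)" by simp
  then show "(of_int n)\<^sup>2 \<ge> \<bar>of_int n\<bar> - (1::real)" by (simp add: power2_eq_square algebra_simps)
  have "(of_int n)\<^sup>2 + of_int n + 1 \<ge> \<bar>of_int n :: real\<bar>"
  proof (cases "n \<ge> 0")
    case False
    have "(of_int n + 1)\<^sup>2 \<ge> (0::real)" by simp
    then show ?thesis using False by (simp add: power2_eq_square algebra_simps)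
  qed (auto)
  then show "(of_int n + 1 / 2)\<^sup>2 \<ge> \<bar>of_int n\<bar> - (1::real)" by (simp add: power2_eq_square algebra_simps)
qed

lemmas th3_abs = quad_series_abs_summable[OF sq_ge_abs(1) zero_le_power2]
lemmas th2_abs = quad_series_abs_summable[OF sq_ge_abs(2) zero_le_power2]

lemma th3_holo: "th3 holomorphic_on UHP" and th2_holo: "th2 holomorphic_on UHP"
  unfolding th3_def th2_def by (rule quad_series_holomorphic; auto simp: sq_ge_abs)+

lemma th4_holo: "th4 holomorphic_on UHP"
proof -
  have "(\<lambda>\<tau>. th3 (\<tau> + 1)) holomorphic_on UHP"
    by (rule holomorphic_on_compose_gen[OF _ th3_holo, unfolded o_def]) (auto intro!: holomorphic_intros)
  then show ?thesis by (simp add: th4_def [abs_def])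
qed

lemma th3_plus2: "th3 (\<tau> + 2) = th3 \<tau>"
  unfolding th3_def quad_series_def
proof (rule infsum_cong)
  fix n :: int
  have "exp (of_real pi * \<i> * of_real ((of_int n)\<^sup>2) * (\<tau> + 2)) =
        exp (of_real pi * \<i> * of_real ((of_int n)\<^sup>2) * \<tau>) * exp (of_int (2 * n\<^sup>2) * (of_real pi * \<i>))"
    by (subst exp_add[symmetric]) (simp add: algebra_simps)
  also have "exp (of_int (2 * n\<^sup>2) * (of_real pi * \<i>)) = 1"
    using exp_integer_2pi[of "of_int (n^2)"] by (simp add: mult_ac)
  finally show "exp (of_real pi * \<i> * of_real ((of_int n)\<^sup>2) * (\<tau> + 2)) = exp (of_real pi * \<i> * of_real ((of_int n)\<^sup>2) * \<tau>)"
    by simp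
qed

lemma th4_plus1: "th4 (\<tau> + 1) = th3 \<tau>" by (simp add: th4_def th3_plus2 add.assoc)
lemma th3_plus1: "th3 (\<tau> + 1) = th4 \<tau>" by (simp add: th4_def)

lemma th2_plus1: "th2 (\<tau> + 1) = exp (of_real pi * \<i> / 4) * th2 \<tau>"
proof -
  have "th2 (\<tau> + 1) = (\<Sum>\<^sub>\<infinity>n::int. exp (of_real pi * \<i> / 4) * exp (of_real pi * \<i> * of_real ((of_int n + 1/2)\<^sup>2) * \<tau>))"
    unfolding th2_def quad_series_def
  proof (rule infsum_cong)
    fix n :: int
    have "even (n\<^sup>2 + n)" by auto
    then obtain k where k: "n\<^sup>2 + n = 2 * k" by (elim evenE)
    have k': "(of_int n + 1/2)\<^sup>2 = (1/4 + 2 * of_int k :: real)"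
      using arg_cong[OF k, of "of_int :: int \<Rightarrow> real"] by (simp add: power2_eq_square algebra_simps)
    have "of_real pi * \<i> * of_real (1/4 + 2 * of_int k) * (\<tau> + 1) =
       of_real pi * \<i> / 4 + of_real pi * \<i> * of_real (1/4 + 2 * of_int k) * \<tau> + 2 * of_int k * of_real pi * \<i>"
      by (simp add: algebra_simps)
    then have "exp (of_real pi * \<i> * of_real (1/4 + 2 * of_int k) * (\<tau> + 1)) =
        exp (of_real pi * \<i> / 4) * exp (of_real pi * \<i> * of_real (1/4 + 2 * of_int k) * \<tau>) * exp (2 * of_int k * of_real pi * \<i>)"
      by (simp only: exp_add)
    also have "exp (2 * of_int k * of_real pi * \<i>) = 1"
      using exp_integer_2pi[of "of_int k"] by (simp add: mult_ac)
    finally show "exp (of_real pi * \<i> * of_real ((of_int n + 1/2)\<^sup>2) * (\<tau> + 1)) =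
      exp (of_real pi * \<i> / 4) * exp (of_real pi * \<i> * of_real ((of_int n + 1/2)\<^sup>2) * \<tau>)"
      unfolding k' by simp
  qed
  also have "\<dots> = exp (of_real pi * \<i> / 4) * th2 \<tau>"
    unfolding th2_def quad_series_def by (rule infsum_cmult_right')
  finally show ?thesis .
qed

lemma th2_plus1_sq: "th2 (\<tau> + 1) ^ 2 = \<i> * th2 \<tau> ^ 2"
proof -
  have "exp (of_real pi * \<i> / 4) ^ 2 = exp (of_real (pi / 2) * \<i>)"
    by (subst exp_of_nat_mult[symmetric]) (simp add: field_simps)
  also have "\<dots> = \<i>" by (simp add: exp_eq_polar mult.commute[of _ \<i>] cis_conv_exp[symmetric])
  finally show ?thesis by (simp add: th2_plus1 power_mult_distrib)
qed

lemma infsum_int_parity: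
  fixes f :: "int \<Rightarrow> complex"
  assumes "f summable_on UNIV"
  shows "infsum f UNIV = (\<Sum>\<^sub>\<infinity>n. f (2 * n)) + (\<Sum>\<^sub>\<infinity>n. f (2 * n + 1))"
proof -
  have "infsum f UNIV = infsum f {n. even n} + infsum f {n. odd n}"
    by (subst infsum_Un_disjoint[symmetric]) (auto intro: summable_on_subset[OF assms] arg_cong[where f = "infsum f"])
  also have "infsum f {n. even n} = (\<Sum>\<^sub>\<infinity>n. f (2 * n))"
    by (rule infsum_reindex_bij_witness[of _ "\<lambda>n. 2 * n" "\<lambda>n. n div 2"]) auto
  also have "infsum f {n. odd n} = (\<Sum>\<^sub>\<infinity>n. f (2 * n + 1))"
    by (rule infsum_reindex_bij_witness[of _ "\<lambda>n. 2 * n + 1" "\<lambda>n. n div 2"]) auto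
  finally show ?thesis .
qed

text \<open>Separate even and odd summation indices.\<close>
lemma th3_split:
  assumes "Im \<tau> > 0"
  shows "th3 \<tau> = th3 (4 * \<tau>) + th2 (4 * \<tau>)"
proof -
  have "th3 \<tau> = (\<Sum>\<^sub>\<infinity>n::int. exp (of_real pi * \<i> * of_real ((of_int (2 * n))\<^sup>2) * \<tau>)) +
        (\<Sum>\<^sub>\<infinity>n::int. exp (of_real pi * \<i> * of_real ((of_int (2 * n + 1))\<^sup>2) * \<tau>))"
    unfolding th3_def quad_series_def
    by (rule infsum_int_parity, rule abs_summable_summable, rule th3_abs[OF assms])
  also have "\<dots> = th3 (4 * \<tau>) + th2 (4 * \<tau>)"
    unfolding th3_def th2_def quad_series_def
    by (intro arg_cong2[where f = "(+)"] infsum_cong arg_cong[where f = exp]) (auto simp: field_simps power2_eq_square)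
  finally show ?thesis .
qed

lemma infsum_product_int:
  fixes f g :: "int \<Rightarrow> complex"
  assumes "f abs_summable_on UNIV" "g abs_summable_on UNIV"
  shows "(\<lambda>(m, n). f m * g n) abs_summable_on UNIV"
    and "infsum f UNIV * infsum g UNIV = (\<Sum>\<^sub>\<infinity>(m, n). f m * g n)"
proof -
  have "(\<lambda>(m, n). f m * g n) abs_summable_on (UNIV \<times> UNIV)"
    unfolding Infinite_Sum.abs_summable_on_Sigma_iff
  proof (intro conjI ballI)
    fix m show "(\<lambda>n. norm (case (m, n) of (m, n) \<Rightarrow> f m * g n)) summable_on UNIV"
      using summable_on_cmult_right[OF assms(2), of "norm (f m)"] by (simp add: norm_mult)
  next
    have "(\<lambda>m. norm (f m) * infsum (\<lambda>n. norm (g n)) UNIV) summable_on UNIV"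
      by (rule summable_on_cmult_left[OF assms(1)])
    then show "(\<lambda>m. norm (\<Sum>\<^sub>\<infinity>n. norm (case (m, n) of (m, n) \<Rightarrow> f m * g n))) summable_on UNIV"
      by (simp add: norm_mult infsum_cmult_right' abs_mult infsum_nonneg)
  qed
  then show s: "(\<lambda>(m, n). f m * g n) abs_summable_on UNIV" by simp
  have "(\<Sum>\<^sub>\<infinity>(m, n). f m * g n) = (\<Sum>\<^sub>\<infinity>m. \<Sum>\<^sub>\<infinity>n. f m * g n)"
    using infsum_Sigma'_banach[of "\<lambda>m n. f m * g n" UNIV "\<lambda>_. UNIV"] abs_summable_summable[OF s] by simp
  then show "infsum f UNIV * infsum g UNIV = (\<Sum>\<^sub>\<infinity>(m, n). f m * g n)"
    by (simp add: infsum_cmult_right' infsum_cmult_left')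
qed

text \<open>The index-two sublattice \<open>m + n\<close> even of the square lattice is the square lattice rotated by
  forty-five degrees; this is the source of all doubling formulas for theta constants.\<close>
lemma infsum_int_prod_parity:
  fixes f :: "int \<times> int \<Rightarrow> complex"
  assumes "f summable_on UNIV"
  shows "infsum f UNIV = (\<Sum>\<^sub>\<infinity>(u, v). f (u + v, u - v)) + (\<Sum>\<^sub>\<infinity>(u, v). f (u + v + 1, u - v))"
proof -
  let ?E = "{p::int \<times> int. even (fst p + snd p)}" and ?O = "{p::int \<times> int. odd (fst p + snd p)}"
  have half: "even (m + n) \<Longrightarrow> (m + n) div 2 + (m - n) div 2 = m" "even (m + n) \<Longrightarrow> (m + n) div 2 - (m - n) div 2 = n"
    "odd (m + n) \<Longrightarrow> (m + n) div 2 + (m - n) div 2 + 1 = m" "odd (m + n) \<Longrightarrow> (m + n) div 2 - (m - n) div 2 = n"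
    "(u + v + (u - v)) div 2 = u" "(u + v - (u - v)) div 2 = v"
    "(u + v + 1 + (u - v)) div 2 = u" "(u + v + 1 - (u - v)) div 2 = v" for m n u v :: int
    by presburger+
  have U: "?E \<union> ?O = UNIV" by blast
  have "infsum f (?E \<union> ?O) = infsum f ?E + infsum f ?O"
    by (rule infsum_Un_disjoint) (use summable_on_subset_banach[OF assms] in auto)
  also have "infsum f ?E = (\<Sum>\<^sub>\<infinity>p. f (fst p + snd p, fst p - snd p))"
  proof (rule infsum_reindex_bij_witness[of ?E "\<lambda>p. (fst p + snd p, fst p - snd p)"
          "\<lambda>p. ((fst p + snd p) div 2, (fst p - snd p) div 2)"])
    fix p :: "int \<times> int" show "(fst p + snd p, fst p - snd p) \<in> ?E" by simp
  qed (simp_all add: half del: even_add odd_add)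
  also have "infsum f ?O = (\<Sum>\<^sub>\<infinity>p. f (fst p + snd p + 1, fst p - snd p))"
  proof (rule infsum_reindex_bij_witness[of ?O "\<lambda>p. (fst p + snd p + 1, fst p - snd p)"
          "\<lambda>p. ((fst p + snd p) div 2, (fst p - snd p) div 2)"])
    fix p :: "int \<times> int" show "(fst p + snd p + 1, fst p - snd p) \<in> ?O" by simp
  qed (simp_all add: half del: even_add odd_add)
  finally show ?thesis unfolding U by (simp add: case_prod_unfold)
qed

lemma infsum_product_parity:
  fixes f g f1 g1 f2 g2 :: "int \<Rightarrow> complex"
  assumes "f abs_summable_on UNIV" "g abs_summable_on UNIV"
    and "f1 abs_summable_on UNIV" "g1 abs_summable_on UNIV"
    and "f2 abs_summable_on UNIV" "g2 abs_summable_on UNIV"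
    and "\<And>u v. f (u + v) * g (u - v) = f1 u * g1 v"
    and "\<And>u v. f (u + v + 1) * g (u - v) = f2 u * g2 v"
  shows "infsum f UNIV * infsum g UNIV = infsum f1 UNIV * infsum g1 UNIV + infsum f2 UNIV * infsum g2 UNIV"
  unfolding infsum_product_int(2)[OF assms(1,2)] infsum_product_int(2)[OF assms(3,4)] infsum_product_int(2)[OF assms(5,6)]
  by (subst infsum_int_prod_parity[OF abs_summable_summable[OF infsum_product_int(1)[OF assms(1,2)]]]) (simp add: assms(7,8))

lemma infsum_int_shift: "(\<Sum>\<^sub>\<infinity>n::int. f (n + k)) = (\<Sum>\<^sub>\<infinity>n. f n)"
  by (rule infsum_reindex_bij_witness[of _ "\<lambda>n. n - k" "\<lambda>n. n + k"]) auto

lemma abs_summable_int_shift: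
  assumes "f abs_summable_on (UNIV :: int set)"
  shows "(\<lambda>n. f (n + k)) abs_summable_on UNIV"
proof -
  have "bij_betw (\<lambda>n::int. n + k) UNIV UNIV"
    by (rule bij_betwI[of _ _ _ "\<lambda>n. n - k"]) auto
  from summable_on_reindex_bij_betw[OF this, of "\<lambda>n. norm (f n)"] show ?thesis using assms by simp
qed

lemma th3_sq:
  assumes "Im \<tau> > 0"
  shows "th3 \<tau> ^ 2 = th3 (2 * \<tau>) ^ 2 + th2 (2 * \<tau>) ^ 2"
  unfolding power2_eq_square th3_def th2_def quad_series_def
proof -
  let ?E3 = "\<lambda>\<tau> n::int. exp (of_real pi * \<i> * of_real (of_int n * of_int n) * \<tau>)"
  let ?E2 = "\<lambda>\<tau> n::int. exp (of_real pi * \<i> * of_real ((of_int n + 1/2) * (of_int n + 1/2)) * \<tau>)"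
  have A: "?E3 \<tau> abs_summable_on UNIV" "?E3 (2 * \<tau>) abs_summable_on UNIV" "?E2 (2 * \<tau>) abs_summable_on UNIV"
    using th3_abs[of \<tau>] th3_abs[of "2 * \<tau>"] th2_abs[of "2 * \<tau>"] assms by (simp_all add: power2_eq_square)
  show "infsum (?E3 \<tau>) UNIV * infsum (?E3 \<tau>) UNIV = infsum (?E3 (2 * \<tau>)) UNIV * infsum (?E3 (2 * \<tau>)) UNIV +
     infsum (?E2 (2 * \<tau>)) UNIV * infsum (?E2 (2 * \<tau>)) UNIV"
    by (rule infsum_product_parity; (intro A)?) (auto simp flip: exp_add intro!: arg_cong[where f = exp], (simp add: field_simps)+)
qed

lemma th2_sq:
  assumes "Im \<tau> > 0"
  shows "th2 \<tau> ^ 2 = 2 * th2 (2 * \<tau>) * th3 (2 * \<tau>)"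
proof -
  let ?E3 = "\<lambda>\<tau> n::int. exp (of_real pi * \<i> * of_real (of_int n * of_int n) * \<tau>)"
  let ?E2 = "\<lambda>\<tau> n::int. exp (of_real pi * \<i> * of_real ((of_int n + 1/2) * (of_int n + 1/2)) * \<tau>)"
  have A: "?E2 \<tau> abs_summable_on UNIV" "?E3 (2 * \<tau>) abs_summable_on UNIV" "?E2 (2 * \<tau>) abs_summable_on UNIV"
    using th2_abs[of \<tau>] th3_abs[of "2 * \<tau>"] th2_abs[of "2 * \<tau>"] assms by (simp_all add: power2_eq_square)
  have B: "(\<lambda>n. ?E3 (2 * \<tau>) (n + 1)) abs_summable_on UNIV"
    by (rule abs_summable_int_shift[OF A(2)])
  have "infsum (?E2 \<tau>) UNIV * infsum (?E2 \<tau>) UNIV = infsum (?E2 (2 * \<tau>)) UNIV * infsum (?E3 (2 * \<tau>)) UNIV +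
     (\<Sum>\<^sub>\<infinity>n. ?E3 (2 * \<tau>) (n + 1)) * infsum (?E2 (2 * \<tau>)) UNIV"
    by (rule infsum_product_parity; (intro A B)?) (auto simp flip: exp_add intro!: arg_cong[where f = exp], (simp add: field_simps)+)
  also have "(\<Sum>\<^sub>\<infinity>n. ?E3 (2 * \<tau>) (n + 1)) = infsum (?E3 (2 * \<tau>)) UNIV"
    by (rule infsum_int_shift)
  finally show ?thesis unfolding power2_eq_square th3_def th2_def quad_series_def by (simp add: mult_ac)
qed

lemma th4_sq:
  assumes "Im \<tau> > 0"
  shows "th4 \<tau> ^ 2 = th3 (2 * \<tau>) ^ 2 - th2 (2 * \<tau>) ^ 2"
proof -
  have "th2 (2 * \<tau> + 1 + 1) ^ 2 = - (th2 (2 * \<tau>) ^ 2)"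
    by (simp only: th2_plus1_sq) simp
  then have "th2 (2 * \<tau> + 2) ^ 2 = - (th2 (2 * \<tau>) ^ 2)" by (simp add: add.assoc)
  moreover have "th3 (2 * \<tau> + 2) = th3 (2 * \<tau>)" by (rule th3_plus2)
  ultimately show ?thesis
    using th3_sq[of "\<tau> + 1"] assms by (simp add: th4_def ring_distribs)
qed

lemma jacobi_theta_identity:
  assumes "Im \<tau> > 0"
  shows "th3 \<tau> ^ 4 = th2 \<tau> ^ 4 + th4 \<tau> ^ 4"
proof -
  have *: "x ^ 4 = (x ^ 2) ^ 2" for x :: complex by simp
  show ?thesis unfolding * th3_sq[OF assms] th2_sq[OF assms] th4_sq[OF assms]
    by (simp add: power2_eq_square algebra_simps)
qed

section \<open>The inversion formulas\<close>

text \<open>The Gaussian is, up to scaling, its own Fourier transform: this is the characteristic function of the normal distribution.\<close>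
lemma gaussian_fourier:
  fixes t :: real and k :: int
  assumes "t > 0"
  shows "((\<lambda>x. of_real (exp (- pi * t * x\<^sup>2)) * exp (- (2 * of_real pi * \<i> * of_int k * of_real x)))
          has_integral complex_of_real (exp (- pi * (of_int k)\<^sup>2 / t) / sqrt t)) UNIV"
proof -
  define c where "c = sqrt (2 * pi * t)"
  define s where "s = - (2 * pi * of_int k) / c"
  have c: "c > 0" using assms by (simp add: c_def)
  have c2: "c\<^sup>2 = 2 * pi * t" using assms by (simp add: c_def)
  define g where "g = (\<lambda>x. complex_of_real (std_normal_density x) * exp (\<i> * of_real (s * x)))"
  have int: "integrable lborel g"
  proof (rule Bochner_Integration.integrable_bound)
    show "integrable lborel std_normal_density" by simp
    show "AE x in lborel. norm (g x) \<le> norm (std_normal_density x)"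
      by (simp add: g_def norm_mult)
  qed (simp add: g_def)
  have "char std_normal_distribution s = (LINT x|lborel. std_normal_density x *\<^sub>R exp (\<i> * of_real (s * x)))"
    unfolding char_def by (subst integral_density) (auto simp: normal_density_nonneg)
  then have val: "integral\<^sup>L lborel g = complex_of_real (exp (- (s\<^sup>2) / 2))"
    by (simp add: char_std_normal_distribution g_def scaleR_conv_of_real)
  have int2: "integrable lborel (\<lambda>x. g (0 + c * x))"
    using lborel_integrable_real_affine[OF int, of c 0] c by simp
  have "integral\<^sup>L lborel g = \<bar>c\<bar> *\<^sub>R integral\<^sup>L lborel (\<lambda>x. g (0 + c * x))"
    by (rule lborel_integral_real_affine) (use c in simp)
  then have val2: "integral\<^sup>L lborel (\<lambda>x. g (0 + c * x)) = complex_of_real (exp (- (s\<^sup>2) / 2) / c)"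
    using c val by (simp add: scaleR_conv_of_real field_simps)
  have "((\<lambda>x. g (0 + c * x)) has_integral complex_of_real (exp (- (s\<^sup>2) / 2) / c)) UNIV"
    using has_integral_integral_lborel[OF int2] val2 by simp
  then have "((\<lambda>x. complex_of_real (sqrt (2 * pi)) * g (0 + c * x)) has_integral
       complex_of_real (sqrt (2 * pi)) * complex_of_real (exp (- (s\<^sup>2) / 2) / c)) UNIV"
    by (rule has_integral_mult_right)
  moreover have "complex_of_real (sqrt (2 * pi)) * g (0 + c * x) =
      of_real (exp (- pi * t * x\<^sup>2)) * exp (- (2 * of_real pi * \<i> * of_int k * of_real x))" for x
  proof -
    have "sqrt (2 * pi) * std_normal_density (c * x) = exp (- pi * t * x\<^sup>2)"
      using c2 by (simp add: std_normal_density_def power_mult_distrib)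
    moreover have "\<i> * of_real (s * (c * x)) = - (2 * of_real pi * \<i> * of_int k * of_real x)"
      using c by (simp add: s_def)
    ultimately show ?thesis
      unfolding g_def by (simp only: add_0 mult.assoc[symmetric] of_real_mult[symmetric])
  qed
  moreover have s2: "s\<^sup>2 / 2 = pi * (of_int k)\<^sup>2 / t"
    using assms c2 by (simp add: s_def power_divide power_mult_distrib field_simps power2_eq_square)
  moreover have "sqrt (2 * pi) / c = 1 / sqrt t"
    using assms by (simp add: c_def real_sqrt_mult)
  moreover have "complex_of_real (sqrt (2 * pi)) * complex_of_real (exp (- (s\<^sup>2) / 2) / c) =
      complex_of_real (exp (- pi * (of_int k)\<^sup>2 / t) / sqrt t)"
  proof -
    have "sqrt (2 * pi) * (exp (- (s\<^sup>2) / 2) / c) = exp (- (s\<^sup>2 / 2)) * (sqrt (2 * pi) / c)" by simp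
    also have "\<dots> = exp (- pi * (of_int k)\<^sup>2 / t) / sqrt t"
      using assms by (simp only: s2) (simp add: c_def real_sqrt_mult)
    finally show ?thesis by (simp only: of_real_mult[symmetric])
  qed
  ultimately show ?thesis by (simp only:)
qed

definition fchar :: "int \<Rightarrow> real \<Rightarrow> complex" where
  "fchar k x = exp (2 * of_real pi * \<i> * of_int k * of_real x)"

lemma fchar_simps: "fchar 0 x = 1" "fchar k 0 = 1" "fchar k 1 = 1" "cnj (fchar k x) = fchar (- k) x"
  "fchar (k + l) x = fchar k x * fchar l x" "norm (fchar k x) = 1"
  using exp_integer_2pi[of "of_int k"]
  by (simp_all add: fchar_def exp_cnj mult_ac norm_exp_eq_Re flip: exp_add add: algebra_simps)

lemma fchar_cont [continuous_intros]: "continuous_on A (fchar k)"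
  unfolding fchar_def by (intro continuous_intros)

lemma fchar_integral: "(fchar k has_integral (if k = 0 then 1 else 0)) {0..1}"
proof (cases "k = 0")
  case True
  moreover have "fchar 0 = (\<lambda>_. 1)" by (simp add: fchar_def fun_eq_iff)
  ultimately show ?thesis using has_integral_const_real[of "1::complex" 0 1] by simp
next
  case False
  define a where "a = 2 * of_real pi * \<i> * of_int k"
  have a: "a \<noteq> 0" using False by (simp add: a_def)
  have "((\<lambda>x. exp (a * of_real x)) has_integral exp (a * of_real 1) / a - exp (a * of_real 0) / a) {0..1}"
  proof (rule fundamental_theorem_of_calculus)
    fix x :: real
    have "((\<lambda>z. exp (a * z) / a) has_field_derivative exp (a * of_real x)) (at (of_real x))"
      by (rule derivative_eq_intros refl | use a in simp)+
    then show "((\<lambda>x. exp (a * of_real x) / a) has_vector_derivative exp (a * of_real x)) (at x within {0..1})"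
      by (rule has_vector_derivative_real_field)
  qed simp
  moreover have "exp (a * of_real 1) = 1" using fchar_simps(3)[of k] by (simp add: fchar_def a_def)
  moreover have "fchar k = (\<lambda>x. exp (a * of_real x))" by (simp add: fchar_def a_def fun_eq_iff)
  ultimately show ?thesis using False by simp
qed

lemma bessel_inequality:
  fixes g :: "real \<Rightarrow> complex"
  assumes g: "continuous_on {0..1} g" and K: "finite K"
  defines "c \<equiv> \<lambda>k. integral {0..1} (\<lambda>x. g x * fchar (- k) x)"
  shows "(\<Sum>k\<in>K. (norm (c k))\<^sup>2) \<le> integral {0..1} (\<lambda>x. (norm (g x))\<^sup>2)"
proof -
  define S where "S = (\<lambda>x. \<Sum>k\<in>K. c k * fchar k x)"
  define T where "T = (\<Sum>k\<in>K. (norm (c k))\<^sup>2)"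
  have gi: "((\<lambda>x. g x * fchar (- k) x) has_integral c k) {0..1}" for k
    unfolding c_def by (intro integrable_integral integrable_continuous_real continuous_intros g)
  have 1: "((\<lambda>x. g x * cnj (S x)) has_integral of_real T) {0..1}"
  proof -
    have "((\<lambda>x. \<Sum>k\<in>K. cnj (c k) * (g x * fchar (- k) x)) has_integral (\<Sum>k\<in>K. cnj (c k) * c k)) {0..1}"
      by (intro has_integral_sum K has_integral_mult_right gi)
    moreover have "(\<Sum>k\<in>K. cnj (c k) * (g x * fchar (- k) x)) = g x * cnj (S x)" for x
      by (simp add: S_def sum_distrib_left fchar_simps mult_ac)
    moreover have "(\<Sum>k\<in>K. cnj (c k) * c k) = of_real T"
      unfolding T_def of_real_sum by (simp only: complex_norm_square mult.commute)
    ultimately show ?thesis by simp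
  qed
  have 2: "((\<lambda>x. S x * cnj (S x)) has_integral of_real T) {0..1}"
  proof -
    have "((\<lambda>x. \<Sum>k\<in>K. \<Sum>l\<in>K. (c k * cnj (c l)) * fchar (k - l) x) has_integral
          (\<Sum>k\<in>K. \<Sum>l\<in>K. (c k * cnj (c l)) * (if k - l = 0 then 1 else 0))) {0..1}"
      by (intro has_integral_sum K has_integral_mult_right fchar_integral)
    moreover have "(\<Sum>l\<in>K. (c k * cnj (c l)) * (if k - l = 0 then 1 else 0)) = of_real ((norm (c k))\<^sup>2)" if "k \<in> K" for k
    proof -
      have "(\<Sum>l\<in>K. (c k * cnj (c l)) * (if k - l = 0 then 1 else 0)) = (\<Sum>l\<in>K. if l = k then c k * cnj (c k) else 0)"
        by (rule sum.cong) auto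
      also have "\<dots> = c k * cnj (c k)" using K that by simp
      finally show ?thesis by (simp only: complex_norm_square)
    qed
    moreover have "(\<Sum>k\<in>K. \<Sum>l\<in>K. (c k * cnj (c l)) * fchar (k - l) x) = S x * cnj (S x)" for x
      by (simp add: S_def sum_product fchar_simps mult_ac fchar_simps(5)[of _ "- _", simplified])
    ultimately show ?thesis by (simp add: T_def)
  qed
  have 3: "((\<lambda>x. cnj (g x) * S x) has_integral of_real T) {0..1}"
  proof -
    have "((\<lambda>x. cnj (g x * cnj (S x))) has_integral cnj (of_real T)) {0..1}"
      using has_integral_linear[OF 1 bounded_linear_cnj] by (simp add: o_def)
    then show ?thesis by simp
  qed
  have 4: "((\<lambda>x. g x * cnj (g x)) has_integral of_real (integral {0..1} (\<lambda>x. (norm (g x))\<^sup>2))) {0..1}"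
  proof -
    have "((\<lambda>x. (norm (g x))\<^sup>2) has_integral integral {0..1} (\<lambda>x. (norm (g x))\<^sup>2)) {0..1}"
      by (intro integrable_integral integrable_continuous_real continuous_intros g)
    from has_integral_linear[OF this bounded_linear_of_real[where 'a = complex]] show ?thesis
      by (simp only: o_def complex_norm_square)
  qed
  have "((\<lambda>x. g x * cnj (g x) - g x * cnj (S x) - cnj (g x) * S x + S x * cnj (S x)) has_integral
        of_real (integral {0..1} (\<lambda>x. (norm (g x))\<^sup>2)) - of_real T - of_real T + of_real T) {0..1}"
    by (intro has_integral_add has_integral_diff 1 2 3 4)
  moreover have "g x * cnj (g x) - g x * cnj (S x) - cnj (g x) * S x + S x * cnj (S x) = of_real ((norm (g x - S x))\<^sup>2)" for x
    unfolding complex_norm_square by (simp add: algebra_simps)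
  ultimately have "((\<lambda>x. complex_of_real ((norm (g x - S x))\<^sup>2)) has_integral
        of_real (integral {0..1} (\<lambda>x. (norm (g x))\<^sup>2) - T)) {0..1}" by simp
  from has_integral_linear[OF this bounded_linear_Re]
  have "((\<lambda>x. (norm (g x - S x))\<^sup>2) has_integral (integral {0..1} (\<lambda>x. (norm (g x))\<^sup>2) - T)) {0..1}"
    by (simp add: o_def)
  then have "0 \<le> integral {0..1} (\<lambda>x. (norm (g x))\<^sup>2) - T"
    by (rule has_integral_nonneg) simp
  then show ?thesis by (simp add: T_def)
qed

text \<open>Bessel's inequality makes the squares of the coefficients summable.\<close>
lemma fourier_coeff_null:
  fixes g :: "real \<Rightarrow> complex"
  assumes g: "continuous_on {0..1} g"
  defines "c \<equiv> \<lambda>k. integral {0..1} (\<lambda>x. g x * fchar (- k) x)"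
  shows "(\<lambda>n. c (int n)) \<longlonglongrightarrow> 0" "(\<lambda>n. c (- int n)) \<longlonglongrightarrow> 0"
proof -
  have "(\<lambda>n. c (u * int n)) \<longlonglongrightarrow> 0" if u: "u \<noteq> 0" for u
  proof -
    have "summable (\<lambda>n. (norm (c (u * int n)))\<^sup>2)"
    proof (rule summableI_nonneg_bounded)
      fix N
      have "(\<Sum>n<N. (norm (c (u * int n)))\<^sup>2) = (\<Sum>k\<in>(\<lambda>n. u * int n) ` {..<N}. (norm (c k))\<^sup>2)"
        by (subst sum.reindex) (use u in \<open>auto simp: inj_on_def\<close>)
      also have "\<dots> \<le> integral {0..1} (\<lambda>x. (norm (g x))\<^sup>2)"
        unfolding c_def by (rule bessel_inequality[OF g]) simp
      finally show "(\<Sum>n<N. (norm (c (u * int n)))\<^sup>2) \<le> integral {0..1} (\<lambda>x. (norm (g x))\<^sup>2)" .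
    qed simp
    then have "(\<lambda>n. (norm (c (u * int n)))\<^sup>2) \<longlonglongrightarrow> 0" by (rule summable_LIMSEQ_zero)
    then have "(\<lambda>n. sqrt ((norm (c (u * int n)))\<^sup>2)) \<longlonglongrightarrow> sqrt 0" by (rule tendsto_real_sqrt)
    then show ?thesis by (simp add: tendsto_norm_zero_iff)
  qed
  from this[of 1] this[of "-1"] show "(\<lambda>n. c (int n)) \<longlonglongrightarrow> 0" "(\<lambda>n. c (- int n)) \<longlonglongrightarrow> 0" by simp_all
qed

text \<open>Chernoff's trick: dividing \<open>F - F(0)\<close> by \<open>e(x) - 1\<close> turns the Fourier coefficients of \<open>F\<close> into
  differences, so that the symmetric partial sums of the Fourier series at \<open>0\<close> telescope.\<close>
lemma fourier_series_at_0:
  fixes G :: "complex \<Rightarrow> complex"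
  defines "F \<equiv> \<lambda>x::real. G (of_real x)"
  assumes F: "continuous_on {0..1} F"
    and d0: "(G has_field_derivative D) (at 0)" and d1: "(G has_field_derivative D) (at 1)" and per: "F 1 = F 0"
  shows "(\<lambda>N. \<Sum>k=-int N..int N. integral {0..1} (\<lambda>x. F x * fchar (- k) x)) \<longlonglongrightarrow> F 0"
proof -
  define g where "g x = (if x \<in> {0, 1} then D / (2 * of_real pi * \<i>) else (F x - F 0) / (fchar 1 x - 1))" for x
  have quot: "((\<lambda>x. (f (of_real x) - f (of_real a)) / of_real (x - a)) \<longlongrightarrow> d) (at a)"
    if "(f has_field_derivative d) (at (of_real a))" for f :: "complex \<Rightarrow> complex" and d and a :: real
  proof -
    have "filterlim complex_of_real (at (of_real a)) (at a)"
      by (intro filterlim_atI tendsto_intros) (auto simp: eventually_at_filter)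
    from filterlim_compose[OF that[unfolded has_field_derivative_iff] this] show ?thesis by simp
  qed
  have fd: "((\<lambda>z. exp (2 * of_real pi * \<i> * z)) has_field_derivative 2 * of_real pi * \<i>) (at (of_real a))"
    if "a \<in> {0, 1}" for a :: real
  proof -
    have e: "exp (2 * of_real pi * \<i> * of_real a) = 1"
      using that fchar_simps(2,3)[of 1] by (auto simp: fchar_def)
    show ?thesis
      by (rule derivative_eq_intros refl | use e in simp)+
  qed
  have ne: "fchar 1 x \<noteq> 1" if "0 < x" "x < 1" for x
  proof
    assume "fchar 1 x = 1"
    then have "exp (of_real (2 * pi * x) * \<i>) = 1" by (simp add: fchar_def mult_ac)
    then obtain n :: int where "2 * pi * x = of_int (2 * n) * pi" using exp_eq_1 by auto
    then have "x = of_int n" by simp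
    then show False using that by (simp add: \<open>x = _\<close>)
  qed
  have lim: "((\<lambda>x. (F x - F 0) / (fchar 1 x - 1)) \<longlongrightarrow> D / (2 * of_real pi * \<i>)) (at a)" if a: "a \<in> {0, 1}" for a
  proof -
    have Fa: "F a = F 0" and ea: "fchar 1 a = 1" using a per by (auto simp: fchar_simps)
    have "((\<lambda>x. (F x - F a) / of_real (x - a)) \<longlongrightarrow> D) (at a)"
      unfolding F_def by (rule quot) (use a d0 d1 in auto)
    moreover have "((\<lambda>x. (fchar 1 x - fchar 1 a) / of_real (x - a)) \<longlongrightarrow> 2 * of_real pi * \<i>) (at a)"
      using quot[OF fd[OF a]] by (simp add: fchar_def)
    ultimately have "((\<lambda>x. ((F x - F a) / of_real (x - a)) / ((fchar 1 x - fchar 1 a) / of_real (x - a))) \<longlongrightarrow> D / (2 * of_real pi * \<i>)) (at a)"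
      by (rule tendsto_divide) simp
    then show ?thesis
      by (rule Lim_transform_eventually) (auto simp: Fa ea eventually_at_filter)
  qed
  have gcont: "continuous_on {0..1} g"
    unfolding continuous_on_def
  proof
    fix a :: real assume a: "a \<in> {0..1}"
    show "(g \<longlongrightarrow> g a) (at a within {0..1})"
    proof (cases "a \<in> {0, 1}")
      case True
      have "eventually (\<lambda>x. x \<in> {0..1} \<longrightarrow> g x = (F x - F 0) / (fchar 1 x - 1)) (at a)"
      proof -
        have "eventually (\<lambda>x. x \<noteq> 0 \<and> x \<noteq> 1) (at a)"
          using eventually_neq_at_within[of 0 a UNIV] eventually_neq_at_within[of 1 a UNIV] by (rule eventually_conj)
        then show ?thesis by eventually_elim (auto simp: g_def)
      qed
      then have "eventually (\<lambda>x. (F x - F 0) / (fchar 1 x - 1) = g x) (at a within {0..1})"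
        by (auto simp: eventually_at_filter elim!: eventually_mono)
      moreover have "((\<lambda>x. (F x - F 0) / (fchar 1 x - 1)) \<longlongrightarrow> g a) (at a within {0..1})"
        using lim[OF True] True by (intro tendsto_within_subset[OF lim[OF True], THEN tendsto_eq_rhs]) (auto simp: g_def)
      ultimately show ?thesis by (rule Lim_transform_eventually[rotated])
    next
      case False
      then have a': "0 < a" "a < 1" using a by auto
      have "isCont (\<lambda>x. (F x - F 0) / (fchar 1 x - 1)) a"
        using a' ne continuous_on_interior[OF F, of a] continuous_on_interior[OF fchar_cont[of "{0..1}" 1], of a]
        by (intro continuous_intros) auto
      then have "((\<lambda>x. (F x - F 0) / (fchar 1 x - 1)) \<longlongrightarrow> g a) (at a)"
        using False by (simp add: isCont_def g_def)
      moreover have "eventually (\<lambda>x. x \<in> {0<..<1}) (at a)"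
        using a' by (intro eventually_at_in_open') auto
      then have "eventually (\<lambda>x. (F x - F 0) / (fchar 1 x - 1) = g x) (at a)"
        by eventually_elim (auto simp: g_def)
      ultimately have "(g \<longlongrightarrow> g a) (at a)" by (rule Lim_transform_eventually)
      then show ?thesis by (rule tendsto_within_subset) simp
    qed
  qed
  define c where "c k = integral {0..1} (\<lambda>x. g x * fchar (- k) x)" for k
  have gi: "((\<lambda>x. g x * fchar (- k) x) has_integral c k) {0..1}" for k
    unfolding c_def by (intro integrable_integral integrable_continuous_real continuous_intros gcont)
  have Fc: "integral {0..1} (\<lambda>x. F x * fchar (- k) x) = c (k - 1) - c k + (if k = 0 then F 0 else 0)" for k
  proof -
    have "((\<lambda>x. g x * fchar (- (k - 1)) x - g x * fchar (- k) x + F 0 * fchar (- k) x) has_integral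
        c (k - 1) - c k + F 0 * (if - k = 0 then 1 else 0)) {0..1}"
      by (intro has_integral_add has_integral_diff gi has_integral_mult_right fchar_integral)
    moreover have "g x * fchar (- (k - 1)) x - g x * fchar (- k) x + F 0 * fchar (- k) x = F x * fchar (- k) x"
      if "x \<in> {0..1}" for x
    proof (cases "x \<in> {0, 1}")
      case True
      then show ?thesis using per by (auto simp: fchar_simps)
    next
      case False
      have "fchar (- (k - 1)) x = fchar 1 x * fchar (- k) x"
        using fchar_simps(5)[of 1 "- k" x] by simp
      then have "g x * fchar (- (k - 1)) x - g x * fchar (- k) x = (g x * (fchar 1 x - 1)) * fchar (- k) x"
        by (simp add: algebra_simps)
      also have "g x * (fchar 1 x - 1) = F x - F 0"
        using ne[of x] False that by (auto simp: g_def)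
      finally show ?thesis by (simp add: algebra_simps)
    qed
    ultimately have "((\<lambda>x. F x * fchar (- k) x) has_integral c (k - 1) - c k + F 0 * (if - k = 0 then 1 else 0)) {0..1}"
      by (subst (asm) has_integral_cong)
    then show ?thesis by (auto dest!: integral_unique)
  qed
  have "(\<Sum>k=-int N..int N. integral {0..1} (\<lambda>x. F x * fchar (- k) x)) = c (- int (Suc N)) - c (int N) + F 0" for N
  proof (induction N)
    case 0
    then show ?case using Fc[of 0] by simp
  next
    case (Suc N)
    have "{-int (Suc N)..int (Suc N)} = insert (int (Suc N)) (insert (- int (Suc N)) {-int N..int N})" by auto
    then have "(\<Sum>k=-int (Suc N)..int (Suc N). integral {0..1} (\<lambda>x. F x * fchar (- k) x)) =
       integral {0..1} (\<lambda>x. F x * fchar (- int (Suc N)) x) + (integral {0..1} (\<lambda>x. F x * fchar (- (- int (Suc N))) x)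
         + (\<Sum>k=-int N..int N. integral {0..1} (\<lambda>x. F x * fchar (- k) x)))"
      by simp
    also have "\<dots> = c (int (Suc N) - 1) - c (int (Suc N)) + (c (- int (Suc N) - 1) - c (- int (Suc N)) + (c (- int (Suc N)) - c (int N) + F 0))"
      unfolding Suc.IH unfolding Fc by simp
    finally show ?case by (simp add: algebra_simps)
  qed
  moreover have "(\<lambda>N. c (- int (Suc N)) - c (int N) + F 0) \<longlonglongrightarrow> 0 - 0 + F 0"
    using fourier_coeff_null[OF gcont] unfolding c_def by (intro tendsto_intros LIMSEQ_Suc)
  ultimately show ?thesis by simp
qed

lemma filterlim_int_intervals:
  "filterlim (\<lambda>N. {-int N..<int N}) (finite_subsets_at_top UNIV) sequentially"
  "filterlim (\<lambda>N. {-int N..int N}) (finite_subsets_at_top UNIV) sequentially"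
proof -
  have *: "\<forall>\<^sub>F N in sequentially. X \<subseteq> {-int N..<int N}" if X: "finite X" for X :: "int set"
  proof -
    have "\<forall>\<^sub>F N in sequentially. x \<in> {-int N..<int N}" for x
      using eventually_gt_at_top[of "nat \<bar>x\<bar>"] by eventually_elim auto
    then have "\<forall>\<^sub>F N in sequentially. \<forall>x\<in>X. x \<in> {-int N..<int N}"
      using X by (simp add: eventually_ball_finite)
    then show ?thesis by (simp add: subset_iff Ball_def)
  qed
  show "filterlim (\<lambda>N. {-int N..<int N}) (finite_subsets_at_top UNIV) sequentially"
    unfolding filterlim_finite_subsets_at_top using * by auto
  show "filterlim (\<lambda>N. {-int N..int N}) (finite_subsets_at_top UNIV) sequentially"
    unfolding filterlim_finite_subsets_at_top
  proof safe
    fix X :: "int set" assume "finite X"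
    from *[OF this] show "\<forall>\<^sub>F N in sequentially. finite {-int N..int N} \<and> X \<subseteq> {-int N..int N} \<and> {-int N..int N} \<subseteq> UNIV"
      by eventually_elim fastforce
  qed
qed

lemma integral_Icc_LIMSEQ:
  fixes f :: "real \<Rightarrow> complex"
  assumes "(f has_integral I) UNIV"
  shows "(\<lambda>N. integral {- real N..real N} f) \<longlonglongrightarrow> I"
proof (rule LIMSEQ_I)
  fix e :: real assume "e > 0"
  with assms obtain B where B: "\<And>a b. ball 0 B \<subseteq> cbox a b \<Longrightarrow> norm (integral (cbox a b) f - I) < e"
    unfolding has_integral_alt' by auto metis
  obtain N where N: "real N > B" using reals_Archimedean2 by blast
  show "\<exists>N. \<forall>n\<ge>N. norm (integral {- real n..real n} f - I) < e"
  proof (intro exI allI impI)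
    fix n assume "n \<ge> N"
    then have "ball 0 B \<subseteq> cbox (- real n) (real n)" using N by (auto simp: dist_norm)
    from B[OF this] show "norm (integral {- real n..real n} f - I) < e" by simp
  qed
qed

lemma integral_sum_unit_intervals:
  fixes h :: "real \<Rightarrow> complex"
  assumes h: "continuous_on UNIV h"
  shows "(\<Sum>n=-int N..<int N. integral {0..1} (\<lambda>x. h (x + of_int n))) = integral {- real N..real N} h"
proof (induction N)
  case (Suc N)
  have sh: "integral {0..1} (\<lambda>x. h (x + of_int n)) = integral {of_int n..of_int n + 1} h" for n
    using integral_shift_Icc_real[of 0 1 h "of_int n"] by (simp add: o_def add.commute)
  have "{-int (Suc N)..<int (Suc N)} = insert (- int (Suc N)) (insert (int N) {-int N..<int N})" by auto
  then have "(\<Sum>n=-int (Suc N)..<int (Suc N). integral {0..1} (\<lambda>x. h (x + of_int n))) =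
     integral {- real (Suc N).. - real N} h + (integral {real N..real (Suc N)} h + integral {- real N..real N} h)"
    using Suc.IH by (simp add: sh add_ac)
  also have "integral {real N..real (Suc N)} h + integral {- real N..real N} h = integral {- real N..real (Suc N)} h"
    using Henstock_Kurzweil_Integration.integral_combine[where a = "- real N" and c = "real N" and b = "real (Suc N)" and f = h]
    by (simp add: integrable_continuous_real continuous_on_subset[OF h] add_ac)
  also have "integral {- real (Suc N).. - real N} h + \<dots> = integral {- real (Suc N)..real (Suc N)} h"
    using Henstock_Kurzweil_Integration.integral_combine[where a = "- real (Suc N)" and c = "- real N" and b = "real (Suc N)" and f = h]
    by (simp add: integrable_continuous_real continuous_on_subset[OF h] add_ac)
  finally show ?case .
qed simp

text \<open>The periodization of the Gaussian is differentiable, hence equals its Fourier series at \<open>0\<close>, and its Fourier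
  coefficients unfold to integrals over the whole line.\<close>
lemma gaussian_poisson:
  assumes t: "t > 0"
  shows "(\<Sum>\<^sub>\<infinity>n::int. complex_of_real (exp (- pi * t * (of_int n)\<^sup>2))) =
         (\<Sum>\<^sub>\<infinity>k::int. complex_of_real (exp (- pi * (of_int k)\<^sup>2 / t) / sqrt t))"
proof -
  define f where "f = (\<lambda>(n::int) z::complex. exp (- of_real (pi * t) * (z + of_int n)\<^sup>2))"
  define G where "G = (\<lambda>z. \<Sum>\<^sub>\<infinity>n. f n z)"
  define M where "M = (\<lambda>R (n::int). exp (2 * pi * t * R\<^sup>2) * exp (- pi * t / 2) ^ nat \<bar>n\<bar>)"
  have Ms: "M R summable_on UNIV" for R
    unfolding M_def by (rule summable_on_cmult_right, rule summable_on_int_geometric) (use t in auto)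
  have bound: "norm (f n z) \<le> M R n" if z: "norm z \<le> R" for n z R
  proof -
    have R: "\<bar>Re z\<bar> \<le> R" "\<bar>Im z\<bar> \<le> R" using z abs_Re_le_cmod[of z] abs_Im_le_cmod[of z] by linarith+
    have R2: "(Re z)\<^sup>2 \<le> R\<^sup>2" "(Im z)\<^sup>2 \<le> R\<^sup>2"
      using power_mono[OF R(1) abs_ge_zero, of 2] power_mono[OF R(2) abs_ge_zero, of 2] by simp_all
    have n: "\<bar>of_int n\<bar> \<le> (of_int n :: real)\<^sup>2"
    proof (cases "n = 0")
      case False
      then have "1 \<le> \<bar>of_int n :: real\<bar>" by linarith
      from mult_left_mono[OF this, of "\<bar>of_int n\<bar>"] show ?thesis by (simp add: power2_eq_square)
    qed simp
    have "0 \<le> (2 * Re z + of_int n)\<^sup>2" by simp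
    then have "\<bar>of_int n\<bar> / 2 - 2 * R\<^sup>2 \<le> (Re z + of_int n)\<^sup>2 - (Im z)\<^sup>2"
      using R2 n by (simp add: power2_eq_square algebra_simps)
    then have "- (pi * t) * ((Re z + of_int n)\<^sup>2 - (Im z)\<^sup>2) \<le> - (pi * t) * (\<bar>of_int n\<bar> / 2 - 2 * R\<^sup>2)"
      using t by (intro mult_left_mono_neg) auto
    also have "\<dots> = 2 * pi * t * R\<^sup>2 + of_nat (nat \<bar>n\<bar>) * (- pi * t / 2)"
      by (simp add: algebra_simps)
    finally have "exp (- (pi * t) * ((Re z + of_int n)\<^sup>2 - (Im z)\<^sup>2)) \<le> M R n"
      unfolding M_def exp_of_nat_mult[symmetric] exp_add[symmetric] by simp
    moreover have "norm (f n z) = exp (- (pi * t) * ((Re z + of_int n)\<^sup>2 - (Im z)\<^sup>2))"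
      unfolding f_def norm_exp_eq_Re by (simp add: power2_eq_square)
    ultimately show ?thesis by simp
  qed
  have Ghol: "G holomorphic_on UNIV"
    unfolding G_def
  proof (rule holomorphic_on_infsum)
    fix z :: complex
    have "norm w \<le> norm z + 1" if "w \<in> cball z 1" for w
      using that norm_triangle_ineq2[of w z] by (simp add: dist_norm norm_minus_commute)
    then show "\<exists>r>0. \<exists>M. M summable_on UNIV \<and> (\<forall>n\<in>UNIV. \<forall>w\<in>cball z r \<inter> UNIV. norm (f n w) \<le> M n)"
      using Ms[of "norm z + 1"] bound[of _ "norm z + 1"] by (intro exI[of _ 1] conjI exI[of _ "M (norm z + 1)"]) auto
  qed (auto simp: f_def intro!: holomorphic_intros)
  have Gper: "G (z + 1) = G z" for z
    unfolding G_def f_def using infsum_int_shift[of "\<lambda>n. exp (- of_real (pi * t) * (z + of_int n)\<^sup>2)" 1]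
    by (simp add: add_ac)
  have d: "(G has_field_derivative deriv G 0) (at 0)"
    using holomorphic_derivI[OF Ghol open_UNIV] by simp
  have d1: "(G has_field_derivative deriv G 0) (at 1)"
  proof -
    have "((\<lambda>z. G (z - 1)) has_field_derivative deriv G 0 * 1) (at 1)"
      by (rule DERIV_chain2[of G]) (use d in \<open>auto intro!: derivative_eq_intros\<close>)
    moreover have "G (z - 1) = G z" for z using Gper[of "z - 1"] by simp
    ultimately show ?thesis by simp
  qed
  have coeff: "integral {0..1} (\<lambda>x. G (of_real x) * fchar (- k) x) = of_real (exp (- pi * (of_int k)\<^sup>2 / t) / sqrt t)" for k
  proof -
    define h where "h = (\<lambda>x. complex_of_real (exp (- pi * t * x\<^sup>2)) * exp (- (2 * of_real pi * \<i> * of_int k * of_real x)))"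
    have hcont: "continuous_on A h" for A unfolding h_def by (intro continuous_intros)
    have sh: "f n (of_real x) * fchar (- k) x = h (x + of_int n)" for n x
    proof -
      have "fchar (- k) x = exp (- (2 * of_real pi * \<i> * of_int k * of_real (x + of_int n)))"
      proof -
        have "- (2 * of_real pi * \<i> * of_int k * of_real (x + of_int n)) =
          2 * of_real pi * \<i> * of_int (- k) * of_real x + 2 * of_int (- (k * n)) * of_real pi * \<i>"
          by (simp add: algebra_simps)
        then show ?thesis using exp_integer_2pi[of "of_int (- (k * n))"]
          unfolding fchar_def by (simp only: exp_add) (simp add: mult_ac)
      qed
      moreover have "f n (of_real x) = complex_of_real (exp (- pi * t * (x + of_int n)\<^sup>2))"
        unfolding f_def by (simp add: exp_of_real [symmetric] mult_ac)
      ultimately show ?thesis by (simp add: h_def)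
    qed
    have "uniform_limit (cbox 0 1) (\<lambda>Y x. \<Sum>n\<in>Y. h (x + of_int n)) (\<lambda>x. \<Sum>\<^sub>\<infinity>n. h (x + of_int n)) (finite_subsets_at_top UNIV)"
    proof (rule Weierstrass_m_test_general[OF _ Ms[of 1]])
      fix n and x :: real assume "x \<in> cbox 0 1"
      then have "norm (f n (of_real x)) \<le> M 1 n" by (intro bound) auto
      then show "norm (h (x + of_int n)) \<le> M 1 n"
        unfolding sh[symmetric] norm_mult fchar_simps by simp
    qed
    moreover have "continuous_on (cbox 0 1) (\<lambda>x. \<Sum>n\<in>Y. h (x + of_int n))" for Y
      by (intro continuous_intros continuous_on_compose2[OF hcont[of UNIV]]) auto
    ultimately obtain I J where IJ: "\<And>Y. ((\<lambda>x. \<Sum>n\<in>Y. h (x + of_int n)) has_integral I Y) (cbox 0 1)"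
      "((\<lambda>x. \<Sum>\<^sub>\<infinity>n. h (x + of_int n)) has_integral J) (cbox 0 1)" "(I \<longlongrightarrow> J) (finite_subsets_at_top UNIV)"
      by (rule uniform_limit_integral_cbox) auto
    have "I {-int N..<int N} = integral {- real N..real N} h" for N
    proof -
      have hi: "(\<lambda>x. h (x + of_int n)) integrable_on {0..1}" for n :: int
        by (intro integrable_continuous_real continuous_intros continuous_on_compose2[OF hcont[of UNIV]]) auto
      have "I {-int N..<int N} = integral {0..1} (\<lambda>x. \<Sum>n\<in>{-int N..<int N}. h (x + of_int n))"
        using IJ(1) by (metis box_real(2) integral_unique)
      also have "\<dots> = (\<Sum>n\<in>{-int N..<int N}. integral {0..1} (\<lambda>x. h (x + of_int n)))"
        by (rule integral_sum) (auto intro: hi)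
      also have "\<dots> = integral {- real N..real N} h"
        by (rule integral_sum_unit_intervals[OF hcont])
      finally show ?thesis .
    qed
    then have "(\<lambda>N. integral {- real N..real N} h) \<longlonglongrightarrow> J"
      using filterlim_compose[OF IJ(3) filterlim_int_intervals(1)] by simp
    moreover have "(\<lambda>N. integral {- real N..real N} h) \<longlonglongrightarrow> of_real (exp (- pi * (of_int k)\<^sup>2 / t) / sqrt t)"
      using integral_Icc_LIMSEQ[OF gaussian_fourier[OF t, of k]] by (simp add: h_def)
    ultimately have "J = of_real (exp (- pi * (of_int k)\<^sup>2 / t) / sqrt t)" by (rule LIMSEQ_unique)
    moreover have "(\<Sum>\<^sub>\<infinity>n. h (x + of_int n)) = G (of_real x) * fchar (- k) x" for x
      unfolding G_def sh[symmetric] by (rule infsum_cmult_left')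
    ultimately show ?thesis using IJ(2) by (simp add: integral_unique)
  qed
  have "(\<lambda>N. \<Sum>k=-int N..int N. integral {0..1} (\<lambda>x. G (of_real x) * fchar (- k) x)) \<longlonglongrightarrow> G (of_real 0)"
  proof (rule fourier_series_at_0)
    show "continuous_on {0..1} (\<lambda>x. G (of_real x))"
      by (rule continuous_on_compose2[OF holomorphic_on_imp_continuous_on[OF Ghol]]) (auto intro!: continuous_intros)
    show "G (of_real 1) = G (of_real 0)" using Gper[of 0] by simp
  qed (rule d d1)+
  then have L1: "(\<lambda>N. \<Sum>k=-int N..int N. of_real (exp (- pi * (of_int k)\<^sup>2 / t) / sqrt t)) \<longlonglongrightarrow> G 0"
    by (simp only: coeff of_real_0)
  have s: "(\<lambda>k::int. complex_of_real (exp (- pi * (of_int k)\<^sup>2 / t) / sqrt t)) summable_on UNIV"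
  proof -
    have "(\<lambda>k::int. exp (of_real pi * \<i> * of_real ((of_int k)\<^sup>2) * (\<i> / of_real t))) summable_on UNIV"
      by (rule abs_summable_summable[OF th3_abs]) (use t in simp)
    then have "(\<lambda>k::int. complex_of_real (1 / sqrt t) * exp (of_real pi * \<i> * of_real ((of_int k)\<^sup>2) * (\<i> / of_real t))) summable_on UNIV"
      by (rule summable_on_cmult_right)
    moreover have "complex_of_real (1 / sqrt t) * exp (of_real pi * \<i> * of_real ((of_int k)\<^sup>2) * (\<i> / of_real t)) =
        complex_of_real (exp (- pi * (of_int k)\<^sup>2 / t) / sqrt t)" for k :: int
      using t by (simp add: exp_of_real [symmetric] field_simps)
    ultimately show ?thesis by (simp only:)
  qed
  have "(\<lambda>N. \<Sum>k=-int N..int N. complex_of_real (exp (- pi * (of_int k)\<^sup>2 / t) / sqrt t)) \<longlonglongrightarrow>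
     (\<Sum>\<^sub>\<infinity>k::int. complex_of_real (exp (- pi * (of_int k)\<^sup>2 / t) / sqrt t))"
    by (rule filterlim_compose[OF infsum_tendsto[OF s] filterlim_int_intervals(2)])
  from LIMSEQ_unique[OF L1 this] show ?thesis
    unfolding G_def f_def by (simp add: exp_of_real [symmetric] mult_ac)
qed

text \<open>On the imaginary axis this is Poisson summation for the Gaussian; both sides are holomorphic, so it extends to
  the upper half-plane.\<close>
lemma th3_inversion:
  assumes "Im \<tau> > 0"
  shows "th3 (- 1 / \<tau>) = csqrt (- \<i> * \<tau>) * th3 \<tau>"
proof -
  define D where "D = (\<lambda>\<tau>. th3 (- 1 / \<tau>) - csqrt (- \<i> * \<tau>) * th3 \<tau>)"
  have nz: "\<tau> \<noteq> 0" if "Im \<tau> > 0" for \<tau> using that by auto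
  have im: "Im (- 1 / \<tau>) > 0" if "Im \<tau> > 0" for \<tau>
    using that nz[OF that] by (simp add: Im_divide complex_neq_0)
  have "(\<lambda>\<tau>. th3 (- 1 / \<tau>)) holomorphic_on UHP"
    by (rule holomorphic_on_compose_gen[OF _ th3_holo, unfolded o_def])
       (use im nz in \<open>auto intro!: holomorphic_intros simp del: divide_minus_left\<close>)
  moreover have "(\<lambda>\<tau>. csqrt (- \<i> * \<tau>)) holomorphic_on UHP"
    by (intro holomorphic_intros) (auto simp: complex_nonpos_Reals_iff)
  ultimately have hol: "D holomorphic_on UHP"
    unfolding D_def by (intro holomorphic_on_diff holomorphic_on_mult th3_holo)
  have zero: "D (\<i> * of_real s) = 0" if s: "s > 0" for s
  proof -
    have "th3 (\<i> * of_real s) = th3 (\<i> / of_real s) / of_real (sqrt s)"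
    proof -
      have "th3 (\<i> * of_real s) = (\<Sum>\<^sub>\<infinity>n::int. complex_of_real (exp (- pi * s * (of_int n)\<^sup>2)))"
        unfolding th3_def quad_series_def by (simp add: exp_of_real [symmetric] mult_ac)
      also have "\<dots> = (\<Sum>\<^sub>\<infinity>k::int. complex_of_real (exp (- pi * (of_int k)\<^sup>2 / s) / sqrt s))"
        by (rule gaussian_poisson[OF s])
      also have "\<dots> = (\<Sum>\<^sub>\<infinity>k::int. exp (of_real pi * \<i> * of_real ((of_int k)\<^sup>2) * (\<i> / of_real s)) * (1 / of_real (sqrt s)))"
        by (rule infsum_cong) (simp add: exp_of_real [symmetric] field_simps)
      also have "\<dots> = th3 (\<i> / of_real s) * (1 / of_real (sqrt s))"
        unfolding th3_def quad_series_def by (rule infsum_cmult_left')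
      finally show ?thesis by simp
    qed
    moreover have inv: "- 1 / (\<i> * complex_of_real s) = \<i> / of_real s"
      using s by (simp add: field_simps)
    moreover have "csqrt (- \<i> * (\<i> * complex_of_real s)) = of_real (sqrt s)"
      using s by (simp add: csqrt_of_real_nonneg)
    ultimately show ?thesis unfolding D_def inv using s by simp
  qed
  have "D \<tau> = 0"
  proof (rule analytic_continuation[OF hol open_UHP, of "(\<lambda>s. \<i> * of_real s) ` {0<..}" \<i>])
    show "connected UHP" by (intro convex_connected convex_halfspace_Im_gt)
    show "\<i> islimpt (\<lambda>s. \<i> * of_real s) ` {0<..}"
      unfolding islimpt_approachable
    proof (intro allI impI)
      fix e :: real assume "e > 0"
      then show "\<exists>x'\<in>(\<lambda>s. \<i> * of_real s) ` {0<..}. x' \<noteq> \<i> \<and> dist x' \<i> < e"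
        by (intro bexI[of _ "\<i> * of_real (1 + e / 2)"]) (auto simp: dist_norm norm_mult complex_eq_iff algebra_simps intro!: image_eqI)
    qed
  qed (use assms zero in auto)
  then show ?thesis by (simp add: D_def)
qed

lemma th4_split:
  assumes "Im \<tau> > 0"
  shows "th4 \<tau> = th3 (4 * \<tau>) - th2 (4 * \<tau>)"
proof -
  have "th2 (4 * \<tau> + 1 + 1 + 1 + 1) = (exp (of_real pi * \<i> / 4)) ^ 4 * th2 (4 * \<tau>)"
    by (simp only: th2_plus1) (simp add: power4_eq_xxxx)
  also have "exp (of_real pi * \<i> / 4) ^ 4 = exp (of_real pi * \<i>)"
    by (subst exp_of_nat_mult[symmetric]) simp
  finally have "th2 (4 * \<tau> + 4) = - th2 (4 * \<tau>)" by (simp add: add.assoc)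
  moreover have "th3 (4 * \<tau> + 4) = th3 (4 * \<tau>)"
    using th3_plus2[of "4 * \<tau> + 2"] th3_plus2[of "4 * \<tau>"] by (simp add: add.assoc)
  ultimately show ?thesis
    using th3_split[of "\<tau> + 1"] assms by (simp add: th4_def ring_distribs)
qed

lemma csqrt_4_mult: "csqrt (4 * z) = 2 * csqrt z"
  by (rule csqrt_unique) (use csqrt_principal[of z] in \<open>auto simp: power_mult_distrib\<close>)

text \<open>Since \<open>th2\<close> and \<open>th4\<close> are linear combinations of \<open>th3(\<tau>)\<close> and \<open>th3(4 \<tau>)\<close>, up to rescaling \<open>\<tau>\<close>, their
  inversion formulas follow from that of \<open>th3\<close>.\<close>
lemma th2_inversion:
  assumes "Im \<tau> > 0"
  shows "th2 (- 1 / \<tau>) = csqrt (- \<i> * \<tau>) * th4 \<tau>"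
proof -
  have nz: "\<tau> \<noteq> 0" using assms by auto
  have im: "Im (- 1 / (4 * \<tau>)) > 0"
    using assms nz by (simp add: Im_divide complex_neq_0)
  have eq: "4 * (- 1 / (4 * \<tau>)) = - 1 / \<tau>" by simp
  have "th2 (- 1 / \<tau>) = th3 (- 1 / (4 * \<tau>)) - th3 (- 1 / \<tau>)"
    using th3_split[OF im] unfolding eq by simp
  also have "\<dots> = csqrt (4 * (- \<i> * \<tau>)) * th3 (4 * \<tau>) - csqrt (- \<i> * \<tau>) * th3 \<tau>"
    using th3_inversion[OF assms] th3_inversion[of "4 * \<tau>"] assms by (simp add: mult_ac)
  also have "\<dots> = csqrt (- \<i> * \<tau>) * (2 * th3 (4 * \<tau>) - th3 \<tau>)"
    unfolding csqrt_4_mult by (simp add: algebra_simps)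
  also have "2 * th3 (4 * \<tau>) - th3 \<tau> = th4 \<tau>"
    using th3_split[OF assms] th4_split[OF assms] by simp
  finally show ?thesis .
qed

lemma th4_inversion:
  assumes "Im \<tau> > 0"
  shows "th4 (- 1 / \<tau>) = csqrt (- \<i> * \<tau>) * th2 \<tau>"
proof -
  have nz: "\<tau> \<noteq> 0" using assms by auto
  have im: "Im (- 1 / \<tau>) > 0" "Im (\<tau> / 4) > 0"
    using assms nz by (simp_all add: Im_divide complex_neq_0)
  have eq: "4 * (- 1 / \<tau>) = - 1 / (\<tau> / 4)" by simp
  have "th4 (- 1 / \<tau>) = th3 (- 1 / (\<tau> / 4)) - th2 (- 1 / (\<tau> / 4))"
    using th4_split[OF im(1)] unfolding eq .
  also have "\<dots> = csqrt (- \<i> * (\<tau> / 4)) * (th3 (\<tau> / 4) - th4 (\<tau> / 4))"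
    unfolding th3_inversion[OF im(2)] th2_inversion[OF im(2)] by (simp add: algebra_simps)
  also have "th3 (\<tau> / 4) - th4 (\<tau> / 4) = 2 * th2 \<tau>"
    using th3_split[OF im(2)] th4_split[OF im(2)] by simp
  also have "csqrt (- \<i> * \<tau>) = 2 * csqrt (- \<i> * (\<tau> / 4))"
    using csqrt_4_mult[of "- \<i> * (\<tau> / 4)"] by simp
  then have "csqrt (- \<i> * (\<tau> / 4)) * (2 * th2 \<tau>) = csqrt (- \<i> * \<tau>) * th2 \<tau>" by simp
  finally show ?thesis .
qed

section \<open>The Jacobi triple product\<close>

lemma infsum_dominated_limit:
  fixes f :: "nat \<Rightarrow> 'a \<Rightarrow> complex"
  assumes lim: "\<And>m. m \<in> A \<Longrightarrow> (\<lambda>n. f n m) \<longlonglongrightarrow> g m"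
    and bound: "\<And>n m. m \<in> A \<Longrightarrow> norm (f n m) \<le> M m" and M: "M summable_on A"
  shows "(\<lambda>n. \<Sum>\<^sub>\<infinity>m\<in>A. f n m) \<longlonglongrightarrow> (\<Sum>\<^sub>\<infinity>m\<in>A. g m)"
proof (rule swap_uniform_limit'[where S = UNIV and F = "finite_subsets_at_top A"])
  have fin: "eventually (\<lambda>Y. finite Y \<and> Y \<subseteq> A) (finite_subsets_at_top A)"
    by (simp add: eventually_finite_subsets_at_top_weakI)
  then show "\<forall>\<^sub>F Y in finite_subsets_at_top A. (\<lambda>n. \<Sum>m\<in>Y. f n m) \<longlonglongrightarrow> (\<Sum>m\<in>Y. g m)"
    by eventually_elim (intro tendsto_sum lim, auto)
  show "uniform_limit UNIV (\<lambda>Y n. \<Sum>m\<in>Y. f n m) (\<lambda>n. \<Sum>\<^sub>\<infinity>m\<in>A. f n m) (finite_subsets_at_top A)"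
    by (rule Weierstrass_m_test_general[OF bound M])
  have "norm (g m) \<le> M m" if "m \<in> A" for m
    by (rule LIMSEQ_le_const2[OF tendsto_norm[OF lim[OF that]]]) (use bound that in auto)
  then have "g summable_on A"
    using abs_summable_summable[OF Infinite_Sum.abs_summable_on_comparison_test'[OF M]] by blast
  then show "((\<lambda>Y. \<Sum>m\<in>Y. g m) \<longlongrightarrow> (\<Sum>\<^sub>\<infinity>m\<in>A. g m)) (finite_subsets_at_top A)"
    by (rule infsum_tendsto)
qed auto

definition qfact :: "complex \<Rightarrow> nat \<Rightarrow> complex" where
  "qfact q n = (\<Prod>i<n. 1 - q ^ Suc i)"

lemma qfact_Suc: "qfact q (Suc n) = qfact q n * (1 - q ^ Suc n)" and qfact_0: "qfact q 0 = 1"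
  by (simp_all add: qfact_def)

lemma one_minus_power_nz: "norm q < 1 \<Longrightarrow> 1 - q ^ Suc n \<noteq> (0::complex)"
  by (metis norm_one norm_power power_Suc_less_one norm_ge_zero less_irrefl right_minus_eq power_less_one_iff zero_less_Suc)

lemma qfact_nz: "norm q < 1 \<Longrightarrow> qfact q n \<noteq> 0"
  using one_minus_power_nz unfolding qfact_def by (auto simp del: power_Suc)

text \<open>The Gaussian binomial coefficient.\<close>
definition qbinom :: "complex \<Rightarrow> nat \<Rightarrow> nat \<Rightarrow> complex" where
  "qbinom q n k = (if k \<le> n then qfact q n / (qfact q k * qfact q (n - k)) else 0)"

lemma qbinom_0: "norm q < 1 \<Longrightarrow> qbinom q n 0 = 1"
  using qfact_nz[of q n] by (simp add: qbinom_def qfact_0)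

lemma qbinom_Suc:
  assumes q: "norm q < 1" and k: "k \<le> n"
  shows "qbinom q (Suc n) (Suc k) = qbinom q n (Suc k) + q ^ (n - k) * qbinom q n k"
proof (cases "k = n")
  case True
  then show ?thesis using qfact_nz[OF q] by (simp add: qbinom_def qfact_0)
next
  case False
  with k obtain r where n: "n = k + Suc r" using less_imp_Suc_add[of k n] by auto
  have r: "Suc n - Suc k = Suc r" "n - Suc k = r" "n - k = Suc r" "Suc k \<le> n" using n by auto
  define a b where "a = q ^ Suc k" and "b = q ^ Suc r"
  have ab: "q ^ Suc n = a * b" unfolding a_def b_def n by (simp add: power_add mult_ac)
  have nz: "1 - a \<noteq> 0" "1 - b \<noteq> 0" "qfact q k \<noteq> 0" "qfact q r \<noteq> 0"
    unfolding a_def b_def using one_minus_power_nz[OF q] qfact_nz[OF q] by auto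
  have h1: "qbinom q (Suc n) (Suc k) = qfact q n * (1 - a * b) / (qfact q k * (1 - a) * (qfact q r * (1 - b)))"
    using k r ab by (simp add: qbinom_def qfact_Suc a_def[symmetric] b_def[symmetric] del: power_Suc)
  have h2: "qbinom q n (Suc k) = qfact q n / (qfact q k * (1 - a) * qfact q r)"
    using k r by (simp add: qbinom_def qfact_Suc a_def[symmetric] b_def[symmetric] del: power_Suc)
  have h3: "q ^ (n - k) * qbinom q n k = b * (qfact q n / (qfact q k * (qfact q r * (1 - b))))"
    using k r by (simp add: qbinom_def qfact_Suc a_def[symmetric] b_def[symmetric] del: power_Suc)
  show ?thesis unfolding h1 h2 h3 using nz by (simp add: divide_simps) (simp add: algebra_simps)
qed

lemma q_binomial_theorem:
  assumes q: "norm q < 1"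
  shows "(\<Prod>k<n. 1 + z * q ^ k) = (\<Sum>j\<le>n. qbinom q n j * q ^ (j * (j - 1) div 2) * z ^ j)"
proof (induction n)
  case 0
  then show ?case using qbinom_0[OF q] by simp
next
  case (Suc n)
  have tri: "Suc j * j div 2 = j * (j - 1) div 2 + j" for j :: nat
  proof -
    have "Suc j * j = j * (j - 1) + j * 2" by (cases j) (auto simp: algebra_simps)
    then show ?thesis by simp
  qed
  let ?t = "\<lambda>n j. qbinom q n j * q ^ (j * (j - 1) div 2) * z ^ j"
  have top: "?t n (Suc n) = 0" by (simp add: qbinom_def)
  have "(\<Sum>j\<le>Suc n. ?t (Suc n) j) = 1 + (\<Sum>j\<le>n. ?t (Suc n) (Suc j))"
    by (subst sum.atMost_Suc_shift) (simp add: qbinom_0[OF q])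
  also have "(\<Sum>j\<le>n. ?t (Suc n) (Suc j)) = (\<Sum>j\<le>n. ?t n (Suc j)) + (\<Sum>j\<le>n. z * q ^ n * ?t n j)"
    unfolding sum.distrib[symmetric]
  proof (rule sum.cong)
    fix j assume j: "j \<in> {..n}"
    have "q ^ (n - j) * q ^ (j * (j - 1) div 2 + j) = q ^ n * q ^ (j * (j - 1) div 2)"
      using j by (simp add: power_add[symmetric])
    then have "q ^ (n - j) * qbinom q n j * q ^ (j * (j - 1) div 2 + j) * z ^ Suc j = z * q ^ n * ?t n j"
      by (simp add: mult_ac)
    then show "?t (Suc n) (Suc j) = ?t n (Suc j) + z * q ^ n * ?t n j"
      using j unfolding diff_Suc_1 tri by (simp add: qbinom_Suc[OF q] ring_distribs del: power_Suc mult_Suc)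
  qed simp
  also have "(\<Sum>j\<le>n. z * q ^ n * ?t n j) = z * q ^ n * (\<Sum>j\<le>n. ?t n j)"
    by (rule sum_distrib_left[symmetric])
  also have "1 + ((\<Sum>j\<le>n. ?t n (Suc j)) + z * q ^ n * (\<Sum>j\<le>n. ?t n j)) = (\<Sum>j\<le>n. ?t n j) + z * q ^ n * (\<Sum>j\<le>n. ?t n j)"
  proof -
    have "(\<Sum>j\<le>n. ?t n j) = (\<Sum>j\<le>Suc n. ?t n j)" using top by simp
    also have "\<dots> = 1 + (\<Sum>j\<le>n. ?t n (Suc j))"
      by (subst sum.atMost_Suc_shift) (simp add: qbinom_0[OF q])
    finally show ?thesis by simp
  qed
  finally show ?case using Suc.IH by (simp add: algebra_simps)
qed

text \<open>The \<open>q\<close>-binomial theorem with \<open>2 n\<close> factors, \<open>q = x\<^sup>2\<close>, and \<open>z\<close> chosen so that the factors pair up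
  symmetrically around the middle.\<close>
lemma finite_triple_product:
  assumes x: "norm x < 1" "x \<noteq> 0" and w: "w \<noteq> 0"
  shows "(\<Prod>k<n. (1 + w * x ^ (2 * k + 1)) * (1 + x ^ (2 * k + 1) / w)) =
         (\<Sum>m=-int n..int n. qbinom (x\<^sup>2) (2 * n) (nat (int n + m)) * x ^ nat (m\<^sup>2) * w powi m)"
proof -
  have q: "norm (x\<^sup>2) < 1" using x by (simp add: norm_power power_less_one_iff)
  define z where "z = w * x / x ^ (2 * n)"
  have prod1: "(\<Prod>k<2 * n. 1 + z * (x\<^sup>2) ^ k) = (\<Prod>k<n. 1 + w / x ^ (2 * k + 1)) * (\<Prod>k<n. 1 + w * x ^ (2 * k + 1))"
  proof -
    have "{..<2 * n} = {..<n} \<union> (\<lambda>k. n + k) ` {..<n}"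
    proof (intro equalityI subsetI)
      fix i assume "i \<in> {..<2 * n}"
      then show "i \<in> {..<n} \<union> (\<lambda>k. n + k) ` {..<n}"
        by (cases "i < n") (auto intro!: image_eqI[of _ _ "i - n"])
    qed auto
    then have "(\<Prod>k<2 * n. 1 + z * (x\<^sup>2) ^ k) = (\<Prod>k<n. 1 + z * (x\<^sup>2) ^ k) * (\<Prod>k<n. 1 + z * (x\<^sup>2) ^ (n + k))"
      by (simp only:, subst prod.union_disjoint) (auto simp: prod.reindex)
    also have "(\<Prod>k<n. 1 + z * (x\<^sup>2) ^ k) = (\<Prod>k<n. 1 + w / x ^ (2 * k + 1))"
    proof (rule prod.reindex_bij_witness[of _ "\<lambda>k. n - 1 - k" "\<lambda>k. n - 1 - k"])
      fix k assume k: "k \<in> {..<n}"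
      have "2 * n = 2 * k + 1 + (2 * (n - 1 - k) + 1)" using k by auto
      then have "x ^ (2 * n) = x ^ (2 * k + 1) * x ^ (2 * (n - 1 - k) + 1)" by (metis power_add)
      then show "1 + w / x ^ (2 * (n - 1 - k) + 1) = 1 + z * (x\<^sup>2) ^ k"
        using x by (simp add: z_def field_simps power_mult[symmetric])
    qed auto
    also have "(\<Prod>k<n. 1 + z * (x\<^sup>2) ^ (n + k)) = (\<Prod>k<n. 1 + w * x ^ (2 * k + 1))"
      using x by (intro prod.cong refl) (simp add: z_def power_mult[symmetric] power_add ring_distribs field_simps)
    finally show ?thesis .
  qed
  have sq: "(\<Prod>k<n. x ^ (2 * k + 1)) = x ^ (n\<^sup>2)"
  proof (induction n)
    case (Suc n)
    have "(Suc n)\<^sup>2 = n\<^sup>2 + (2 * n + 1)" by (simp add: power2_eq_square)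
    then show ?case using Suc.IH by (simp only: prod.lessThan_Suc power_add)
  qed simp
  have prod2: "(\<Prod>k<n. 1 + w / x ^ (2 * k + 1)) * x ^ (n\<^sup>2) = w ^ n * (\<Prod>k<n. 1 + x ^ (2 * k + 1) / w)"
  proof -
    have "(\<Prod>k<n. 1 + w / x ^ (2 * k + 1)) * x ^ (n\<^sup>2) = (\<Prod>k<n. (1 + w / x ^ (2 * k + 1)) * x ^ (2 * k + 1))"
      by (simp add: prod.distrib sq[symmetric] del: power_Suc)
    also have "\<dots> = (\<Prod>k<n. w * (1 + x ^ (2 * k + 1) / w))"
      using x w by (intro prod.cong refl) (simp add: field_simps)
    finally show ?thesis by (simp add: prod.distrib)
  qed
  have "w ^ n * (\<Prod>k<n. (1 + w * x ^ (2 * k + 1)) * (1 + x ^ (2 * k + 1) / w)) = (\<Prod>k<2 * n. 1 + z * (x\<^sup>2) ^ k) * x ^ (n\<^sup>2)"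
    unfolding prod1 using prod2 by (simp add: prod.distrib mult_ac)
  also have "\<dots> = (\<Sum>j\<le>2 * n. qbinom (x\<^sup>2) (2 * n) j * (x\<^sup>2) ^ (j * (j - 1) div 2) * z ^ j * x ^ (n\<^sup>2))"
    unfolding q_binomial_theorem[OF q] by (simp add: sum_distrib_right)
  also have "\<dots> = (\<Sum>j\<le>2 * n. qbinom (x\<^sup>2) (2 * n) j * x ^ nat ((int j - int n)\<^sup>2) * w ^ j)"
  proof (rule sum.cong)
    fix j
    have e: "(x\<^sup>2) ^ (j * (j - 1) div 2) = x ^ (j * (j - 1))"
    proof -
      have "even (j * (j - 1))" by (cases j) auto
      then have "2 * (j * (j - 1) div 2) = j * (j - 1)" by simp
      then show ?thesis by (simp only: power_mult[symmetric])
    qed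
    have "int (nat ((int j - int n)\<^sup>2)) = (int j - int n)\<^sup>2" by (rule nat_0_le) simp
    then have "int (nat ((int j - int n)\<^sup>2) + 2 * n * j) = int (j * (j - 1) + j + n\<^sup>2)"
      by (cases j) (simp_all add: power2_eq_square algebra_simps)
    then have "nat ((int j - int n)\<^sup>2) + 2 * n * j = j * (j - 1) + j + n\<^sup>2" by (simp only: of_nat_eq_iff)
    then have "x ^ nat ((int j - int n)\<^sup>2) * x ^ (2 * n * j) = x ^ (j * (j - 1)) * x ^ j * x ^ (n\<^sup>2)"
      by (simp only: power_add[symmetric])
    then have "(x\<^sup>2) ^ (j * (j - 1) div 2) * z ^ j * x ^ (n\<^sup>2) = x ^ nat ((int j - int n)\<^sup>2) * w ^ j"
      unfolding e z_def using x by (simp add: power_divide power_mult_distrib power_mult[symmetric] field_simps)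
    then show "qbinom (x\<^sup>2) (2 * n) j * (x\<^sup>2) ^ (j * (j - 1) div 2) * z ^ j * x ^ (n\<^sup>2) =
        qbinom (x\<^sup>2) (2 * n) j * x ^ nat ((int j - int n)\<^sup>2) * w ^ j"
      by (simp add: mult.assoc)
  qed simp
  also have "\<dots> = (\<Sum>m=-int n..int n. qbinom (x\<^sup>2) (2 * n) (nat (int n + m)) * x ^ nat (m\<^sup>2) * w ^ nat (int n + m))"
    by (rule sum.reindex_bij_witness[of _ "\<lambda>m. nat (int n + m)" "\<lambda>j. int j - int n"]) (auto simp: nat_le_iff)
  also have "\<dots> = w ^ n * (\<Sum>m=-int n..int n. qbinom (x\<^sup>2) (2 * n) (nat (int n + m)) * x ^ nat (m\<^sup>2) * w powi m)"
    unfolding sum_distrib_left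
  proof (rule sum.cong)
    fix m assume m: "m \<in> {-int n..int n}"
    have "w ^ nat (int n + m) = w powi (int n + m)" using m by (simp add: power_int_def)
    also have "\<dots> = w ^ n * w powi m" using w by (simp add: power_int_add)
    finally show "qbinom (x\<^sup>2) (2 * n) (nat (int n + m)) * x ^ nat (m\<^sup>2) * w ^ nat (int n + m) =
       w ^ n * (qbinom (x\<^sup>2) (2 * n) (nat (int n + m)) * x ^ nat (m\<^sup>2) * w powi m)" by simp
  qed simp
  finally show ?thesis using w by simp
qed

lemma convergent_prod_geometric:
  fixes x :: complex and f :: "nat \<Rightarrow> complex"
  assumes "norm x < 1" "\<And>k. norm (f k) \<le> c * norm x ^ k"
  shows "convergent_prod (\<lambda>k. 1 + f k)"
proof (rule abs_convergent_prod_imp_convergent_prod, rule summable_imp_abs_convergent_prod)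
  have "summable (\<lambda>k. c * norm x ^ k)" using assms(1) by (intro summable_mult summable_geometric) auto
  then show "summable (\<lambda>i. norm (1 + f i - 1))"
    by (rule summable_comparison_test') (use assms(2) in auto)
qed

lemma prodinf_LIMSEQ_lessThan:
  fixes f :: "nat \<Rightarrow> complex"
  assumes "convergent_prod f"
  shows "(\<lambda>n. \<Prod>k<n. f k) \<longlonglongrightarrow> prodinf f"
  using convergent_prod_LIMSEQ[OF assms] LIMSEQ_lessThan_iff_atMost[of "\<lambda>A. prod f A"] by simp

definition euler_prod :: "complex \<Rightarrow> complex" where
  "euler_prod q = (\<Prod>k. 1 - q ^ Suc k)"

lemma power_bound_geometric:
  fixes x :: complex
  assumes "norm x < 1" "\<And>k. e k \<ge> k"
  shows "norm (a * x ^ e k) \<le> norm a * norm x ^ k"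
  using mult_left_mono[OF power_decreasing[of k "e k" "norm x"], of "norm a"] assms
  by (simp add: norm_mult norm_power)

lemma convergent_prod_powers:
  fixes x :: complex
  assumes "norm x < 1" "\<And>k. e k \<ge> k"
  shows "convergent_prod (\<lambda>k. 1 + a * x ^ e k)"
  by (rule convergent_prod_geometric[OF assms(1) power_bound_geometric[OF assms]])

lemma convergent_prod_euler: "norm (q::complex) < 1 \<Longrightarrow> convergent_prod (\<lambda>k. 1 - q ^ Suc k)"
  using convergent_prod_powers[of q Suc "-1"] by simp

lemma euler_prod_nz: "norm q < 1 \<Longrightarrow> euler_prod q \<noteq> 0"
  unfolding euler_prod_def by (intro prodinf_nonzero convergent_prod_euler one_minus_power_nz)

lemma qfact_LIMSEQ: "norm q < 1 \<Longrightarrow> qfact q \<longlonglongrightarrow> euler_prod q"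
  using prodinf_LIMSEQ_lessThan[OF convergent_prod_euler] by (simp add: qfact_def [abs_def] euler_prod_def)

text \<open>The limit of the finite identity; the Gaussian binomials are bounded uniformly, because the finite products
  \<open>qfact\<close> are bounded and bounded away from zero, which gives dominated convergence.\<close>
lemma triple_product:
  assumes x: "norm x < 1" "x \<noteq> 0" and w: "w \<noteq> 0"
    and s: "(\<lambda>m::int. x ^ nat (m\<^sup>2) * w powi m) abs_summable_on UNIV"
  shows "(\<Sum>\<^sub>\<infinity>m::int. x ^ nat (m\<^sup>2) * w powi m) =
     euler_prod (x\<^sup>2) * (\<Prod>k. 1 + w * x ^ (2 * k + 1)) * (\<Prod>k. 1 + x ^ (2 * k + 1) / w)"
proof -
  define q where "q = x\<^sup>2"
  have q: "norm q < 1" using x by (simp add: q_def norm_power power_less_one_iff)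
  have lim: "qfact q \<longlonglongrightarrow> euler_prod q" by (rule qfact_LIMSEQ[OF q])
  obtain K where K: "\<And>n. norm (qfact q n) \<le> K"
    using convergent_imp_Bseq[OF convergentI[OF lim]] by (auto simp: Bseq_def)
  obtain L where L: "\<And>n. norm (inverse (qfact q n)) \<le> L"
    using convergent_imp_Bseq[OF convergentI[OF tendsto_inverse[OF lim euler_prod_nz[OF q]]]] by (auto simp: Bseq_def)
  have K0: "K \<ge> 0" and L0: "L \<ge> 0" using K[of 0] L[of 0] norm_ge_zero order_trans by blast+
  have B: "norm (qbinom q n k) \<le> K * L * L" for n k
  proof (cases "k \<le> n")
    case True
    have "norm (qbinom q n k) = norm (qfact q n) * norm (inverse (qfact q k)) * norm (inverse (qfact q (n - k)))"
      using True by (simp add: qbinom_def norm_divide norm_mult norm_inverse divide_inverse)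
    also have "\<dots> \<le> K * L * L"
      by (intro mult_mono K L mult_nonneg_nonneg norm_ge_zero K0 L0)
    finally show ?thesis .
  qed (use K0 L0 in \<open>simp add: qbinom_def\<close>)
  define g where "g = (\<lambda>n m. if m \<in> {-int n..int n} then qbinom q (2 * n) (nat (int n + m)) * (x ^ nat (m\<^sup>2) * w powi m) else 0)"
  have glim: "(\<lambda>n. g n m) \<longlonglongrightarrow> 1 / euler_prod q * (x ^ nat (m\<^sup>2) * w powi m)" for m
  proof -
    have f1: "filterlim (\<lambda>n. nat (int n + m)) at_top sequentially"
      unfolding filterlim_at_top
    proof
      fix Z show "\<forall>\<^sub>F n in sequentially. Z \<le> nat (int n + m)"
        using eventually_ge_at_top[of "Z + nat \<bar>m\<bar>"] by eventually_elim auto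
    qed
    have f2: "filterlim (\<lambda>n. nat (int n - m)) at_top sequentially"
      unfolding filterlim_at_top
    proof
      fix Z show "\<forall>\<^sub>F n in sequentially. Z \<le> nat (int n - m)"
        using eventually_ge_at_top[of "Z + nat \<bar>m\<bar>"] by eventually_elim auto
    qed
    have f3: "filterlim (\<lambda>n. 2 * n) at_top (sequentially :: nat filter)"
      by (rule filterlim_at_top_mono[OF filterlim_ident]) auto
    have "(\<lambda>n. qfact q (2 * n) / (qfact q (nat (int n + m)) * qfact q (nat (int n - m))) * (x ^ nat (m\<^sup>2) * w powi m))
       \<longlonglongrightarrow> euler_prod q / (euler_prod q * euler_prod q) * (x ^ nat (m\<^sup>2) * w powi m)"
      using euler_prod_nz[OF q]
      by (intro tendsto_intros filterlim_compose[OF lim f1] filterlim_compose[OF lim f2] filterlim_compose[OF lim f3]) auto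
    moreover have "\<forall>\<^sub>F n in sequentially. qfact q (2 * n) / (qfact q (nat (int n + m)) * qfact q (nat (int n - m))) * (x ^ nat (m\<^sup>2) * w powi m) = g n m"
      using eventually_ge_at_top[of "nat \<bar>m\<bar>"]
    proof eventually_elim
      case (elim n)
      have "2 * n - nat (int n + m) = nat (int n - m)" using elim by auto
      then show ?case using elim by (auto simp: g_def qbinom_def)
    qed
    ultimately have "(\<lambda>n. g n m) \<longlonglongrightarrow> euler_prod q / (euler_prod q * euler_prod q) * (x ^ nat (m\<^sup>2) * w powi m)"
      by (rule Lim_transform_eventually)
    then show ?thesis using euler_prod_nz[OF q] by (simp add: divide_simps)
  qed
  have "(\<lambda>n. \<Sum>\<^sub>\<infinity>m. g n m) \<longlonglongrightarrow> (\<Sum>\<^sub>\<infinity>m. 1 / euler_prod q * (x ^ nat (m\<^sup>2) * w powi m))"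
  proof (rule infsum_dominated_limit[OF glim])
    fix n m
    show "norm (g n m) \<le> K * L * L * norm (x ^ nat (m\<^sup>2) * w powi m)"
      using B[of "2 * n" "nat (int n + m)"] K0 L0 by (auto simp: g_def norm_mult intro!: mult_right_mono mult_nonneg_nonneg)
  qed (rule summable_on_cmult_right[OF s])
  also have "(\<Sum>\<^sub>\<infinity>m. 1 / euler_prod q * (x ^ nat (m\<^sup>2) * w powi m)) = 1 / euler_prod q * (\<Sum>\<^sub>\<infinity>m. x ^ nat (m\<^sup>2) * w powi m)"
    by (rule infsum_cmult_right')
  also have "(\<lambda>n. \<Sum>\<^sub>\<infinity>m. g n m) = (\<lambda>n. (\<Prod>k<n. 1 + w * x ^ (2 * k + 1)) * (\<Prod>k<n. 1 + x ^ (2 * k + 1) / w))"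
  proof
    fix n
    have "(\<Sum>\<^sub>\<infinity>m. g n m) = (\<Sum>\<^sub>\<infinity>m\<in>{-int n..int n}. g n m)"
      by (rule infsum_cong_neutral) (auto simp: g_def)
    also have "\<dots> = (\<Sum>m\<in>{-int n..int n}. g n m)" by simp
    also have "\<dots> = (\<Sum>m=-int n..int n. qbinom (x\<^sup>2) (2 * n) (nat (int n + m)) * x ^ nat (m\<^sup>2) * w powi m)"
      by (intro sum.cong) (auto simp: g_def q_def)
    also have "\<dots> = (\<Prod>k<n. (1 + w * x ^ (2 * k + 1)) * (1 + x ^ (2 * k + 1) / w))"
      by (rule finite_triple_product[OF x w, symmetric])
    finally show "(\<Sum>\<^sub>\<infinity>m. g n m) = (\<Prod>k<n. 1 + w * x ^ (2 * k + 1)) * (\<Prod>k<n. 1 + x ^ (2 * k + 1) / w)"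
      by (simp add: prod.distrib)
  qed
  finally have "(\<lambda>n. (\<Prod>k<n. 1 + w * x ^ (2 * k + 1)) * (\<Prod>k<n. 1 + x ^ (2 * k + 1) / w))
     \<longlonglongrightarrow> 1 / euler_prod q * (\<Sum>\<^sub>\<infinity>m. x ^ nat (m\<^sup>2) * w powi m)" .
  moreover have "convergent_prod (\<lambda>k. 1 + w * x ^ (2 * k + 1))" "convergent_prod (\<lambda>k. 1 + x ^ (2 * k + 1) / w)"
    using convergent_prod_powers[OF x(1), of "\<lambda>k. 2 * k + 1" w] convergent_prod_powers[OF x(1), of "\<lambda>k. 2 * k + 1" "1 / w"]
    by (simp_all add: mult_ac)
  then have "(\<lambda>n. (\<Prod>k<n. 1 + w * x ^ (2 * k + 1)) * (\<Prod>k<n. 1 + x ^ (2 * k + 1) / w))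
     \<longlonglongrightarrow> (\<Prod>k. 1 + w * x ^ (2 * k + 1)) * (\<Prod>k. 1 + x ^ (2 * k + 1) / w)"
    by (intro tendsto_mult prodinf_LIMSEQ_lessThan)
  ultimately have "1 / euler_prod q * (\<Sum>\<^sub>\<infinity>m. x ^ nat (m\<^sup>2) * w powi m) = (\<Prod>k. 1 + w * x ^ (2 * k + 1)) * (\<Prod>k. 1 + x ^ (2 * k + 1) / w)"
    by (rule LIMSEQ_unique)
  then show ?thesis using euler_prod_nz[OF q] by (simp add: q_def field_simps)
qed

section \<open>Product formulas for the theta constants\<close>

lemma exp_nome_power: "exp (of_real pi * \<i> * of_real (of_int m ^ 2) * \<tau>) = exp (of_real pi * \<i> * \<tau>) ^ nat (m\<^sup>2)"
proof -
  have "of_nat (nat (m\<^sup>2)) = (of_int m ^ 2 :: complex)"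
    by (metis of_int_of_nat_eq of_int_power nat_0_le zero_le_power2)
  then show ?thesis by (simp add: exp_of_nat_mult[symmetric] mult_ac)
qed

lemma norm_half_nome: "Im \<tau> > 0 \<Longrightarrow> norm (exp (of_real pi * \<i> * \<tau>)) < 1"
  by (simp add: norm_exp_eq_Re)

lemma th3_product:
  assumes "Im \<tau> > 0"
  defines "x \<equiv> exp (of_real pi * \<i> * \<tau>)"
  shows "th3 \<tau> = euler_prod (x\<^sup>2) * (\<Prod>k. 1 + x ^ (2 * k + 1))\<^sup>2"
proof -
  have x: "norm x < 1" "x \<noteq> 0" using norm_half_nome[OF assms(1)] by (simp_all add: x_def)
  have "(\<lambda>m::int. x ^ nat (m\<^sup>2) * 1 powi m) abs_summable_on UNIV"
    using th3_abs[OF assms(1)] by (simp only: exp_nome_power x_def power_int_1_left mult_1_right)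
  from triple_product[OF x _ this] show ?thesis
    unfolding th3_def quad_series_def exp_nome_power x_def[symmetric] power2_eq_square[of "prodinf _"] by simp
qed

lemma th4_product:
  assumes "Im \<tau> > 0"
  defines "x \<equiv> exp (of_real pi * \<i> * \<tau>)"
  shows "th4 \<tau> = euler_prod (x\<^sup>2) * (\<Prod>k. 1 - x ^ (2 * k + 1))\<^sup>2"
proof -
  have "exp (of_real pi * \<i> * (\<tau> + 1)) = - x"
    by (simp add: x_def ring_distribs exp_add)
  then show ?thesis using th3_product[of "\<tau> + 1"] assms(1) by (simp add: th4_def)
qed

lemma th2_product:
  assumes "Im \<tau> > 0"
  defines "x \<equiv> exp (of_real pi * \<i> * \<tau>)"
  shows "th2 \<tau> = 2 * exp (of_real pi * \<i> * \<tau> / 4) * euler_prod (x\<^sup>2) * (\<Prod>k. 1 + (x\<^sup>2) ^ Suc k)\<^sup>2"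
proof -
  have x: "norm x < 1" "x \<noteq> 0" using norm_half_nome[OF assms(1)] by (simp_all add: x_def)
  let ?c = "exp (of_real pi * \<i> * \<tau> / 4)"
  have t: "exp (of_real pi * \<i> * of_real ((of_int m + 1/2)\<^sup>2) * \<tau>) = ?c * (x ^ nat (m\<^sup>2) * x powi m)" for m :: int
  proof -
    have "x powi m = exp (of_int m * (of_real pi * \<i> * \<tau>))"
      unfolding x_def by (simp add: exp_power_int)
    then show ?thesis
      unfolding x_def exp_nome_power[symmetric] by (simp add: exp_add[symmetric] power2_eq_square algebra_simps)
  qed
  have s: "(\<lambda>m::int. x ^ nat (m\<^sup>2) * x powi m) abs_summable_on UNIV"
  proof -
    have "(\<lambda>m::int. norm (1 / ?c) * norm (exp (of_real pi * \<i> * of_real ((of_int m + 1/2)\<^sup>2) * \<tau>))) summable_on UNIV"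
      by (rule summable_on_cmult_right[OF th2_abs[OF assms(1)]])
    then show ?thesis unfolding t by (simp add: norm_mult norm_divide)
  qed
  have "th2 \<tau> = ?c * (\<Sum>\<^sub>\<infinity>m::int. x ^ nat (m\<^sup>2) * x powi m)"
    unfolding th2_def quad_series_def t by (rule infsum_cmult_right')
  also have "(\<Sum>\<^sub>\<infinity>m::int. x ^ nat (m\<^sup>2) * x powi m) = euler_prod (x\<^sup>2) * (\<Prod>k. 1 + x * x ^ (2 * k + 1)) * (\<Prod>k. 1 + x ^ (2 * k + 1) / x)"
    by (rule triple_product[OF x x(2) s])
  also have "(\<lambda>k. 1 + x * x ^ (2 * k + 1)) = (\<lambda>k. 1 + (x\<^sup>2) ^ Suc k)"
    by (simp add: fun_eq_iff power_mult[symmetric] power_add[symmetric] flip: power_Suc)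
  also have "(\<lambda>k. 1 + x ^ (2 * k + 1) / x) = (\<lambda>k. 1 + (x\<^sup>2) ^ k)"
    using x by (simp add: power_mult[symmetric] fun_eq_iff)
  also have "(\<Prod>k. 1 + (x\<^sup>2) ^ k) = 2 * (\<Prod>k. 1 + (x\<^sup>2) ^ Suc k)"
  proof -
    have q: "norm (x\<^sup>2) < 1" using x by (simp add: norm_power power_less_one_iff)
    have c: "convergent_prod (\<lambda>k. 1 + (x\<^sup>2) ^ k)" "convergent_prod (\<lambda>k. 1 + (x\<^sup>2) ^ Suc k)"
      using convergent_prod_powers[OF q, of "\<lambda>k. k" 1] convergent_prod_powers[OF q, of Suc 1] by simp_all
    have "(\<lambda>n. \<Prod>k<Suc n. 1 + (x\<^sup>2) ^ k) \<longlonglongrightarrow> (\<Prod>k. 1 + (x\<^sup>2) ^ k)"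
      by (rule LIMSEQ_Suc[OF prodinf_LIMSEQ_lessThan[OF c(1)]])
    moreover have "(\<lambda>n. \<Prod>k<Suc n. 1 + (x\<^sup>2) ^ k) \<longlonglongrightarrow> 2 * (\<Prod>k. 1 + (x\<^sup>2) ^ Suc k)"
      unfolding prod.lessThan_Suc_shift using tendsto_mult_left[OF prodinf_LIMSEQ_lessThan[OF c(2)], of 2] by simp
    ultimately show ?thesis by (rule LIMSEQ_unique)
  qed
  finally show ?thesis by (simp add: power2_eq_square mult_ac)
qed

text \<open>Euler: there are as many partitions into distinct parts as into odd parts. Multiply by \<open>\<Prod>(1 - q\<^sup>k)\<close> and use
  \<open>(1 - q\<^sup>k) (1 + q\<^sup>k) = 1 - q\<^sup>2\<^sup>k\<close>.\<close>
lemma euler_partition_identity: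
  fixes q :: complex
  assumes q: "norm q < 1"
  shows "(\<Prod>k. 1 + q ^ Suc k) * (\<Prod>k. 1 - q ^ (2 * k + 1)) = 1"
proof -
  let ?B = "\<Prod>k. 1 + q ^ Suc k" and ?C = "\<Prod>k. 1 - q ^ (2 * k + 1)"
  have cB: "convergent_prod (\<lambda>k. 1 + q ^ Suc k)" and cC: "convergent_prod (\<lambda>k. 1 - q ^ (2 * k + 1))"
    and cD: "convergent_prod (\<lambda>k. 1 - q ^ (2 * k + 2))"
    using convergent_prod_powers[OF q, of Suc 1] convergent_prod_powers[OF q, of "\<lambda>k. 2 * k + 1" "-1"]
      convergent_prod_powers[OF q, of "\<lambda>k. 2 * k + 2" "-1"] by simp_all
  have "(\<Prod>k. 1 - q ^ (2 * k + 2)) = (\<Prod>k. (1 - q ^ Suc k) * (1 + q ^ Suc k))"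
  proof (rule arg_cong[where f = prodinf], rule ext)
    fix k
    have "q ^ (2 * k + 2) = q ^ Suc k * q ^ Suc k"
      unfolding power_add[symmetric] by (rule arg_cong[where f = "power q"]) simp
    then show "1 - q ^ (2 * k + 2) = (1 - q ^ Suc k) * (1 + q ^ Suc k)"
      by (simp only:) (simp only: algebra_simps, simp)
  qed
  also have "\<dots> = euler_prod q * ?B"
    unfolding euler_prod_def by (rule prodinf_mult[symmetric, OF convergent_prod_euler[OF q] cB])
  finally have D: "(\<Prod>k. 1 - q ^ (2 * k + 2)) = euler_prod q * ?B" .
  have split: "(\<Prod>k<2 * n. 1 - q ^ Suc k) = (\<Prod>k<n. 1 - q ^ (2 * k + 1)) * (\<Prod>k<n. 1 - q ^ (2 * k + 2))" for n
    by (induction n) (simp_all add: mult_ac)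
  have f: "filterlim (\<lambda>n. 2 * n) at_top (sequentially :: nat filter)"
    by (rule filterlim_at_top_mono[OF filterlim_ident]) auto
  have "(\<lambda>n. \<Prod>k<2 * n. 1 - q ^ Suc k) \<longlonglongrightarrow> euler_prod q"
    unfolding euler_prod_def by (rule filterlim_compose[OF prodinf_LIMSEQ_lessThan[OF convergent_prod_euler[OF q]] f])
  moreover have "(\<lambda>n. \<Prod>k<2 * n. 1 - q ^ Suc k) \<longlonglongrightarrow> ?C * (\<Prod>k. 1 - q ^ (2 * k + 2))"
    unfolding split by (intro tendsto_mult prodinf_LIMSEQ_lessThan cC cD)
  ultimately have "euler_prod q = ?C * (euler_prod q * ?B)" unfolding D by (rule LIMSEQ_unique)
  then show ?thesis using euler_prod_nz[OF q] by (simp add: field_simps)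
qed

text \<open>In the product of the three product formulas, everything except \<open>2 \<eta>\<^sup>3\<close> cancels by Euler's identity.\<close>
lemma theta_product_eta:
  assumes "Im \<tau> > 0"
  shows "th2 \<tau> * th3 \<tau> * th4 \<tau> = 2 * eta \<tau> ^ 3"
proof -
  define x where "x = exp (of_real pi * \<i> * \<tau>)"
  have x: "norm x < 1" using norm_half_nome[OF assms] by (simp add: x_def)
  have q: "norm (x\<^sup>2) < 1" using x by (simp add: norm_power power_less_one_iff)
  define B where "B = (\<Prod>k. 1 + (x\<^sup>2) ^ Suc k)"
  define P where "P = (\<Prod>k. 1 + x ^ (2 * k + 1))"
  define M where "M = (\<Prod>k. 1 - x ^ (2 * k + 1))"
  have "P * M = (\<Prod>k. (1 + x ^ (2 * k + 1)) * (1 - x ^ (2 * k + 1)))"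
    unfolding P_def M_def
    using convergent_prod_powers[OF x, of "\<lambda>k. 2 * k + 1" 1] convergent_prod_powers[OF x, of "\<lambda>k. 2 * k + 1" "-1"]
    by (intro prodinf_mult) simp_all
  also have "\<dots> = (\<Prod>k. 1 - (x\<^sup>2) ^ (2 * k + 1))"
    by (rule arg_cong[where f = prodinf]) (simp add: fun_eq_iff algebra_simps power_add[symmetric] power_mult[symmetric])
  finally have BPM: "B * (P * M) = 1"
    using euler_partition_identity[OF q] by (simp add: B_def)
  have nome: "nome \<tau> = x\<^sup>2"
    by (simp add: nome_def x_def exp_of_nat_mult[symmetric] mult_ac)
  have np: "nome_pow (1 / 24) \<tau> ^ 3 = exp (of_real pi * \<i> * \<tau> / 4)"
    by (simp add: nome_pow_def exp_of_nat_mult[symmetric] mult_ac)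
  have "th2 \<tau> * th3 \<tau> * th4 \<tau> = 2 * exp (of_real pi * \<i> * \<tau> / 4) * euler_prod (x\<^sup>2) ^ 3 * (B * (P * M))\<^sup>2"
    unfolding th2_product[OF assms] th3_product[OF assms] th4_product[OF assms] x_def[symmetric] B_def[symmetric] P_def[symmetric] M_def[symmetric]
    by (simp add: power2_eq_square power3_eq_cube mult_ac)
  then show ?thesis
    unfolding BPM eta_def np[symmetric] nome euler_prod_def by (simp add: power_mult_distrib)
qed

lemma eta_nz:
  assumes "Im \<tau> > 0" shows "eta \<tau> \<noteq> 0"
proof -
  have "norm (nome \<tau>) < 1" using assms by (simp add: nome_def norm_exp_eq_Re)
  then show ?thesis using euler_prod_nz[of "nome \<tau>"] by (simp add: eta_def euler_prod_def nome_pow_def)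
qed

lemma theta_nz:
  assumes "Im \<tau> > 0"
  shows "th2 \<tau> \<noteq> 0" "th3 \<tau> \<noteq> 0" "th4 \<tau> \<noteq> 0"
  using theta_product_eta[OF assms] eta_nz[OF assms] by auto

lemma theta10_eq_th2: "theta10 \<tau> = th2 \<tau>"
  unfolding theta10_def th2_def quad_series_def nome_pow_def
  by (intro infsum_cong arg_cong[where f = exp]) (simp add: power2_eq_square field_simps)

section \<open>Level one functions vanishing at the cusp\<close>

lemma Im_minus_inverse: "Im (- 1 / \<tau>) = Im \<tau> / (norm \<tau>)\<^sup>2"
  by (simp add: Im_divide cmod_power2)

lemma UHP_inv: "Im \<tau> > 0 \<Longrightarrow> Im (- 1 / \<tau>) > 0"
  unfolding Im_minus_inverse by (intro divide_pos_pos) auto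

lemma UHP_nz: "Im \<tau> > 0 \<Longrightarrow> \<tau> \<noteq> 0"
  by auto

lemma periodic_of_int:
  assumes T: "\<And>\<tau>. Im \<tau> > 0 \<Longrightarrow> h (\<tau> + 1) = h \<tau>" and "Im \<tau> > 0"
  shows "h (\<tau> + of_int n) = h \<tau>"
proof (induction n rule: int_induct[where k = 0])
  case (step1 i)
  then show ?case using T[of "\<tau> + of_int i"] assms(2) by (simp add: add.assoc)
next
  case (step2 i)
  then show ?case using T[of "\<tau> + of_int (i - 1)"] assms(2) by (simp add: add.assoc)
qed simp

text \<open>After a translation into \<open>|Re \<tau>| \<le> 1/2\<close>, an inversion at least doubles the imaginary part while it is below
  \<open>1/2\<close>; so the induction is on the number of doublings needed.\<close>
lemma reduce_level_one:
  assumes T: "\<And>\<tau>. Im \<tau> > 0 \<Longrightarrow> h (\<tau> + 1) = h \<tau>"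
    and S: "\<And>\<tau>. Im \<tau> > 0 \<Longrightarrow> h (- 1 / \<tau>) = h \<tau>"
    and t: "Im \<tau> > 0"
  shows "\<exists>\<tau>'. \<bar>Re \<tau>'\<bar> \<le> 1 / 2 \<and> Im \<tau>' \<ge> 1 / 2 \<and> h \<tau>' = h \<tau>"
proof -
  have "\<exists>\<tau>'. \<bar>Re \<tau>'\<bar> \<le> 1 / 2 \<and> Im \<tau>' \<ge> 1 / 2 \<and> h \<tau>' = h \<tau>" if "Im \<tau> > 0" "Im \<tau> * 2 ^ n \<ge> 1 / 2" for n \<tau>
    using that
  proof (induction n arbitrary: \<tau>)
    case (0 \<tau>)
    define \<sigma> where "\<sigma> = \<tau> + of_int (- round (Re \<tau>))"
    have "\<bar>Re \<sigma>\<bar> \<le> 1 / 2" using of_int_round_abs_le[of "Re \<tau>"] by (simp add: \<sigma>_def abs_minus_commute)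
    moreover have "h \<sigma> = h \<tau>" unfolding \<sigma>_def by (rule periodic_of_int[of h, OF T 0(1)])
    ultimately show ?case using 0 by (intro exI[of _ \<sigma>]) (simp add: \<sigma>_def)
  next
    case (Suc n \<tau>)
    define \<sigma> where "\<sigma> = \<tau> + of_int (- round (Re \<tau>))"
    have re: "\<bar>Re \<sigma>\<bar> \<le> 1 / 2" using of_int_round_abs_le[of "Re \<tau>"] by (simp add: \<sigma>_def abs_minus_commute)
    have h: "h \<sigma> = h \<tau>" unfolding \<sigma>_def by (rule periodic_of_int[of h, OF T Suc.prems(1)])
    have im: "Im \<sigma> = Im \<tau>" by (simp add: \<sigma>_def)
    show ?case
    proof (cases "Im \<sigma> \<ge> 1 / 2")
      case True
      then show ?thesis using re h by blast
    next
      case False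
      have "(norm \<sigma>)\<^sup>2 = (Re \<sigma>)\<^sup>2 + (Im \<sigma>)\<^sup>2" by (rule cmod_power2)
      also have "\<dots> \<le> (1/2)\<^sup>2 + (1/2)\<^sup>2"
      proof (rule add_mono)
        show "(Re \<sigma>)\<^sup>2 \<le> (1/2)\<^sup>2" using power_mono[OF re abs_ge_zero, of 2] by simp
        show "(Im \<sigma>)\<^sup>2 \<le> (1/2)\<^sup>2" by (rule power_mono) (use False Suc.prems(1) im in auto)
      qed
      finally have n2: "(norm \<sigma>)\<^sup>2 \<le> 1 / 2" by (simp add: power2_eq_square)
      have pos: "(norm \<sigma>)\<^sup>2 > 0" using Suc.prems(1) im by auto
      have "Im (- 1 / \<sigma>) \<ge> 2 * Im \<tau>"
      proof -
        have "2 * Im \<tau> * (norm \<sigma>)\<^sup>2 \<le> 2 * Im \<tau> * (1 / 2)"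
          using n2 Suc.prems(1) by (intro mult_left_mono) auto
        then show ?thesis unfolding Im_minus_inverse im using pos by (simp add: field_simps)
      qed
      then have "Im (- 1 / \<sigma>) * 2 ^ n \<ge> 2 * Im \<tau> * 2 ^ n" by (intro mult_right_mono) auto
      then have "Im (- 1 / \<sigma>) * 2 ^ n \<ge> 1 / 2" using Suc.prems(2) by simp
      moreover have "Im (- 1 / \<sigma>) > 0" using UHP_inv[of \<sigma>] Suc.prems(1) im by simp
      ultimately obtain \<tau>' where "\<bar>Re \<tau>'\<bar> \<le> 1 / 2" "Im \<tau>' \<ge> 1 / 2" "h \<tau>' = h (- 1 / \<sigma>)"
        using Suc.IH by blast
      moreover have "h (- 1 / \<sigma>) = h \<sigma>" using S[of \<sigma>] Suc.prems(1) im by simp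
      ultimately show ?thesis using h by (intro exI[of _ \<tau>']) simp
    qed
  qed
  moreover obtain n where "1 / (2 * Im \<tau>) < 2 ^ n" using real_arch_pow[of 2 "1 / (2 * Im \<tau>)"] by auto
  then have "Im \<tau> * 2 ^ n \<ge> 1 / 2" using t by (simp add: field_simps)
  ultimately show ?thesis using t by blast
qed

text \<open>The maximum modulus principle: \<open>|h|\<close> is small near the cusp, so by invariance it attains its maximum over the
  half-plane on a compact rectangle, and \<open>h\<close> is constant.\<close>
lemma level_one_vanish:
  assumes hol: "h holomorphic_on UHP"
    and T: "\<And>\<tau>. Im \<tau> > 0 \<Longrightarrow> h (\<tau> + 1) = h \<tau>"
    and S: "\<And>\<tau>. Im \<tau> > 0 \<Longrightarrow> h (- 1 / \<tau>) = h \<tau>"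
    and lim: "(h \<longlongrightarrow> 0) at_cusp" and t: "Im \<tau> > 0"
  shows "h \<tau> = 0"
proof (rule ccontr)
  assume nz: "h \<tau> \<noteq> 0"
  have "\<forall>\<^sub>F \<sigma> in at_cusp. norm (h \<sigma>) < norm (h \<tau>)"
    using tendstoD[OF lim, of "norm (h \<tau>)"] nz by (simp add: dist_norm)
  then obtain Y where Y: "\<And>\<sigma>. Im \<sigma> \<ge> Y \<Longrightarrow> norm (h \<sigma>) < norm (h \<tau>)"
    unfolding eventually_filtercomap eventually_at_top_linorder by blast
  define K where "K = cbox (Complex (- 1 / 2) (1 / 2)) (Complex (1 / 2) (max Y 1))"
  have K: "\<sigma> \<in> K \<longleftrightarrow> \<bar>Re \<sigma>\<bar> \<le> 1 / 2 \<and> 1 / 2 \<le> Im \<sigma> \<and> Im \<sigma> \<le> max Y 1" for \<sigma>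
    by (auto simp: K_def in_cbox_complex_iff)
  have "compact K" by (simp add: K_def compact_cbox)
  moreover have "Complex 0 (1/2) \<in> K" by (simp add: K)
  then have "K \<noteq> {}" by blast
  moreover have "continuous_on K (\<lambda>\<sigma>. norm (h \<sigma>))"
    by (intro continuous_on_norm holomorphic_on_imp_continuous_on holomorphic_on_subset[OF hol]) (auto simp: K)
  ultimately obtain \<xi> where \<xi>: "\<xi> \<in> K" "\<And>\<sigma>. \<sigma> \<in> K \<Longrightarrow> norm (h \<sigma>) \<le> norm (h \<xi>)"
    using continuous_attains_sup[of K "\<lambda>\<sigma>. norm (h \<sigma>)"] by blast
  have le: "norm (h \<sigma>) \<le> norm (h \<xi>) \<or> norm (h \<sigma>) < norm (h \<tau>)" if s: "Im \<sigma> > 0" for \<sigma>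
  proof -
    obtain \<sigma>' where \<sigma>': "\<bar>Re \<sigma>'\<bar> \<le> 1 / 2" "Im \<sigma>' \<ge> 1 / 2" "h \<sigma>' = h \<sigma>"
      using reduce_level_one[OF T S s] by blast
    show ?thesis
    proof (cases "Im \<sigma>' \<le> max Y 1")
      case True
      then have "\<sigma>' \<in> K" using \<sigma>' by (simp add: K)
      then show ?thesis using \<xi>(2) \<sigma>' by metis
    next
      case False
      then have "norm (h \<sigma>') < norm (h \<tau>)" using Y by simp
      then show ?thesis using \<sigma>' by simp
    qed
  qed
  then have max: "norm (h \<sigma>) \<le> norm (h \<xi>)" if "Im \<sigma> > 0" for \<sigma>
    using le[OF that] le[OF t] by linarith
  have "h constant_on UHP"
    by (rule maximum_modulus_principle[OF hol open_UHP _ open_UHP subset_refl])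
       (use \<xi>(1) max in \<open>auto simp: K convex_connected convex_halfspace_Im_gt\<close>)
  then obtain c where c: "\<And>\<sigma>. Im \<sigma> > 0 \<Longrightarrow> h \<sigma> = c" unfolding constant_on_def by auto
  have "(h \<longlongrightarrow> c) at_cusp"
  proof (rule Lim_transform_eventually[OF tendsto_const])
    show "\<forall>\<^sub>F \<sigma> in at_cusp. c = h \<sigma>"
      using eventually_at_cusp_UHP by eventually_elim (simp add: c)
  qed
  then have "c = 0" using lim by (rule tendsto_unique[OF at_cusp_neq_bot])
  then show False using nz c[OF t] by simp
qed

lemma nome_tendsto: "(nome \<longlongrightarrow> 0) at_cusp"
proof -
  have "((\<lambda>y. exp (- 2 * pi * y)) \<longlongrightarrow> 0) at_top" by real_asymp
  then have "((\<lambda>\<tau>. exp (- 2 * pi * Im \<tau>)) \<longlongrightarrow> 0) at_cusp"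
    by (rule filterlim_compose[OF _ filterlim_filtercomap])
  then have "((\<lambda>\<tau>. norm (nome \<tau>)) \<longlongrightarrow> 0) at_cusp" by (simp add: nome_def norm_exp_eq_Re)
  then show ?thesis by (rule tendsto_norm_zero_cancel)
qed

text \<open>A one-periodic function vanishing at the cusp is divisible by the nome: it descends to the
  punctured disc, where the singularity at the origin is removable.\<close>
lemma cusp_order_one:
  assumes hol: "f holomorphic_on UHP"
    and T: "\<And>\<tau>. Im \<tau> > 0 \<Longrightarrow> f (\<tau> + 1) = f \<tau>"
    and lim: "(f \<longlongrightarrow> 0) at_cusp"
  shows "\<exists>L. ((\<lambda>\<tau>. f \<tau> / nome \<tau>) \<longlongrightarrow> L) at_cusp"
proof -
  define c where "c = 2 * of_real pi * \<i>"
  have c: "c \<noteq> 0" by (simp add: c_def)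
  define g where "g w = (if w = 0 then 0 else f (Ln w / c))" for w
  have im: "Im (z / c) = - Re z / (2 * pi)" for z
    unfolding c_def by (simp add: Im_divide power2_eq_square)
  have g: "g (exp (c * z)) = f z" if "Im z > 0" for z
  proof -
    have "exp (Ln (exp (c * z))) = exp (c * z)" by simp
    then obtain n :: int where n: "Ln (exp (c * z)) = c * z + of_int (2 * n) * pi * \<i>"
      unfolding exp_eq by blast
    then have "Ln (exp (c * z)) / c = z + of_int n"
      using c by (simp add: c_def field_simps)
    then show ?thesis using periodic_of_int[of f, OF T that, of n] by (simp add: g_def)
  qed
  have lnneg: "Re (Ln w) < 0" if "w \<in> ball 0 1" "w \<noteq> 0" for w :: complex
    using that by simp
  have hol1: "g holomorphic_on (ball 0 1 - {0})"
  proof -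
    have "g field_differentiable at w" if w: "w \<in> ball 0 1 - {0}" for w
    proof -
      \<comment> \<open>A local branch of the logarithm at \<open>w\<close>: rotate by \<open>s = - 1\<close> if \<open>w\<close> lies on the cut.\<close>
      obtain b :: complex and s where b: "w * s \<notin> \<real>\<^sub>\<le>\<^sub>0" "s \<noteq> 0" "norm s = 1" "exp b * s = 1" "Re b = 0"
      proof (cases "w \<in> \<real>\<^sub>\<le>\<^sub>0")
        case False
        then show ?thesis using that[of 1 0] by simp
      next
        case True
        then have "w * (-1) \<notin> \<real>\<^sub>\<le>\<^sub>0" using w by (auto simp: complex_nonpos_Reals_iff complex_eq_iff)
        then show ?thesis using that[of "-1" "of_real pi * \<i>"] by simp
      qed
      define U where "U = {v \<in> ball 0 1 - {0}. v * s \<notin> \<real>\<^sub>\<le>\<^sub>0}"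
      have U: "open U"
      proof -
        have "U = (ball 0 1 - {0}) \<inter> (\<lambda>v. v * s) -` (- \<real>\<^sub>\<le>\<^sub>0)" by (auto simp: U_def)
        moreover have "open ((ball 0 1 - {0}) \<inter> (\<lambda>v. v * s) -` (- \<real>\<^sub>\<le>\<^sub>0))"
          by (intro continuous_open_preimage continuous_intros open_Diff) auto
        ultimately show ?thesis by simp
      qed
      have wU: "w \<in> U" using w b by (simp add: U_def)
      have Ui: "Im ((Ln (v * s) + b) / c) > 0" if "v \<in> U" for v
      proof -
        have v: "norm v < 1" "v \<noteq> 0" using that by (auto simp: U_def)
        then have "ln (norm v) < 0" by simp
        then show ?thesis using b v by (simp add: im norm_mult divide_neg_pos)
      qed
      have "(\<lambda>v. f ((Ln (v * s) + b) / c)) holomorphic_on U"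
      proof (rule holomorphic_on_compose_gen[OF _ hol, unfolded o_def])
        show "(\<lambda>v. (Ln (v * s) + b) / c) holomorphic_on U"
          using c by (intro holomorphic_intros) (auto simp: U_def)
      qed (use Ui in auto)
      moreover have "f ((Ln (v * s) + b) / c) = g v" if "v \<in> U" for v
      proof -
        have "exp (c * ((Ln (v * s) + b) / c)) = v"
        proof -
          have "s * exp b = 1" using b(4) by (simp add: mult.commute)
          then show ?thesis using c b that by (simp add: exp_add U_def)
        qed
        then show ?thesis using g[OF Ui[OF that]] by simp
      qed
      ultimately have "g holomorphic_on U" by (simp cong: holomorphic_cong)
      then show ?thesis using holomorphic_on_imp_differentiable_at U wU by blast
    qed
    then show ?thesis by (simp add: holomorphic_on_def field_differentiable_at_within)
  qed
  have g0: "(g \<longlongrightarrow> g 0) (at 0)"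
  proof -
    have "filterlim (\<lambda>w::complex. Ln w / c) at_cusp (at 0)"
      unfolding filterlim_filtercomap_iff o_def
    proof -
      have "filterlim (\<lambda>r. - ln r / (2 * pi)) at_top (at_right 0)" by real_asymp
      moreover have "filterlim norm (at_right 0) (at (0::complex))"
        unfolding filterlim_at by (auto intro!: tendsto_eq_intros simp: eventually_at_filter)
      ultimately have "filterlim (\<lambda>w::complex. - ln (norm w) / (2 * pi)) at_top (at 0)"
        by (rule filterlim_compose)
      then show "filterlim (\<lambda>w::complex. Im (Ln w / c)) at_top (at 0)"
        by (rule filterlim_cong[THEN iffD1, rotated -1, OF _ refl refl]) (auto simp: eventually_at_filter im)
    qed
    from filterlim_compose[OF lim this] have "((\<lambda>w. f (Ln w / c)) \<longlongrightarrow> 0) (at 0)" .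
    then have "(g \<longlongrightarrow> 0) (at 0)"
      by (rule Lim_transform_eventually) (auto simp: eventually_at_filter g_def)
    then show ?thesis by (simp add: g_def)
  qed
  have "g holomorphic_on ball 0 1"
    by (rule no_isolated_singularity'[OF _ hol1]) (use g0 in \<open>auto simp: at_within_open[of 0 "ball 0 1"]\<close>)
  then have "(g has_field_derivative deriv g 0) (at 0)"
    by (intro holomorphic_derivI) auto
  then have D: "((\<lambda>w. g w / w) \<longlongrightarrow> deriv g 0) (at 0)"
    by (simp add: has_field_derivative_iff g_def)
  have "filterlim nome (at 0) at_cusp"
    unfolding filterlim_at
  proof
    show "\<forall>\<^sub>F x in at_cusp. nome x \<in> UNIV \<and> nome x \<noteq> 0" by (simp add: nome_def)
    show "(nome \<longlongrightarrow> 0) at_cusp" by (rule nome_tendsto)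
  qed
  from filterlim_compose[OF D this] have "((\<lambda>\<tau>. g (nome \<tau>) / nome \<tau>) \<longlongrightarrow> deriv g 0) at_cusp" .
  then have "((\<lambda>\<tau>. f \<tau> / nome \<tau>) \<longlongrightarrow> deriv g 0) at_cusp"
  proof (rule Lim_transform_eventually)
    show "\<forall>\<^sub>F x in at_cusp. g (nome x) / nome x = f x / nome x"
      using eventually_at_cusp_UHP
    proof eventually_elim
      case (elim x)
      then show ?case using g[of x] by (simp add: nome_def c_def mult_ac)
    qed
  qed
  then show ?thesis by blast
qed

lemma nome_plus1: "nome (\<tau> + 1) = nome \<tau>"
  by (simp add: nome_def ring_distribs exp_add)

section \<open>Theta constants at the cusp\<close>

lemma filterlim_cusp_plus1: "filterlim (\<lambda>\<tau>. \<tau> + 1) at_cusp at_cusp"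
  unfolding filterlim_filtercomap_iff o_def by simp (rule filterlim_filtercomap)

lemma filterlim_cusp_mult: "c > 0 \<Longrightarrow> filterlim (\<lambda>\<tau>. of_real c * \<tau>) at_cusp at_cusp"
  unfolding filterlim_filtercomap_iff o_def
  by simp (rule filterlim_tendsto_pos_mult_at_top[OF tendsto_const _ filterlim_filtercomap])

lemma th3_tendsto: "(th3 \<longlongrightarrow> 1) at_cusp"
proof -
  have e: "{n::int. (real_of_int n)\<^sup>2 = 0} = {0}" by auto
  have "(real_of_int n)\<^sup>2 = 0 \<or> (real_of_int n)\<^sup>2 \<ge> 1" for n
  proof (cases "n = 0")
    case False
    then have "\<bar>real_of_int n\<bar> \<ge> 1" by linarith
    then show ?thesis using power_mono[of 1 "\<bar>real_of_int n\<bar>" 2] by simp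
  qed simp
  from quad_series_tendsto[OF sq_ge_abs(1) this] show ?thesis unfolding th3_def e by simp
qed

lemma th4_tendsto: "(th4 \<longlongrightarrow> 1) at_cusp"
  unfolding th4_def [abs_def] by (rule filterlim_compose[OF th3_tendsto filterlim_cusp_plus1])

text \<open>Dividing by the leading term turns the exponents \<open>(n + 1/2)\<^sup>2\<close> into \<open>n (n + 1)\<close>, which vanish exactly for
  \<open>n = 0\<close> and \<open>n = - 1\<close>.\<close>
lemma th2_tendsto: "((\<lambda>\<tau>. th2 \<tau> / exp (of_real pi * \<i> * \<tau> / 4)) \<longlongrightarrow> 2) at_cusp"
proof -
  have e: "{n::int. real_of_int (n * (n + 1)) = 0} = {0, -1}" by auto
  have 1: "real_of_int (n * (n + 1)) = 0 \<or> real_of_int (n * (n + 1)) \<ge> 1" for n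
  proof -
    have "n * (n + 1) \<ge> 0" by (cases "n \<ge> 0") (auto intro: mult_nonpos_nonpos)
    then have "n * (n + 1) = 0 \<or> n * (n + 1) \<ge> 1" by linarith
    then show ?thesis by (metis of_int_0 of_int_1_le_iff)
  qed
  have 2: "real_of_int (n * (n + 1)) \<ge> \<bar>of_int n\<bar> - 1" for n
  proof -
    have "n * (n + 1) \<ge> \<bar>n\<bar> - 1"
    proof (cases "n \<ge> 0")
      case False
      have "(n + 1) * (n + 1) \<ge> 0" by simp
      then show ?thesis using False by (simp add: algebra_simps)
    qed (simp add: algebra_simps)
    then show ?thesis by linarith
  qed
  have "(quad_series (\<lambda>n. real_of_int (n * (n + 1))) \<longlongrightarrow> 2) at_cusp"
    using quad_series_tendsto[of "\<lambda>n. real_of_int (n * (n + 1))", OF 2 1] unfolding e by simp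
  moreover have "quad_series (\<lambda>n. real_of_int (n * (n + 1))) \<tau> = th2 \<tau> / exp (of_real pi * \<i> * \<tau> / 4)" for \<tau>
  proof -
    have "th2 \<tau> = (\<Sum>\<^sub>\<infinity>n::int. exp (of_real pi * \<i> * \<tau> / 4) * exp (of_real pi * \<i> * of_real (real_of_int (n * (n + 1))) * \<tau>))"
      unfolding th2_def quad_series_def exp_add[symmetric]
      by (intro infsum_cong arg_cong[where f = exp]) (simp add: power2_eq_square field_simps)
    also have "\<dots> = exp (of_real pi * \<i> * \<tau> / 4) * quad_series (\<lambda>n. real_of_int (n * (n + 1))) \<tau>"
      unfolding quad_series_def by (rule infsum_cmult_right')
    finally show ?thesis by simp
  qed
  then have "quad_series (\<lambda>n. real_of_int (n * (n + 1))) = (\<lambda>\<tau>. th2 \<tau> / exp (of_real pi * \<i> * \<tau> / 4))" by blast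
  ultimately show ?thesis by (simp only:)
qed

lemma th2_tendsto_0: "(th2 \<longlongrightarrow> 0) at_cusp"
proof -
  have "((\<lambda>y. exp (- pi * y / 4)) \<longlongrightarrow> 0) at_top" by real_asymp
  then have "((\<lambda>\<tau>. exp (- pi * Im \<tau> / 4)) \<longlongrightarrow> 0) at_cusp"
    by (rule filterlim_compose[OF _ filterlim_filtercomap])
  then have "((\<lambda>\<tau>. norm (exp (of_real pi * \<i> * \<tau> / 4))) \<longlongrightarrow> 0) at_cusp" by (simp add: norm_exp_eq_Re)
  then have "((\<lambda>\<tau>. exp (of_real pi * \<i> * \<tau> / 4)) \<longlongrightarrow> 0) at_cusp" by (rule tendsto_norm_zero_cancel)
  from tendsto_mult[OF th2_tendsto this] show ?thesis by simp
qed

section \<open>Level one forms of small weight\<close>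

text \<open>Equal to \<open>\<eta>\<^sup>2\<^sup>4\<close>. In this form the transformation behaviour follows from that of the theta constants.\<close>
definition Delta :: "complex \<Rightarrow> complex" where
  "Delta \<tau> = (th2 \<tau> * th3 \<tau> * th4 \<tau>) ^ 8 / 256"

lemma Delta_holo: "Delta holomorphic_on UHP"
  unfolding Delta_def [abs_def] by (intro holomorphic_intros th2_holo th3_holo th4_holo) auto

lemma Delta_nz: "Im \<tau> > 0 \<Longrightarrow> Delta \<tau> \<noteq> 0"
  by (simp add: Delta_def theta_nz)

lemma csqrt_power: "csqrt z ^ (2 * n) = z ^ n"
  by (simp add: power_mult)

lemma th2_plus1_4: "th2 (\<tau> + 1) ^ 4 = - (th2 \<tau> ^ 4)"
proof -
  have "th2 (\<tau> + 1) ^ 4 = (th2 (\<tau> + 1) ^ 2) ^ 2" by simp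
  also have "\<dots> = - (th2 \<tau> ^ 4)" unfolding th2_plus1_sq by (simp add: power_mult_distrib)
  finally show ?thesis .
qed

lemma th2_plus1_8: "th2 (\<tau> + 1) ^ 8 = th2 \<tau> ^ 8"
proof -
  have "th2 (\<tau> + 1) ^ 8 = (th2 (\<tau> + 1) ^ 4) ^ 2" by simp
  also have "\<dots> = th2 \<tau> ^ 8" unfolding th2_plus1_4 by simp
  finally show ?thesis .
qed

lemma Delta_plus1: "Delta (\<tau> + 1) = Delta \<tau>"
  by (simp add: Delta_def power_mult_distrib th2_plus1_8 th3_plus1 th4_plus1)

lemma minus_i_powers: "(- \<i> * \<tau>) ^ 4 = \<tau> ^ 4" "(- \<i> * \<tau>) ^ 12 = \<tau> ^ 12"
proof -
  have "(- \<i>) ^ 4 = (1::complex)" by (simp add: power4_eq_xxxx)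
  moreover have "(- \<i>) ^ 12 = ((- \<i>) ^ 4) ^ (3::nat)" by (simp only: power_mult[symmetric]) simp
  ultimately have "(- \<i>) ^ 4 = (1::complex)" "(- \<i>) ^ 12 = (1::complex)" by simp_all
  then show "(- \<i> * \<tau>) ^ 4 = \<tau> ^ 4" "(- \<i> * \<tau>) ^ 12 = \<tau> ^ 12" by (simp_all only: power_mult_distrib mult_1_left)
qed

lemma Delta_inversion:
  assumes "Im \<tau> > 0" shows "Delta (- 1 / \<tau>) = \<tau> ^ 12 * Delta \<tau>"
proof -
  have "Delta (- 1 / \<tau>) = csqrt (- \<i> * \<tau>) ^ (2 * 12) * (th2 \<tau> * th3 \<tau> * th4 \<tau>) ^ 8 / 256"
    unfolding Delta_def th2_inversion[OF assms] th3_inversion[OF assms] th4_inversion[OF assms]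
    by (simp add: power_mult_distrib power_add[symmetric] mult_ac)
  then show ?thesis unfolding csqrt_power minus_i_powers by (simp add: Delta_def)
qed

lemma Delta_tendsto: "((\<lambda>\<tau>. nome \<tau> / Delta \<tau>) \<longlongrightarrow> 1) at_cusp"
proof -
  have "((\<lambda>\<tau>. 256 / ((th2 \<tau> / exp (of_real pi * \<i> * \<tau> / 4)) * th3 \<tau> * th4 \<tau>) ^ 8) \<longlongrightarrow> 256 / (2 * 1 * 1) ^ 8) at_cusp"
    by (intro tendsto_intros th2_tendsto th3_tendsto th4_tendsto) auto
  moreover have "256 / ((th2 \<tau> / exp (of_real pi * \<i> * \<tau> / 4)) * th3 \<tau> * th4 \<tau>) ^ 8 = nome \<tau> / Delta \<tau>" for \<tau>
  proof -
    have "exp (of_real pi * \<i> * \<tau> / 4) ^ 8 = nome \<tau>"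
      unfolding nome_def exp_of_nat_mult[symmetric] by (rule arg_cong[where f = exp]) simp
    then show ?thesis by (simp add: Delta_def power_mult_distrib power_divide)
  qed
  ultimately show ?thesis by simp
qed

text \<open>The function \<open>f\<^sup>3 / \<Delta>\<^sup>n\<close> has weight zero, and it vanishes at the cusp since \<open>f\<^sup>3\<close> has there a zero of order
  at least \<open>3 > n\<close>.\<close>
lemma level_one_weight_vanish:
  assumes hol: "f holomorphic_on UHP"
    and T: "\<And>\<tau>. Im \<tau> > 0 \<Longrightarrow> f (\<tau> + 1) = f \<tau>"
    and S: "\<And>\<tau>. Im \<tau> > 0 \<Longrightarrow> f (- 1 / \<tau>) = \<tau> ^ (4 * n) * f \<tau>"
    and lim: "(f \<longlongrightarrow> 0) at_cusp" and n: "n < 3" and t: "Im \<tau> > 0"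
  shows "f \<tau> = 0"
proof -
  define h where "h = (\<lambda>\<tau>. f \<tau> ^ 3 / Delta \<tau> ^ n)"
  have "h \<tau> = 0"
  proof (rule level_one_vanish[OF _ _ _ _ t])
    show "h holomorphic_on UHP" unfolding h_def
      using Delta_nz by (intro holomorphic_intros hol Delta_holo) auto
    show "h (\<tau> + 1) = h \<tau>" if "Im \<tau> > 0" for \<tau> using that by (simp add: h_def T Delta_plus1)
    show "h (- 1 / \<tau>) = h \<tau>" if "Im \<tau> > 0" for \<tau>
    proof -
      have "h (- 1 / \<tau>) = (\<tau> ^ (4 * n) * f \<tau>) ^ 3 / (\<tau> ^ 12 * Delta \<tau>) ^ n"
        unfolding h_def S[OF that] Delta_inversion[OF that] ..
      also have "\<dots> = h \<tau>"
        using UHP_nz[OF that] by (simp add: h_def power_mult_distrib power_mult[symmetric] mult_ac)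
      finally show ?thesis .
    qed
    obtain L where L: "((\<lambda>\<tau>. f \<tau> / nome \<tau>) \<longlongrightarrow> L) at_cusp"
      using cusp_order_one[OF hol T lim] by blast
    have "((\<lambda>\<tau>. (f \<tau> / nome \<tau>) ^ 3 * (nome \<tau> / Delta \<tau>) ^ n * nome \<tau> ^ (3 - n)) \<longlongrightarrow> L ^ 3 * 1 ^ n * 0 ^ (3 - n)) at_cusp"
      by (intro tendsto_intros L Delta_tendsto nome_tendsto)
    moreover have "(f \<tau> / nome \<tau>) ^ 3 * (nome \<tau> / Delta \<tau>) ^ n * nome \<tau> ^ (3 - n) = h \<tau>" for \<tau>
    proof -
      have q: "nome \<tau> \<noteq> 0" by (simp add: nome_def)
      have "nome \<tau> ^ 3 = nome \<tau> ^ n * nome \<tau> ^ (3 - n)" using n by (simp add: power_add[symmetric])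
      then show ?thesis using q by (simp add: h_def power_divide field_simps)
    qed
    ultimately show "(h \<longlongrightarrow> 0) at_cusp" using n by (simp add: power_0_left)
  qed
  then show ?thesis using Delta_nz[OF t] by (simp add: h_def)
qed

definition e4 :: "complex \<Rightarrow> complex" where
  "e4 \<tau> = (th2 \<tau> ^ 8 + th3 \<tau> ^ 8 + th4 \<tau> ^ 8) / 2"

lemma e4_holo: "e4 holomorphic_on UHP"
  unfolding e4_def [abs_def] by (intro holomorphic_intros th2_holo th3_holo th4_holo) auto

lemma e4_plus1: "e4 (\<tau> + 1) = e4 \<tau>"
  by (simp add: e4_def th2_plus1_8 th3_plus1 th4_plus1)

lemma e4_inversion: "Im \<tau> > 0 \<Longrightarrow> e4 (- 1 / \<tau>) = \<tau> ^ 4 * e4 \<tau>"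
proof -
  assume t: "Im \<tau> > 0"
  have "e4 (- 1 / \<tau>) = csqrt (- \<i> * \<tau>) ^ (2 * 4) * e4 \<tau>"
    unfolding e4_def th2_inversion[OF t] th3_inversion[OF t] th4_inversion[OF t]
    by (simp add: power_mult_distrib algebra_simps)
  then show ?thesis unfolding csqrt_power minus_i_powers .
qed

lemma e4_tendsto: "(e4 \<longlongrightarrow> 1) at_cusp"
proof -
  have "(e4 \<longlongrightarrow> (0 ^ 8 + 1 ^ 8 + 1 ^ 8) / 2) at_cusp"
    unfolding e4_def [abs_def] by (intro tendsto_intros th2_tendsto_0 th3_tendsto th4_tendsto) auto
  then show ?thesis by simp
qed

section \<open>Lipschitz's formula in weight four\<close>

lemma rational_deriv1: "w \<noteq> 1 \<Longrightarrow> ((\<lambda>w. 1 + 2 / (w - 1)) has_field_derivative (- 2 / (w - 1) ^ 2)) (at (w::complex))"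
  by (auto intro!: derivative_eq_intros simp: power2_eq_square)
lemma rational_deriv2: "w \<noteq> 1 \<Longrightarrow> ((\<lambda>w. w / (w - 1) ^ 2) has_field_derivative (- (w + 1) / (w - 1) ^ 3)) (at (w::complex))"
proof -
  assume w: "w \<noteq> 1"
  have e: "((\<lambda>w. w / (w - 1) ^ 2) has_field_derivative (1 * (w - 1) ^ 2 - w * (2 * (w - 1))) / ((w - 1) ^ 2 * (w - 1) ^ 2)) (at w)"
    using w by (auto intro!: derivative_eq_intros)
  define b where "b = w - 1"
  have b: "w = b + 1" "b \<noteq> 0" using w by (simp_all add: b_def)
  have "(1 * (w - 1) ^ 2 - w * (2 * (w - 1))) / ((w - 1) ^ 2 * (w - 1) ^ 2) = - (w + 1) / (w - 1) ^ 3"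
    unfolding b(1) using b(2) by (simp add: divide_simps) (simp add: eval_nat_numeral algebra_simps)
  then show ?thesis using e by (simp only:)
qed
lemma rational_deriv3: "w \<noteq> 1 \<Longrightarrow> ((\<lambda>w. w * (w + 1) / (w - 1) ^ 3) has_field_derivative (- (w ^ 2 + 4 * w + 1) / (w - 1) ^ 4)) (at (w::complex))"
proof -
  assume w: "w \<noteq> 1"
  have e: "((\<lambda>w. w * (w + 1) / (w - 1) ^ 3) has_field_derivative ((2 * w + 1) * (w - 1) ^ 3 - w * (w + 1) * (3 * (w - 1) ^ 2)) / ((w - 1) ^ 3 * (w - 1) ^ 3)) (at w)"
    using w by (auto intro!: derivative_eq_intros simp: algebra_simps)
  define b where "b = w - 1"
  have b: "w = b + 1" "b \<noteq> 0" using w by (simp_all add: b_def)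
  have "((2 * w + 1) * (w - 1) ^ 3 - w * (w + 1) * (3 * (w - 1) ^ 2)) / ((w - 1) ^ 3 * (w - 1) ^ 3) = - (w ^ 2 + 4 * w + 1) / (w - 1) ^ 4"
    unfolding b(1) using b(2) by (simp add: divide_simps) (simp add: eval_nat_numeral algebra_simps)
  then show ?thesis using e by (simp only:)
qed
lemma DERIV_one_minus: "((\<lambda>z. 1 - z) has_field_derivative -1) (at (z::complex))"
  using DERIV_diff[OF DERIV_const[of 1] DERIV_ident] by simp
lemma DERIV_sin_pi: "((\<lambda>z. sin (of_real pi * z)) has_field_derivative cos (of_real pi * z) * of_real pi) (at (z::complex))"
  by (auto intro!: derivative_eq_intros)

text \<open>The reflection formula of the Gamma function, differentiated logarithmically and then three more times. The
  logarithmic derivative of the sine is a rational function of \<open>w = e(z)\<close>, hence so are all further derivatives.\<close>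
lemma polygamma_reflection:
  fixes z :: complex
  assumes z: "z \<notin> \<int>"
  defines "w \<equiv> exp (2 * of_real pi * \<i> * z)"
  shows "Polygamma 3 z + Polygamma 3 (1 - z) = 16 * of_real pi ^ 4 * (w * (w\<^sup>2 + 4 * w + 1) / (1 - w) ^ 4)"
proof -
  define U where "U = - (\<int> :: complex set)"
  have U: "open U" "z \<in> U" using z by (auto simp: U_def open_Compl)
  define W where "W = (\<lambda>z::complex. exp (2 * of_real pi * \<i> * z))"
  define c where "c = 2 * of_real pi * \<i>"
  have W1: "W z \<noteq> 1" if "z \<in> U" for z
  proof
    assume "W z = 1"
    then obtain n :: int where "Re (2 * of_real pi * \<i> * z) = 0" "Im (2 * of_real pi * \<i> * z) = of_int (2 * n) * pi"
      unfolding W_def exp_eq_1 by blast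
    then have "z = of_int n" by (simp add: complex_eq_iff)
    then show False using that by (simp add: U_def)
  qed
  have dW: "(W has_field_derivative c * W z) (at z)" for z
    unfolding W_def c_def by (rule derivative_eq_intros refl)+ simp
  have np: "z \<notin> \<int>\<^sub>\<le>\<^sub>0" "1 - z \<notin> \<int>\<^sub>\<le>\<^sub>0" if "z \<in> U" for z
  proof -
    show "z \<notin> \<int>\<^sub>\<le>\<^sub>0" using that by (auto simp: U_def nonpos_Ints_def)
    have "1 - z \<notin> \<int>"
    proof
      assume "1 - z \<in> \<int>"
      then have "1 - (1 - z) \<in> \<int>" by (rule Ints_diff[OF Ints_1])
      moreover have "1 - (1 - z) = z" by simp
      ultimately have "z \<in> \<int>" by (simp only:)
      then show False using that by (simp add: U_def)
    qed
    moreover have "1 - z \<in> \<int>" if np: "1 - z \<in> \<int>\<^sub>\<le>\<^sub>0"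
    proof -
      from np obtain n where "1 - z = of_int n" by (rule nonpos_Ints_cases)
      then show ?thesis by (simp only: Ints_of_int)
    qed
    ultimately show "1 - z \<notin> \<int>\<^sub>\<le>\<^sub>0" by blast
  qed
  have dP1: "(Polygamma n has_field_derivative Polygamma (Suc n) z) (at z)"
    and dP2: "((\<lambda>z. Polygamma n (1 - z)) has_field_derivative - Polygamma (Suc n) (1 - z)) (at z)" if "z \<in> U" for z :: complex and n
  proof -
    show "(Polygamma n has_field_derivative Polygamma (Suc n) z) (at z)"
      by (rule has_field_derivative_Polygamma[OF np(1)[OF that]])
    have "((\<lambda>z. Polygamma n (1 - z)) has_field_derivative Polygamma (Suc n) (1 - z) * (-1)) (at z)"
      by (rule DERIV_chain2[OF has_field_derivative_Polygamma[OF np(2)[OF that]] DERIV_one_minus])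
    then show "((\<lambda>z. Polygamma n (1 - z)) has_field_derivative - Polygamma (Suc n) (1 - z)) (at z)" by simp
  qed
  have transf: "f' = g'" if "\<And>z. z \<in> U \<Longrightarrow> f z = g z" "(f has_field_derivative f') (at z)" "(g has_field_derivative g') (at z)" "z \<in> U"
    for f g :: "complex \<Rightarrow> complex" and f' g' z
  proof -
    have "(g has_field_derivative f') (at z)"
      by (rule has_field_derivative_transform_within_open[of f f' z U g]) (fact that U)+
    then show ?thesis using that(3) by (rule DERIV_unique)
  qed
  have e0: "Polygamma 0 (1 - z) - Polygamma 0 z = of_real pi * \<i> * (1 + 2 / (W z - 1))" if z: "z \<in> U" for z :: complex
  proof -
    have refl: "of_real pi * (rGamma z * rGamma (1 - z)) = sin (of_real pi * z)" if "z \<in> U" for z :: complex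
      unfolding rGamma_reflection_complex by simp
    have "((\<lambda>z. rGamma (1 - z)) has_field_derivative (- rGamma (1 - z) * Digamma (1 - z)) * (-1)) (at z)"
      by (rule DERIV_chain2[OF has_field_derivative_rGamma_no_nonpos_int[OF np(2)[OF z]] DERIV_one_minus])
    note d = DERIV_cmult[OF DERIV_mult[OF has_field_derivative_rGamma_no_nonpos_int[OF np(1)[OF z]] this], of "of_real pi"]
    note transf[OF refl d DERIV_sin_pi z]
    then have "of_real pi * ((rGamma z * rGamma (1 - z)) * (Digamma (1 - z) - Digamma z)) = of_real pi * cos (of_real pi * z)"
      by (simp add: algebra_simps)
    then have "(rGamma z * rGamma (1 - z)) * (Digamma (1 - z) - Digamma z) = cos (of_real pi * z)"
      by simp
    then have A: "sin (of_real pi * z) * (Digamma (1 - z) - Digamma z) = of_real pi * cos (of_real pi * z)"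
      unfolding rGamma_reflection_complex by (simp add: field_simps)
    define v where "v = exp (of_real pi * \<i> * z)"
    have v: "v \<noteq> 0" "W z = v * v" "exp (\<i> * (of_real pi * z)) = v" "exp (- (\<i> * (of_real pi * z))) = 1 / v"
      by (simp_all add: v_def W_def exp_add[symmetric] exp_minus mult_ac divide_inverse)
    define D where "D = Digamma (1 - z) - Digamma z"
    have "(v - 1 / v) / (2 * \<i>) * D = of_real pi * ((v + 1 / v) / 2)"
      using A unfolding sin_exp_eq cos_exp_eq v D_def[symmetric] by simp
    moreover have "(v - 1 / v) / (2 * \<i>) = (v * v - 1) / (2 * \<i> * v)" "(v + 1 / v) / 2 = (v * v + 1) / (2 * v)"
      using v(1) by (simp_all add: field_simps)
    ultimately have h: "(v * v - 1) / (2 * \<i> * v) * D = of_real pi * ((v * v + 1) / (2 * v))" by (simp only:)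
    have "(v * v - 1) * D = (2 * \<i> * v) * ((v * v - 1) / (2 * \<i> * v) * D)" using v(1) by simp
    also have "\<dots> = of_real pi * \<i> * (v * v + 1)" unfolding h using v(1) by simp
    finally have "(v * v - 1) * D = of_real pi * \<i> * (v * v + 1)" .
    moreover have "v * v - 1 \<noteq> 0" using W1[OF z] v by simp
    ultimately have "D = of_real pi * \<i> * (v * v + 1) / (v * v - 1)" by (simp add: nonzero_eq_divide_eq mult_ac)
    also have "\<dots> = of_real pi * \<i> * (1 + 2 / (v * v - 1))"
      using \<open>v * v - 1 \<noteq> 0\<close> by (simp add: divide_simps)
    finally show ?thesis unfolding D_def v(2) .
  qed
  have i2: "\<i> * (\<i> * x) = - x" for x :: complex by (simp add: mult.assoc[symmetric])
  have e1: "- Polygamma 1 (1 - z) - Polygamma 1 z = 4 * of_real pi ^ 2 * (W z / (W z - 1) ^ 2)" if z: "z \<in> U" for z :: complex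
  proof -
    have "- Polygamma (Suc 0) (1 - z) - Polygamma (Suc 0) z = of_real pi * \<i> * (- 2 / (W z - 1) ^ 2 * (c * W z))"
      using transf[OF e0 DERIV_diff[OF dP2[OF z] dP1[OF z]] DERIV_cmult[OF DERIV_chain2[OF rational_deriv1[OF W1[OF z]] dW]] z] .
    also have "\<dots> = 4 * of_real pi ^ 2 * (W z / (W z - 1) ^ 2)"
      by (simp add: c_def power2_eq_square mult_ac i2)
    finally show ?thesis by simp
  qed
  have e2: "Polygamma 2 (1 - z) - Polygamma 2 z = - 8 * of_real pi ^ 3 * \<i> * (W z * (W z + 1) / (W z - 1) ^ 3)" if z: "z \<in> U" for z :: complex
  proof -
    have "- (- Polygamma (Suc 1) (1 - z)) - Polygamma (Suc 1) z = 4 * of_real pi ^ 2 * (- (W z + 1) / (W z - 1) ^ 3 * (c * W z))"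
      using transf[OF e1 DERIV_diff[OF DERIV_minus[OF dP2[OF z]] dP1[OF z]] DERIV_cmult[OF DERIV_chain2[OF rational_deriv2[OF W1[OF z]] dW]] z] .
    also have "\<dots> = - 8 * of_real pi ^ 3 * \<i> * (W z * (W z + 1) / (W z - 1) ^ 3)"
    proof -
      have "4 * p ^ 2 * (- (w + 1) / D * (2 * p * \<i> * w)) = - 8 * p ^ 3 * \<i> * (w * (w + 1) / D)" for p w D :: complex
      proof -
        have "4 * p ^ 2 * (- (w + 1) * (2 * p * \<i> * w)) = - 8 * p ^ 3 * \<i> * (w * (w + 1))"
          by (simp add: eval_nat_numeral algebra_simps)
        from arg_cong[OF this, of "\<lambda>x. x / D"] show ?thesis by simp
      qed
      then show ?thesis unfolding c_def .
    qed
    finally show ?thesis by (simp add: numeral_2_eq_2)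
  qed
  have e3: "- Polygamma 3 (1 - z) - Polygamma 3 z = - 16 * of_real pi ^ 4 * (W z * (W z ^ 2 + 4 * W z + 1) / (W z - 1) ^ 4)" if z: "z \<in> U" for z :: complex
  proof -
    have "- Polygamma (Suc 2) (1 - z) - Polygamma (Suc 2) z = - 8 * of_real pi ^ 3 * \<i> * (- (W z ^ 2 + 4 * W z + 1) / (W z - 1) ^ 4 * (c * W z))"
      using transf[OF e2 DERIV_diff[OF dP2[OF z] dP1[OF z]] DERIV_cmult[OF DERIV_chain2[OF rational_deriv3[OF W1[OF z]] dW]] z] .
    also have "\<dots> = - 16 * of_real pi ^ 4 * (W z * (W z ^ 2 + 4 * W z + 1) / (W z - 1) ^ 4)"
    proof -
      have "- 8 * p ^ 3 * \<i> * (- (w ^ 2 + 4 * w + 1) / D * (2 * p * \<i> * w)) = - 16 * p ^ 4 * (w * (w ^ 2 + 4 * w + 1) / D)" for p w D :: complex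
      proof -
        have "- 8 * p ^ 3 * \<i> * (- (w ^ 2 + 4 * w + 1) * (2 * p * \<i> * w)) = - 16 * p ^ 4 * (w * (w ^ 2 + 4 * w + 1))"
          by (simp add: eval_nat_numeral algebra_simps i2)
        from arg_cong[OF this, of "\<lambda>x. x / D"] show ?thesis by simp
      qed
      then show ?thesis unfolding c_def .
    qed
    finally show ?thesis by (simp add: numeral_3_eq_3 numeral_2_eq_2)
  qed
  have sgn: "(W z - 1) ^ 4 = (1 - W z) ^ 4" by (simp add: power4_eq_xxxx algebra_simps)
  have "Polygamma 3 z + Polygamma 3 (1 - z) = - (- Polygamma 3 (1 - z) - Polygamma 3 z)" by simp
  also have "\<dots> = 16 * of_real pi ^ 4 * (W z * (W z ^ 2 + 4 * W z + 1) / (1 - W z) ^ 4)"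
    unfolding e3[OF U(2)] sgn by simp
  finally have "Polygamma 3 z + Polygamma 3 (1 - z) = 16 * of_real pi ^ 4 * (W z * (W z ^ 2 + 4 * W z + 1) / (1 - W z) ^ 4)" .
  then show ?thesis by (simp add: w_def W_def)
qed

lemma lattice_line_sum_raw:
  fixes z :: complex
  assumes z: "z \<notin> \<int>"
  shows "((\<lambda>n::int. 1 / (z + of_int n) ^ 4) has_sum (Polygamma 3 z + Polygamma 3 (1 - z)) / 6) UNIV"
proof -
  have abs: "summable (\<lambda>k. norm (1 / (u + of_nat k) ^ 4))" if "u \<noteq> 0" for u :: complex
  proof (rule summable_comparison_test_ev)
    have "summable (\<lambda>k. 1 / real k ^ 4)"
      using inverse_power_summable[of 4, where 'a = real] by (simp add: field_simps)
    then show "summable (\<lambda>k. 16 * (1 / real k ^ 4))" by (rule summable_mult)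
    show "\<forall>\<^sub>F k in sequentially. norm (norm (1 / (u + of_nat k) ^ 4)) \<le> 16 * (1 / real k ^ 4)"
      using eventually_ge_at_top[of "nat \<lceil>2 * norm u\<rceil> + 1"]
    proof eventually_elim
      case (elim k)
      then have k: "real k \<ge> 2 * norm u" "real k > 0" by linarith+
      have "norm (u + of_nat k) \<ge> real k - norm u"
        using norm_diff_ineq[of "of_nat k :: complex" u] by (simp add: add.commute)
      then have "real k / 2 \<le> norm (u + of_nat k)" using k by linarith
      then have "(real k / 2) ^ 4 \<le> norm (u + of_nat k) ^ 4" using k by (intro power_mono) auto
      then have "1 / norm (u + of_nat k) ^ 4 \<le> 1 / (real k / 2) ^ 4" using k by (intro divide_left_mono) (auto intro!: mult_pos_pos zero_less_power)
      then show ?case by (simp add: norm_divide norm_power power_divide)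
    qed
  qed
  have hs: "((\<lambda>k. 1 / (u + of_nat k) ^ 4) has_sum Polygamma 3 u / 6) UNIV" if "u \<noteq> 0" for u :: complex
  proof (rule norm_summable_imp_has_sum[OF abs[OF that]])
    show "(\<lambda>k. 1 / (u + of_nat k) ^ 4) sums (Polygamma 3 u / 6)"
      using Polygamma_LIMSEQ[OF that, of 3] by (simp add: inverse_eq_divide fact_numeral)
  qed
  have z0: "z \<noteq> 0" "1 - z \<noteq> 0" using z by auto
  have "((\<lambda>n::int. 1 / (z + of_int n) ^ 4) has_sum Polygamma 3 z / 6) {0..}"
  proof -
    have "((\<lambda>n::int. 1 / (z + of_int n) ^ 4) has_sum Polygamma 3 z / 6) {0..} \<longleftrightarrow>
          ((\<lambda>k. 1 / (z + of_nat k) ^ 4) has_sum Polygamma 3 z / 6) UNIV"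
      by (rule has_sum_reindex_bij_witness[of _ int nat]) auto
    then show ?thesis using hs[OF z0(1)] by blast
  qed
  moreover have "((\<lambda>n::int. 1 / (z + of_int n) ^ 4) has_sum Polygamma 3 (1 - z) / 6) {..<0}"
  proof -
    have "((\<lambda>n::int. 1 / (z + of_int n) ^ 4) has_sum Polygamma 3 (1 - z) / 6) {..<0} \<longleftrightarrow>
          ((\<lambda>k. 1 / (1 - z + of_nat k) ^ 4) has_sum Polygamma 3 (1 - z) / 6) UNIV"
    proof (rule has_sum_reindex_bij_witness[of _ "\<lambda>k. - int k - 1" "\<lambda>n. nat (- n - 1)"])
      fix n :: int assume "n \<in> {..<0}"
      then have "1 - z + of_nat (nat (- n - 1)) = - (z + of_int n)" by simp
      then show "1 / (1 - z + of_nat (nat (- n - 1))) ^ 4 = 1 / (z + of_int n) ^ 4"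
        by (simp only: power_minus_even even_numeral)
    qed auto
    then show ?thesis using hs[OF z0(2)] by blast
  qed
  ultimately have "((\<lambda>n::int. 1 / (z + of_int n) ^ 4) has_sum (Polygamma 3 z / 6 + Polygamma 3 (1 - z) / 6)) ({0..} \<union> {..<0})"
    by (rule has_sum_Un_disjoint) auto
  also have "{0..} \<union> {..<0} = (UNIV :: int set)" by auto
  finally show ?thesis by (simp add: add_divide_distrib)
qed

lemma summable_power_times:
  fixes w :: complex
  assumes "norm w < 1"
  shows "summable (\<lambda>n. of_nat n ^ p * w ^ n)"
  using assms
proof (induction p arbitrary: w)
  case 0
  then show ?case by (simp add: summable_geometric)
next
  case (Suc p)
  obtain K where K: "norm w < K" "K < 1" using Suc.prems dense by blast
  have "summable (\<lambda>n. diffs (\<lambda>n. of_nat n ^ p) n * w ^ n)"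
    by (rule termdiff_converges[of w K]) (use Suc.IH K in \<open>auto\<close>)
  then have "summable (\<lambda>n. w * (diffs (\<lambda>n. of_nat n ^ p) n * w ^ n))" by (rule summable_mult)
  then have "summable (\<lambda>n. of_nat (Suc n) ^ Suc p * w ^ Suc n)"
    by (simp add: diffs_def mult_ac)
  then show ?case by (subst (asm) summable_Suc_iff)
qed

lemma cube_series:
  fixes w :: complex
  assumes w: "norm w < 1"
  shows "(\<lambda>n. of_nat n ^ 3 * w ^ n) sums (w * (w\<^sup>2 + 4 * w + 1) / (1 - w) ^ 4)"
proof -
  define S where "S = (\<lambda>p. \<Sum>n. of_nat n ^ p * w ^ n)"
  have s: "(\<lambda>n. of_nat n ^ p * w ^ n) sums S p" for p
    unfolding S_def using summable_power_times[OF w] by (rule summable_sums)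
  have w1: "1 - w \<noteq> 0" using w by auto
  have shift: "S p = w * T" if "p > 0" "(\<lambda>n. of_nat (Suc n) ^ p * w ^ n) sums T" for p T
  proof -
    have "(\<lambda>n. of_nat (Suc n) ^ p * w ^ Suc n) sums (w * T)"
      using sums_mult[OF that(2), of w] by (simp add: mult_ac)
    then have "(\<lambda>n. of_nat n ^ p * w ^ n) sums (w * T)"
      using sums_Suc_iff[of "\<lambda>n. of_nat n ^ p * w ^ n" "w * T"] that(1) by (simp add: power_0_left)
    then show ?thesis using s[of p] by (rule sums_unique2[rotated])
  qed
  have S0: "S 0 = 1 / (1 - w)" using s[of 0] geometric_sums[OF w] by (auto dest: sums_unique2)
  have S1: "S 1 = w * (S 1 + S 0)"
  proof (rule shift)
    show "(\<lambda>n. of_nat (Suc n) ^ 1 * w ^ n) sums (S 1 + S 0)"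
      using sums_add[OF s[of 1] s[of 0]] by (simp add: algebra_simps)
  qed simp
  have S2: "S 2 = w * (S 2 + 2 * S 1 + S 0)"
  proof (rule shift)
    show "(\<lambda>n. of_nat (Suc n) ^ 2 * w ^ n) sums (S 2 + 2 * S 1 + S 0)"
      using sums_add[OF sums_add[OF s[of 2] sums_mult[OF s[of 1], of 2]] s[of 0]] by (simp add: algebra_simps power2_eq_square)
  qed simp
  have S3: "S 3 = w * (S 3 + 3 * S 2 + 3 * S 1 + S 0)"
  proof (rule shift)
    show "(\<lambda>n. of_nat (Suc n) ^ 3 * w ^ n) sums (S 3 + 3 * S 2 + 3 * S 1 + S 0)"
      using sums_add[OF sums_add[OF sums_add[OF s[of 3] sums_mult[OF s[of 2], of 3]] sums_mult[OF s[of 1], of 3]] s[of 0]]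
      by (simp add: algebra_simps power2_eq_square power3_eq_cube)
  qed simp
  define b where "b = 1 - w"
  have b: "w = 1 - b" "b \<noteq> 0" using w1 by (simp_all add: b_def)
  have solve: "S p = w * x / b" if "S p = w * (S p + x)" for p x
  proof -
    have "b * S p = S p - w * S p" by (simp add: b_def algebra_simps)
    also have "\<dots> = w * (S p + x) - w * S p" using that by metis
    also have "\<dots> = w * x" by (simp add: algebra_simps)
    finally show ?thesis using b(2) by (simp add: field_simps)
  qed
  have 1: "S 1 = w * S 0 / b" using S1 by (rule solve)
  have 2: "S 2 = w * (2 * S 1 + S 0) / b" by (rule solve) (use S2 in \<open>simp only: add.assoc\<close>)
  have 3: "S 3 = w * (3 * S 2 + (3 * S 1 + S 0)) / b" by (rule solve) (use S3 in \<open>simp only: add.assoc\<close>)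
  have "S 3 = w * (w\<^sup>2 + 4 * w + 1) / (1 - w) ^ 4"
    unfolding 3 2 1 S0 b_def[symmetric] unfolding b(1) using b(2)
    by (simp add: divide_simps) (simp add: eval_nat_numeral algebra_simps)
  then show ?thesis using s[of 3] by simp
qed

definition cube_sum :: "complex \<Rightarrow> complex" where
  "cube_sum w = (\<Sum>n. of_nat n ^ 3 * w ^ n)"

text \<open>The sum over nonnegative and the one over negative integers are values of the third polygamma function; reflection
  turns their sum into a rational function of the nome, whose expansion is the series of cubes.\<close>
lemma lipschitz_formula:
  assumes "Im \<tau> > 0"
  shows "((\<lambda>n::int. 1 / (\<tau> + of_int n) ^ 4) has_sum (8 / 3 * of_real pi ^ 4 * cube_sum (nome \<tau>))) UNIV"
proof -
  have z: "\<tau> \<notin> \<int>" using assms by (auto elim!: Ints_cases)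
  have "norm (nome \<tau>) < 1" using assms by (simp add: nome_def norm_exp_eq_Re)
  then have "cube_sum (nome \<tau>) = nome \<tau> * (nome \<tau> ^ 2 + 4 * nome \<tau> + 1) / (1 - nome \<tau>) ^ 4"
    unfolding cube_sum_def by (rule sums_unique[OF cube_series, symmetric])
  then have "(Polygamma 3 \<tau> + Polygamma 3 (1 - \<tau>)) / 6 = 8 / 3 * of_real pi ^ 4 * cube_sum (nome \<tau>)"
    unfolding polygamma_reflection[OF z] nome_def[symmetric] by simp
  then show ?thesis using lattice_line_sum_raw[OF z] by (simp only:)
qed

text \<open>The odd part is a sixteenth of the line sum at \<open>z = 1/2\<close>, and the even part is a sixteenth of the whole.\<close>
lemma sum_inverse_fourth_powers:
  "(\<Sum>\<^sub>\<infinity>n::int. if n = 0 then 0 else 1 / of_int n ^ 4) = complex_of_real pi ^ 4 / 45"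
proof -
  let ?f = "\<lambda>n::int. if n = 0 then 0 else 1 / complex_of_int n ^ 4"
  have half: "(1/2 :: complex) \<notin> \<int>"
  proof
    assume "(1/2 :: complex) \<in> \<int>"
    then obtain n :: int where "(1/2 :: complex) = of_int n" by (elim Ints_cases)
    then have "complex_of_int (2 * n) = of_int 1" by (simp add: field_simps)
    then have "2 * n = 1" by (simp only: of_int_eq_iff)
    then show False by presburger
  qed
  have "exp (2 * of_real pi * \<i> * (1 / 2)) = -1" by simp
  then have "((\<lambda>n::int. 1 / (1 / 2 + complex_of_int n) ^ 4) has_sum (of_real pi ^ 4 / 3)) UNIV"
    using lattice_line_sum_raw[OF half] polygamma_reflection[OF half] by (simp add: field_simps)
  then have odd: "(\<Sum>\<^sub>\<infinity>n::int. 1 / (1 / 2 + complex_of_int n) ^ 4) = of_real pi ^ 4 / 3" by (rule infsumI)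
  have s: "?f summable_on UNIV"
  proof -
    have "((\<lambda>n::int. 1 / (1 / 2 + complex_of_int n) ^ 4) has_sum (of_real pi ^ 4 / 3)) UNIV" by fact
    then have "(\<lambda>n::int. 1 / (1 / 2 + complex_of_int n) ^ 4) abs_summable_on UNIV"
      using has_sum_imp_summable summable_on_iff_abs_summable_on_complex[of "\<lambda>n::int. 1 / (1 / 2 + complex_of_int n) ^ 4" UNIV] by blast
    then have a: "(\<lambda>n. 16 * norm (1 / (1 / 2 + complex_of_int n) ^ 4)) summable_on UNIV"
      by (rule summable_on_cmult_right)
    have "?f abs_summable_on UNIV"
    proof (rule Infinite_Sum.abs_summable_on_comparison_test'[OF a])
      fix n :: int
      show "norm (?f n) \<le> 16 * norm (1 / (1 / 2 + complex_of_int n) ^ 4)"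
      proof (cases "n = 0")
        case False
        define a b where "a = \<bar>of_int n :: real\<bar>" and "b = \<bar>1 / 2 + of_int n :: real\<bar>"
        have e: "norm (1 / 2 + complex_of_int n) = b" "norm (complex_of_int n) = a"
          using norm_of_real[of "1 / 2 + of_int n", where 'a = complex] by (simp_all add: a_def b_def)
        have "\<bar>of_int n :: real\<bar> \<ge> 1" using False by linarith
        then have ab: "b \<le> 2 * a" "0 < b" "0 < a" unfolding a_def b_def by linarith+
        then have "b ^ 4 \<le> (2 * a) ^ 4" by (intro power_mono) auto
        then have "1 / a ^ 4 \<le> 16 * (1 / b ^ 4)" using ab by (simp add: field_simps)
        then show ?thesis using False by (simp only: norm_divide norm_power norm_one e if_False)
      qed simp
    qed
    then show ?thesis by (rule abs_summable_summable)
  qed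
  have "infsum ?f UNIV = (\<Sum>\<^sub>\<infinity>n. ?f (2 * n)) + (\<Sum>\<^sub>\<infinity>n. ?f (2 * n + 1))"
    by (rule infsum_int_parity[OF s])
  also have "(\<Sum>\<^sub>\<infinity>n. ?f (2 * n)) = (\<Sum>\<^sub>\<infinity>n. 1 / 16 * ?f n)"
    by (rule infsum_cong) (simp add: power_mult_distrib)
  also have "\<dots> = 1 / 16 * infsum ?f UNIV" by (rule infsum_cmult_right')
  also have "(\<Sum>\<^sub>\<infinity>n. ?f (2 * n + 1)) = (\<Sum>\<^sub>\<infinity>n. 1 / 16 * (1 / (1 / 2 + complex_of_int n) ^ 4))"
  proof (rule infsum_cong)
    fix n :: int
    have "complex_of_int (2 * n + 1) = 2 * (1 / 2 + complex_of_int n)" by simp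
    then have "complex_of_int (2 * n + 1) ^ 4 = 16 * (1 / 2 + complex_of_int n) ^ 4" by (simp only: power_mult_distrib) simp
    moreover have "2 * n + 1 \<noteq> 0" by presburger
    ultimately show "?f (2 * n + 1) = 1 / 16 * (1 / (1 / 2 + complex_of_int n) ^ 4)" by simp
  qed
  also have "\<dots> = 1 / 16 * (of_real pi ^ 4 / 3)" unfolding odd[symmetric] by (rule infsum_cmult_right')
  finally show ?thesis by (simp add: field_simps)
qed

section \<open>Lattice sums and the Eisenstein series of weight four\<close>

lemma summable_int_powr:
  fixes s :: real
  assumes "s > 1"
  shows "(\<lambda>n::int. (1 + \<bar>of_int n\<bar>) powr (- s)) summable_on (UNIV :: int set)"
proof -
  have "summable (\<lambda>n. real n powr (- s))" using assms by (simp add: summable_real_powr_iff)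
  then have "summable (\<lambda>n. real (Suc n) powr (- s))" by (subst summable_Suc_iff)
  then have s: "(\<lambda>n::nat. (1 + real n) powr (- s)) summable_on UNIV"
    by (intro summable_nonneg_imp_summable_on) (simp_all add: add.commute)
  have "(\<lambda>n::int. (1 + \<bar>of_int n\<bar>) powr (- s)) summable_on (int ` UNIV)"
    using s by (subst summable_on_reindex) (auto simp: o_def inj_on_def)
  moreover have "(\<lambda>n::int. (1 + \<bar>of_int n\<bar>) powr (- s)) summable_on ((\<lambda>n. - int n) ` UNIV)"
    using s by (subst summable_on_reindex) (auto simp: o_def inj_on_def)
  ultimately have "(\<lambda>n::int. (1 + \<bar>of_int n\<bar>) powr (- s)) summable_on (int ` UNIV \<union> (\<lambda>n. - int n) ` UNIV)"
    by (rule summable_on_union)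
  also have "int ` UNIV \<union> (\<lambda>n. - int n) ` UNIV = UNIV"
  proof (intro equalityI subsetI UnCI)
    fix n :: int assume "n \<notin> (\<lambda>n. - int n) ` UNIV"
    then show "n \<in> range int" by (metis int_cases2 rangeI)
  qed auto
  finally show ?thesis .
qed

definition lattice_weight :: "real \<Rightarrow> int \<times> int \<Rightarrow> real" where
  "lattice_weight s = (\<lambda>(c, d). (1 + \<bar>of_int c\<bar>) powr (- s) * (1 + \<bar>of_int d\<bar>) powr (- s))"

lemma lattice_weight_nonneg: "lattice_weight s p \<ge> 0"
  by (cases p) (simp add: lattice_weight_def)

lemma summable_lattice_weight:
  assumes "s > 1" shows "lattice_weight s summable_on A"
proof -
  have "(\<lambda>n. complex_of_real ((1 + \<bar>of_int n\<bar>) powr (- s))) abs_summable_on UNIV"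
    using summable_int_powr[OF assms] by simp
  from infsum_product_int(1)[OF this this] have "lattice_weight s summable_on UNIV"
    by (simp add: lattice_weight_def case_prod_unfold norm_mult)
  then show ?thesis by (rule summable_on_subset_banach) simp
qed

text \<open>All convergence estimates rest on this bound: on a half-strip, \<open>|c \<tau> + d|\<^sup>2\<close> dominates
  \<open>(1 + |c|)(1 + |d|)\<close>, a product, so that sums over the lattice are dominated by products of sums.\<close>
lemma lattice_bound:
  assumes "y > 0"
  obtains K :: real where "K \<ge> 1"
    and "\<And>\<tau> c d. \<bar>Re \<tau>\<bar> \<le> R \<Longrightarrow> Im \<tau> \<ge> y \<Longrightarrow> (c, d) \<noteq> (0, 0) \<Longrightarrow>
     (1 + \<bar>of_int c\<bar>) * (1 + \<bar>of_int d\<bar>) \<le> (K * norm (of_int c * \<tau> + of_int d))\<^sup>2"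
    and "\<And>\<tau> c d. \<bar>Re \<tau>\<bar> \<le> R \<Longrightarrow> Im \<tau> \<ge> y \<Longrightarrow> (c, d) \<noteq> (0, 0) \<Longrightarrow>
     1 \<le> K * norm (of_int c * \<tau> + of_int d)"
proof -
  define R' where "R' = \<bar>R\<bar>"
  define m where "m = min 1 y"
  have m: "m > 0" "m \<le> 1" "m \<le> y" using assms by (auto simp: m_def)
  define K where "K = 2 / m + (1 + R' / m)"
  have R': "R' \<ge> 0" by (simp add: R'_def)
  have K: "K \<ge> 1" using m R' by (simp add: K_def)
  have "(1 + \<bar>of_int c\<bar>) * (1 + \<bar>of_int d\<bar>) \<le> (K * norm (of_int c * \<tau> + of_int d))\<^sup>2 \<and>
     1 \<le> K * norm (of_int c * \<tau> + of_int d)"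
    if re: "\<bar>Re \<tau>\<bar> \<le> R" and im: "Im \<tau> \<ge> y" and cd: "(c, d) \<noteq> (0, 0)" for \<tau> :: complex and c d :: int
  proof
    define j where "j = of_int c * \<tau> + of_int d"
    have re': "\<bar>Re \<tau>\<bar> \<le> R'" using re by (simp add: R'_def)
    have "\<bar>Im j\<bar> = \<bar>of_int c\<bar> * Im \<tau>" using im assms by (simp add: j_def abs_mult)
    moreover have "\<bar>of_int c\<bar> * m \<le> \<bar>of_int c\<bar> * Im \<tau>" using im m by (intro mult_left_mono) auto
    ultimately have c: "\<bar>of_int c\<bar> * m \<le> norm j" using abs_Im_le_cmod[of j] by linarith
    have "of_int d = Re j - of_int c * Re \<tau>" by (simp add: j_def)
    then have "\<bar>of_int d\<bar> \<le> \<bar>Re j\<bar> + \<bar>of_int c\<bar> * \<bar>Re \<tau>\<bar>" by (metis abs_mult abs_triangle_ineq4)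
    also have "\<dots> \<le> norm j + \<bar>of_int c\<bar> * R'"
      using abs_Re_le_cmod[of j] re' by (intro add_mono mult_left_mono) auto
    also have "\<bar>of_int c\<bar> * R' \<le> norm j / m * R'"
      using c m R' by (intro mult_right_mono) (auto simp: field_simps)
    finally have d: "\<bar>of_int d\<bar> \<le> norm j * (1 + R' / m)" by (simp add: algebra_simps)
    have one: "m \<le> norm j"
    proof (cases "c = 0")
      case True
      then have "norm j = \<bar>of_int d\<bar>" by (simp add: j_def)
      moreover have "\<bar>of_int d :: real\<bar> \<ge> 1" using cd True by simp
      ultimately show ?thesis using m by linarith
    next
      case False
      then have "\<bar>of_int c :: real\<bar> \<ge> 1" by linarith
      then have "1 * m \<le> \<bar>of_int c\<bar> * m" using m by (intro mult_right_mono) auto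
      then show ?thesis using c by linarith
    qed
    have one': "1 \<le> norm j / m" using one m by (simp add: field_simps)
    have jm: "norm j / m \<ge> 0" "norm j * (1 + R' / m) \<ge> 0" using m R' by auto
    have Kj: "K * norm j = norm j / m + norm j / m + norm j * (1 + R' / m)"
      using m by (simp add: K_def field_simps)
    have "\<bar>of_int c\<bar> \<le> norm j / m" using c m by (simp add: field_simps)
    then have 1: "1 + \<bar>of_int c\<bar> \<le> K * norm j" unfolding Kj using one' jm by linarith
    have 2: "1 + \<bar>of_int d\<bar> \<le> K * norm j" unfolding Kj using one' jm d by linarith
    show "1 \<le> K * norm (of_int c * \<tau> + of_int d)"
      using one' jm unfolding j_def[symmetric] Kj by linarith
    show "(1 + \<bar>of_int c\<bar>) * (1 + \<bar>of_int d\<bar>) \<le> (K * norm (of_int c * \<tau> + of_int d))\<^sup>2"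
      unfolding j_def[symmetric] power2_eq_square using 1 2 by (intro mult_mono) auto
  qed
  with K show ?thesis by (intro that) auto
qed

lemma lattice_term_bound:
  assumes "y > 0" "s > 0"
  obtains K :: real where "K > 0"
    and "\<And>\<tau> p. \<bar>Re \<tau>\<bar> \<le> R \<Longrightarrow> Im \<tau> \<ge> y \<Longrightarrow> p \<noteq> (0, 0) \<Longrightarrow>
      norm (of_int (fst p) * \<tau> + of_int (snd p)) powr (- (2 * s)) \<le> K * lattice_weight s p"
proof -
  obtain K where K: "K \<ge> 1" and b: "\<And>\<tau> c d. \<bar>Re \<tau>\<bar> \<le> R \<Longrightarrow> Im \<tau> \<ge> y \<Longrightarrow> (c, d) \<noteq> (0, 0) \<Longrightarrow>
     (1 + \<bar>of_int c\<bar>) * (1 + \<bar>of_int d\<bar>) \<le> (K * norm (of_int c * \<tau> + of_int d))\<^sup>2"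
     "\<And>\<tau> c d. \<bar>Re \<tau>\<bar> \<le> R \<Longrightarrow> Im \<tau> \<ge> y \<Longrightarrow> (c, d) \<noteq> (0, 0) \<Longrightarrow> 1 \<le> K * norm (of_int c * \<tau> + of_int d)"
    by (rule lattice_bound[OF assms(1), of R]) blast
  have "norm (of_int c * \<tau> + of_int d) powr (- (2 * s)) \<le> K powr (2 * s) * lattice_weight s (c, d)"
    if "\<bar>Re \<tau>\<bar> \<le> R" "Im \<tau> \<ge> y" "(c, d) \<noteq> (0, 0)" for \<tau> c d
  proof -
    define n where "n = norm (of_int c * \<tau> + of_int d)"
    have Kn: "K * n \<ge> 1" using b(2)[OF that] by (simp add: n_def)
    have n: "n > 0"
    proof (rule ccontr)
      assume "\<not> n > 0"
      then have "n = 0" by (simp add: n_def)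
      then show False using Kn by simp
    qed
    define A where "A = (1 + \<bar>of_int c\<bar>) * (1 + \<bar>of_int d\<bar> :: real)"
    have A: "A > 0" by (simp add: A_def add_pos_nonneg)
    have "A \<le> (K * n)\<^sup>2" using b(1)[OF that] by (simp add: n_def A_def)
    then have "((K * n)\<^sup>2) powr (- s) \<le> A powr (- s)" using A assms(2) by (intro powr_mono2') auto
    also have "((K * n)\<^sup>2) powr (- s) = (K * n) powr (- (2 * s))"
      using K n by (simp add: powr_powr flip: powr_numeral)
    also have "\<dots> = K powr (- (2 * s)) * n powr (- (2 * s))" using K n by (simp add: powr_mult)
    finally have "K powr (2 * s) * (K powr (- (2 * s)) * n powr (- (2 * s))) \<le> K powr (2 * s) * A powr (- s)"
      by (rule mult_left_mono) simp
    then have "n powr (- (2 * s)) \<le> K powr (2 * s) * A powr (- s)"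
      using K by (simp add: mult.assoc[symmetric] powr_add[symmetric])
    also have "A powr (- s) = lattice_weight s (c, d)" by (simp add: A_def lattice_weight_def powr_mult)
    finally show ?thesis unfolding n_def .
  qed
  then show ?thesis using K by (intro that[of "K powr (2 * s)"]) (auto simp: prod_eq_iff)
qed

definition G4 :: "complex \<Rightarrow> complex" where
  "G4 \<tau> = (\<Sum>\<^sub>\<infinity>p. if p = (0, 0) then 0 else 1 / (of_int (fst p) * \<tau> + of_int (snd p)) ^ 4)"

lemma lattice_nz: "Im \<tau> > 0 \<Longrightarrow> (c, d) \<noteq> (0, 0) \<Longrightarrow> of_int c * \<tau> + of_int d \<noteq> 0"
proof
  assume t: "Im \<tau> > 0" "(c, d) \<noteq> (0, 0)" and e: "of_int c * \<tau> + of_int d = 0"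
  have "Im (of_int c * \<tau> + of_int d) = 0" unfolding e by simp
  then have "c = 0" using t by simp
  then show False using t e by simp
qed

lemma G4_bound:
  assumes "y > 0"
  obtains K :: real where "\<And>\<tau> p. \<bar>Re \<tau>\<bar> \<le> R \<Longrightarrow> Im \<tau> \<ge> y \<Longrightarrow>
     norm (if p = (0, 0) then 0 else 1 / (of_int (fst p) * \<tau> + of_int (snd p)) ^ 4) \<le> K * lattice_weight 2 p"
proof -
  obtain K where K: "K > 0" "\<And>\<tau> p. \<bar>Re \<tau>\<bar> \<le> R \<Longrightarrow> Im \<tau> \<ge> y \<Longrightarrow> p \<noteq> (0, 0) \<Longrightarrow>
     norm (of_int (fst p) * \<tau> + of_int (snd p)) powr (- (2 * 2)) \<le> K * lattice_weight 2 p"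
    by (rule lattice_term_bound[OF assms, of 2 R]) auto
  show ?thesis
  proof (rule that[of K])
    fix \<tau> :: complex and p :: "int \<times> int"
    assume t: "\<bar>Re \<tau>\<bar> \<le> R" "Im \<tau> \<ge> y"
    show "norm (if p = (0, 0) then 0 else 1 / (of_int (fst p) * \<tau> + of_int (snd p)) ^ 4) \<le> K * lattice_weight 2 p"
    proof (cases "p = (0, 0)")
      case True
      then show ?thesis using K(1) by (simp add: lattice_weight_nonneg)
    next
      case False
      define n where "n = norm (of_int (fst p) * \<tau> + of_int (snd p))"
      have n: "n > 0" "n powr (- 4) \<le> K * lattice_weight 2 p"
        using K(2)[OF t False] lattice_nz[of \<tau> "fst p" "snd p"] False t assms by (simp_all add: n_def)
      have "1 / n ^ 4 = n powr (- 4)" using n(1) by (simp add: powr_minus divide_inverse)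
      then show ?thesis using n False by (simp add: norm_divide norm_power n_def[symmetric])
    qed
  qed
qed

lemma G4_abs_summable:
  assumes "Im \<tau> > 0"
  shows "(\<lambda>p. if p = (0, 0) then 0 else 1 / (of_int (fst p) * \<tau> + of_int (snd p)) ^ 4) abs_summable_on UNIV"
proof -
  obtain K where K: "\<And>\<sigma> p. \<bar>Re \<sigma>\<bar> \<le> \<bar>Re \<tau>\<bar> \<Longrightarrow> Im \<sigma> \<ge> Im \<tau> \<Longrightarrow>
     norm (if p = (0, 0) then 0 else 1 / (of_int (fst p) * \<sigma> + of_int (snd p)) ^ 4) \<le> K * lattice_weight 2 p"
    by (rule G4_bound[OF assms, of "\<bar>Re \<tau>\<bar>"]) blast
  have "(\<lambda>p. K * lattice_weight 2 p) summable_on UNIV"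
    by (rule summable_on_cmult_right[OF summable_lattice_weight]) simp
  then show ?thesis by (rule Infinite_Sum.abs_summable_on_comparison_test') (rule K[OF order_refl order_refl])
qed

lemma half_strip_nbhd:
  assumes "Im z > 0" "w \<in> cball z (Im z / 2)"
  shows "\<bar>Re w\<bar> \<le> \<bar>Re z\<bar> + Im z" "Im w \<ge> Im z / 2"
proof -
  have "\<bar>Re z - Re w\<bar> \<le> Im z / 2" "\<bar>Im z - Im w\<bar> \<le> Im z / 2"
    using assms(2) abs_Re_le_cmod[of "z - w"] abs_Im_le_cmod[of "z - w"] by (simp_all add: dist_norm)
  then show "\<bar>Re w\<bar> \<le> \<bar>Re z\<bar> + Im z" "Im w \<ge> Im z / 2" using assms(1) by linarith+
qed

lemma G4_holo: "G4 holomorphic_on UHP"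
  unfolding G4_def [abs_def]
proof (rule holomorphic_on_infsum)
  fix z assume z: "z \<in> UHP"
  have z2: "Im z / 2 > 0" using z by simp
  obtain K where K: "\<And>\<tau> p. \<bar>Re \<tau>\<bar> \<le> \<bar>Re z\<bar> + Im z \<Longrightarrow> Im \<tau> \<ge> Im z / 2 \<Longrightarrow>
     norm (if p = (0, 0) then 0 else 1 / (of_int (fst p) * \<tau> + of_int (snd p)) ^ 4) \<le> K * lattice_weight 2 p"
    by (rule G4_bound[OF z2, of "\<bar>Re z\<bar> + Im z"]) blast
  have s: "(\<lambda>p. K * lattice_weight 2 p) summable_on UNIV"
    by (rule summable_on_cmult_right[OF summable_lattice_weight]) simp
  show "\<exists>r>0. \<exists>M. M summable_on UNIV \<and> (\<forall>p\<in>UNIV. \<forall>w\<in>cball z r \<inter> UHP.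
      norm (if p = (0, 0) then 0 else 1 / (of_int (fst p) * w + of_int (snd p)) ^ 4) \<le> M p)"
  proof (intro exI[of _ "Im z / 2"] conjI exI[of _ "\<lambda>p. K * lattice_weight 2 p"] ballI z2 s)
    fix p w assume "w \<in> cball z (Im z / 2) \<inter> UHP"
    then show "norm (if p = (0, 0) then 0 else 1 / (of_int (fst p) * w + of_int (snd p)) ^ 4) \<le> K * lattice_weight 2 p"
      using half_strip_nbhd[of z w] z by (intro K) auto
  qed
next
  fix p :: "int \<times> int"
  show "(\<lambda>\<tau>. if p = (0, 0) then 0 else 1 / (of_int (fst p) * \<tau> + of_int (snd p)) ^ 4) holomorphic_on UHP"
  proof (cases "p = (0, 0)")
    case False
    then have "of_int (fst p) * \<tau> + of_int (snd p) \<noteq> 0" if "\<tau> \<in> UHP" for \<tau>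
      using lattice_nz[of \<tau> "fst p" "snd p"] that by simp
    then show ?thesis using False by (auto intro!: holomorphic_intros)
  qed simp
qed auto

lemma G4_inversion:
  assumes "Im \<tau> > 0" shows "G4 (- 1 / \<tau>) = \<tau> ^ 4 * G4 \<tau>"
proof -
  have nz: "\<tau> \<noteq> 0" using assms by auto
  have "G4 (- 1 / \<tau>) = (\<Sum>\<^sub>\<infinity>p. \<tau> ^ 4 * (if p = (0, 0) then 0 else 1 / (of_int (fst p) * \<tau> + of_int (snd p)) ^ 4))"
    unfolding G4_def
  proof (rule infsum_reindex_bij_witness[of _ "\<lambda>p. (- snd p, fst p)" "\<lambda>p. (snd p, - fst p)"])
    fix p :: "int \<times> int"
    have "of_int (fst p) * (- 1 / \<tau>) + of_int (snd p) = (of_int (snd p) * \<tau> + of_int (- fst p)) / \<tau>"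
      using nz by (simp add: field_simps)
    then show "\<tau> ^ 4 * (if (snd p, - fst p) = (0, 0) then 0 else 1 / (of_int (fst (snd p, - fst p)) * \<tau> + of_int (snd (snd p, - fst p))) ^ 4) =
      (if p = (0, 0) then 0 else 1 / (of_int (fst p) * (- 1 / \<tau>) + of_int (snd p)) ^ 4)"
      by (simp only: fst_conv snd_conv power_divide) (auto simp: prod_eq_iff)
  qed auto
  also have "\<dots> = \<tau> ^ 4 * G4 \<tau>" unfolding G4_def by (rule infsum_cmult_right')
  finally show ?thesis .
qed

text \<open>Collect the pairs \<open>(m, n)\<close> by their product.\<close>
lemma divisor_rearrangement:
  fixes q :: complex
  assumes q: "norm q < 1"
  shows "((\<lambda>p. of_nat (Suc (snd p)) ^ 3 * q ^ (Suc (fst p) * Suc (snd p))) has_sum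
      (\<Sum>n. of_nat (divisor_sum 3 (Suc n)) * q ^ Suc n)) (UNIV :: (nat \<times> nat) set)"
    and "summable (\<lambda>n. of_nat (divisor_sum 3 (Suc n)) * q ^ Suc n)"
proof -
  let ?f = "\<lambda>p::nat \<times> nat. of_nat (Suc (snd p)) ^ 3 * q ^ (Suc (fst p) * Suc (snd p))"
  have s1: "(\<lambda>m. norm q ^ m) summable_on (UNIV :: nat set)"
    using q by (intro summable_nonneg_imp_summable_on summable_geometric) auto
  have s2: "(\<lambda>n. of_nat (Suc n) ^ 3 * norm q ^ Suc n) summable_on (UNIV :: nat set)"
  proof (rule summable_nonneg_imp_summable_on)
    have "summable (\<lambda>n. norm (of_nat n ^ 3 * (of_real (norm q) :: complex) ^ n))"
    proof -
      obtain K where K: "norm q < K" "K < 1" using q dense by blast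
      moreover have "\<bar>K\<bar> < 1" using K norm_ge_zero[of q] by linarith
      ultimately have "summable (\<lambda>n. of_nat n ^ 3 * (complex_of_real K) ^ n)"
        by (intro summable_power_times) simp
      then show ?thesis by (rule powser_insidea) (use K norm_ge_zero[of q] in auto)
    qed
    then have "summable (\<lambda>n. of_nat n ^ 3 * norm q ^ n)" by (simp add: norm_mult norm_power)
    then show "summable (\<lambda>n. of_nat (Suc n) ^ 3 * norm q ^ Suc n)" by (subst summable_Suc_iff)
  qed simp
  have dom: "(\<lambda>p::nat \<times> nat. norm q ^ fst p * (of_nat (Suc (snd p)) ^ 3 * norm q ^ Suc (snd p))) summable_on UNIV"
  proof -
    have "(\<lambda>p::nat \<times> nat. norm q ^ fst p * (of_nat (Suc (snd p)) ^ 3 * norm q ^ Suc (snd p))) abs_summable_on (UNIV \<times> UNIV)"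
      unfolding Infinite_Sum.abs_summable_on_Sigma_iff
    proof (intro conjI ballI)
      fix m :: nat show "(\<lambda>n. norm (norm q ^ fst (m, n) * (of_nat (Suc (snd (m, n))) ^ 3 * norm q ^ Suc (snd (m, n))))) summable_on UNIV"
        using summable_on_cmult_right[OF s2, of "norm q ^ m"] by (simp add: abs_mult)
      have "(\<lambda>m. norm q ^ m * (\<Sum>\<^sub>\<infinity>n::nat. of_nat (Suc n) ^ 3 * norm q ^ Suc n)) summable_on (UNIV :: nat set)"
        by (rule summable_on_cmult_left[OF s1])
      then show "(\<lambda>m. norm (\<Sum>\<^sub>\<infinity>n. norm (norm q ^ fst (m, n) * (of_nat (Suc (snd (m, n))) ^ 3 * norm q ^ Suc (snd (m, n)))))) summable_on (UNIV :: nat set)"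
        by (simp add: abs_mult infsum_cmult_right' infsum_nonneg del: power_Suc of_nat_Suc)
    qed
    then show ?thesis by (simp add: abs_mult)
  qed
  have "?f abs_summable_on UNIV"
  proof (rule Infinite_Sum.abs_summable_on_comparison_test'[OF dom])
    fix p :: "nat \<times> nat"
    have "fst p + Suc (snd p) \<le> Suc (fst p) * Suc (snd p)" by simp
    then have "norm q ^ (Suc (fst p) * Suc (snd p)) \<le> norm q ^ (fst p + Suc (snd p))"
      using q by (intro power_decreasing) auto
    then have "real (Suc (snd p)) ^ 3 * norm q ^ (Suc (fst p) * Suc (snd p)) \<le> real (Suc (snd p)) ^ 3 * (norm q ^ fst p * norm q ^ Suc (snd p))"
      unfolding power_add by (rule mult_left_mono) simp
    then show "norm (?f p) \<le> norm q ^ fst p * (of_nat (Suc (snd p)) ^ 3 * norm q ^ Suc (snd p))"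
      by (simp only: norm_mult norm_power norm_of_nat mult_ac)
  qed
  then have s: "?f summable_on UNIV" by (rule abs_summable_summable)
  define g where "g = (\<lambda>p::nat \<times> nat. of_nat (snd p) ^ 3 * q ^ Suc (fst p))"
  have eq: "(g has_sum x) (SIGMA n:UNIV. {d. d dvd Suc n}) \<longleftrightarrow> (?f has_sum x) UNIV" for x
  proof (rule has_sum_reindex_bij_witness[of _ "\<lambda>p. (Suc (fst p) * Suc (snd p) - 1, Suc (snd p))" "\<lambda>p. (Suc (fst p) div snd p - 1, snd p - 1)"])
    fix p :: "nat \<times> nat" assume p: "p \<in> (SIGMA n:UNIV. {d. d dvd Suc n})"
    then have "snd p dvd Suc (fst p)" by auto
    then obtain e where e: "Suc (fst p) = snd p * e" by (rule dvdE)
    have pos: "snd p > 0" "e > 0" using e by (auto intro!: Nat.gr0I)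
    have d: "Suc (fst p) div snd p = e" using e pos by simp
    show "(\<lambda>p. (Suc (fst p) * Suc (snd p) - 1, Suc (snd p))) (Suc (fst p) div snd p - 1, snd p - 1) = p"
      using e pos unfolding d by (simp add: prod_eq_iff mult.commute)
    show "?f (Suc (fst p) div snd p - 1, snd p - 1) = g p"
      using pos unfolding d g_def e by (simp add: mult.commute)
  next
    fix p :: "nat \<times> nat"
    have e: "Suc (Suc (fst p) * Suc (snd p) - 1) = Suc (fst p) * Suc (snd p)" by simp
    then show "(\<lambda>p. (Suc (fst p) div snd p - 1, snd p - 1)) (Suc (fst p) * Suc (snd p) - 1, Suc (snd p)) = p"
      by (simp only: fst_conv snd_conv nonzero_mult_div_cancel_right) (simp add: prod_eq_iff)
    have "Suc (snd p) dvd Suc (Suc (fst p) * Suc (snd p) - 1)" unfolding e by (rule dvd_triv_right)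
    then show "(Suc (fst p) * Suc (snd p) - 1, Suc (snd p)) \<in> (SIGMA n:UNIV. {d. d dvd Suc n})"
      by (intro SigmaI UNIV_I CollectI)
  qed auto
  have h: "(g has_sum (infsum ?f UNIV)) (SIGMA n:UNIV. {d. d dvd Suc n})"
    unfolding eq using s by (rule has_sum_infsum)
  have inner: "((\<lambda>d. g (n, d)) has_sum (of_nat (divisor_sum 3 (Suc n)) * q ^ Suc n)) {d. d dvd Suc n}" for n
    by (rule has_sum_finiteI) (auto simp: g_def divisor_sum_def sum_distrib_right)
  have "((\<lambda>n. of_nat (divisor_sum 3 (Suc n)) * q ^ Suc n) has_sum (infsum ?f UNIV)) UNIV"
    by (rule has_sum_SigmaD[OF h inner])
  then have "(\<lambda>n. of_nat (divisor_sum 3 (Suc n)) * q ^ Suc n) sums (infsum ?f UNIV)" by (rule has_sum_imp_sums)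
  then show "summable (\<lambda>n. of_nat (divisor_sum 3 (Suc n)) * q ^ Suc n)"
    "(?f has_sum (\<Sum>n. of_nat (divisor_sum 3 (Suc n)) * q ^ Suc n)) UNIV"
    using s by (auto simp: sums_iff has_sum_infsum)
qed

lemma infsum_int_nonzero_even:
  fixes f :: "int \<Rightarrow> complex"
  assumes s: "f summable_on UNIV" and even: "\<And>n. f (- n) = f n"
  shows "infsum f UNIV = f 0 + 2 * (\<Sum>\<^sub>\<infinity>m::nat. f (int (Suc m)))"
proof -
  have U: "UNIV = {0::int} \<union> ({0<..} \<union> {..<0})" by auto
  have ss: "f summable_on A" for A by (rule summable_on_subset_banach[OF s]) simp
  have "infsum f UNIV = infsum f {0} + (infsum f {0<..} + infsum f {..<0})"
    unfolding U by (subst infsum_Un_disjoint; (rule ss | force)?) (subst infsum_Un_disjoint; (rule ss | force)?)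
  moreover have "infsum f {0<..} = (\<Sum>\<^sub>\<infinity>m::nat. f (int (Suc m)))"
    by (rule infsum_reindex_bij_witness[of _ "\<lambda>m. int (Suc m)" "\<lambda>n. nat n - 1"]) auto
  moreover have "infsum f {..<0} = (\<Sum>\<^sub>\<infinity>m::nat. f (int (Suc m)))"
  proof (rule infsum_reindex_bij_witness[of _ "\<lambda>m. - int (Suc m)" "\<lambda>n. nat (- n) - 1"])
    fix n :: int assume "n \<in> {..<0}"
    then have "int (Suc (nat (- n) - 1)) = - n" by auto
    then show "f (int (Suc (nat (- n) - 1))) = f n" by (simp only: even)
  qed auto
  ultimately show ?thesis by simp
qed

text \<open>Sum Lipschitz's formula over the rows \<open>c \<noteq> 0\<close>; the row \<open>c = 0\<close> gives the constant term.\<close>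
lemma G4_eq_E4:
  assumes "Im \<tau> > 0"
  shows "G4 \<tau> = of_real pi ^ 4 / 45 * E4 \<tau>"
proof -
  define q where "q = nome \<tau>"
  have q: "norm q < 1" using assms by (simp add: q_def nome_def norm_exp_eq_Re)
  define f where "f = (\<lambda>c d. if (c, d) = (0, 0) then 0 else 1 / (of_int c * \<tau> + of_int d) ^ 4)"
  define F where "F = (\<lambda>c. \<Sum>\<^sub>\<infinity>d. f c d)"
  have "(\<lambda>p. if p = (0, 0) then 0 else 1 / (of_int (fst p) * \<tau> + of_int (snd p)) ^ 4) summable_on UNIV"
    by (rule abs_summable_summable[OF G4_abs_summable[OF assms]])
  then have s: "(\<lambda>(c, d). f c d) summable_on (UNIV \<times> UNIV)"
    by (simp add: f_def case_prod_unfold prod_eq_iff)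
  have Fm: "F (int (Suc m)) = (\<Sum>\<^sub>\<infinity>n::nat. 8 / 3 * of_real pi ^ 4 * (of_nat (Suc n) ^ 3 * q ^ (Suc m * Suc n)))" for m
  proof -
    have im: "Im (of_nat (Suc m) * \<tau>) > 0" using assms by (simp del: of_nat_Suc)
    have nm: "nome (of_nat (Suc m) * \<tau>) = q ^ Suc m"
      unfolding nome_def q_def exp_of_nat_mult[symmetric] by (rule arg_cong[where f = exp]) (simp add: mult_ac)
    have qm: "norm (q ^ Suc m) < 1" using q by (simp only: norm_power) (rule power_less_one_iff[THEN iffD2], auto)
    have "F (int (Suc m)) = (\<Sum>\<^sub>\<infinity>d::int. 1 / (of_nat (Suc m) * \<tau> + of_int d) ^ 4)"
      unfolding F_def f_def by simp
    also have "\<dots> = 8 / 3 * of_real pi ^ 4 * cube_sum (q ^ Suc m)"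
      using infsumI[OF lipschitz_formula[OF im]] unfolding nm .
    also have "cube_sum (q ^ Suc m) = (\<Sum>\<^sub>\<infinity>n::nat. of_nat (Suc n) ^ 3 * q ^ (Suc m * Suc n))"
    proof -
      have sm: "summable (\<lambda>n. norm (of_nat n ^ 3 * (q ^ Suc m) ^ n))"
      proof -
        obtain K where K: "norm (q ^ Suc m) < K" "K < 1" using qm dense by blast
        moreover have "\<bar>K\<bar> < 1" using K norm_ge_zero[of "q ^ Suc m"] by linarith
        ultimately have "summable (\<lambda>n. of_nat n ^ 3 * (complex_of_real K) ^ n)"
          by (intro summable_power_times) simp
        then show ?thesis by (rule powser_insidea) (use K norm_ge_zero[of "q ^ Suc m"] in auto)
      qed
      have "cube_sum (q ^ Suc m) = (\<Sum>n. of_nat (Suc n) ^ 3 * (q ^ Suc m) ^ Suc n)"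
        unfolding cube_sum_def using suminf_split_head[OF summable_norm_cancel[OF sm]] by simp
      also have "\<dots> = (\<Sum>\<^sub>\<infinity>n::nat. of_nat (Suc n) ^ 3 * (q ^ Suc m) ^ Suc n)"
        by (rule infsumI[symmetric], rule norm_summable_imp_has_sum)
           (use sm summable_norm_cancel[OF sm] in \<open>auto simp only: summable_Suc_iff[of "\<lambda>n. norm (of_nat n ^ 3 * (q ^ Suc m) ^ n)"]
             summable_Suc_iff[of "\<lambda>n. of_nat n ^ 3 * (q ^ Suc m) ^ n"] intro!: summable_sums\<close>)
      finally show ?thesis by (simp only: power_mult)
    qed
    also have "8 / 3 * of_real pi ^ 4 * \<dots> = (\<Sum>\<^sub>\<infinity>n::nat. 8 / 3 * of_real pi ^ 4 * (of_nat (Suc n) ^ 3 * q ^ (Suc m * Suc n)))"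
      by (rule infsum_cmult_right'[symmetric])
    finally show ?thesis .
  qed
  have "G4 \<tau> = (\<Sum>\<^sub>\<infinity>(c, d)\<in>UNIV \<times> UNIV. f c d)"
    unfolding G4_def by (simp add: f_def case_prod_unfold prod_eq_iff)
  also have "\<dots> = infsum F UNIV"
    unfolding F_def by (rule infsum_Sigma'_banach[OF s, symmetric])
  also have "\<dots> = F 0 + 2 * (\<Sum>\<^sub>\<infinity>m::nat. F (int (Suc m)))"
  proof (rule infsum_int_nonzero_even)
    show "F summable_on UNIV" unfolding F_def using summable_on_Sigma_banach[OF s] by simp
    fix c show "F (- c) = F c"
      unfolding F_def
    proof (rule infsum_reindex_bij_witness[of _ uminus uminus])
      fix d
      have "of_int c * \<tau> + of_int (- d) = - (of_int (- c) * \<tau> + of_int d)" by simp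
      then have "(of_int c * \<tau> + of_int (- d)) ^ 4 = (of_int (- c) * \<tau> + of_int d) ^ 4"
        by (simp only: power_minus_even even_numeral)
      then show "f c (- d) = f (- c) d" by (simp add: f_def)
    qed auto
  qed
  also have "F 0 = of_real pi ^ 4 / 45"
  proof -
    have "F 0 = (\<Sum>\<^sub>\<infinity>d::int. if d = 0 then 0 else 1 / of_int d ^ 4)"
      unfolding F_def f_def by (rule infsum_cong) simp
    then show ?thesis by (simp only: sum_inverse_fourth_powers)
  qed
  also have "(\<Sum>\<^sub>\<infinity>m::nat. F (int (Suc m))) = (\<Sum>\<^sub>\<infinity>m::nat. \<Sum>\<^sub>\<infinity>n::nat. 8 / 3 * of_real pi ^ 4 * (of_nat (Suc n) ^ 3 * q ^ (Suc m * Suc n)))"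
    by (simp only: Fm)
  also have "(\<Sum>\<^sub>\<infinity>m::nat. \<Sum>\<^sub>\<infinity>n::nat. 8 / 3 * of_real pi ^ 4 * (of_nat (Suc n) ^ 3 * q ^ (Suc m * Suc n))) =
      (\<Sum>\<^sub>\<infinity>p. 8 / 3 * of_real pi ^ 4 * (of_nat (Suc (snd p)) ^ 3 * q ^ (Suc (fst p) * Suc (snd p))))"
    using infsum_Sigma'_banach[of "\<lambda>m n. 8 / 3 * of_real pi ^ 4 * (of_nat (Suc n) ^ 3 * q ^ (Suc m * Suc n))" UNIV "\<lambda>_. UNIV"]
      summable_on_cmult_right[OF has_sum_imp_summable[OF divisor_rearrangement(1)[OF q]], of "8 / 3 * of_real pi ^ 4"]
    by (simp only: case_prod_unfold UNIV_Times_UNIV)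
  also have "\<dots> = 8 / 3 * of_real pi ^ 4 * (\<Sum>n. of_nat (divisor_sum 3 (Suc n)) * q ^ Suc n)"
    unfolding infsumI[OF divisor_rearrangement(1)[OF q], symmetric] by (rule infsum_cmult_right')
  finally show ?thesis by (simp add: E4_def q_def ring_distribs)
qed

text \<open>Both sides are level one forms of weight four with constant term \<open>1\<close>.\<close>
lemma E4_eq_e4:
  assumes "Im \<tau> > 0" shows "E4 \<tau> = e4 \<tau>"
proof -
  define f where "f = (\<lambda>\<tau>. 45 / of_real pi ^ 4 * G4 \<tau> - e4 \<tau>)"
  have E: "45 / of_real pi ^ 4 * G4 \<tau> = E4 \<tau>" if "Im \<tau> > 0" for \<tau>
    unfolding G4_eq_E4[OF that] by simp
  have "f \<tau> = 0"
  proof (rule level_one_weight_vanish[where n = 1 and f = f and \<tau> = \<tau>])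
    show "f holomorphic_on UHP" unfolding f_def by (intro holomorphic_intros G4_holo e4_holo)
    show "f (\<tau> + 1) = f \<tau>" if "Im \<tau> > 0" for \<tau>
      using E[of \<tau>] E[of "\<tau> + 1"] that by (simp add: f_def e4_plus1 E4_def nome_plus1)
    show "f (- 1 / \<tau>) = \<tau> ^ (4 * 1) * f \<tau>" if "Im \<tau> > 0" for \<tau>
      unfolding f_def G4_inversion[OF that] e4_inversion[OF that] by (simp add: algebra_simps)
    have "isCont (\<lambda>q::complex. \<Sum>n. of_nat (divisor_sum 3 (Suc n)) * q ^ n) 0"
    proof (rule isCont_powser)
      have "summable (\<lambda>n. of_nat (divisor_sum 3 (Suc n)) * (1/2 :: complex) ^ Suc n)"
        by (rule divisor_rearrangement(2)) (simp add: norm_divide)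
      then have "summable (\<lambda>n. 2 * (of_nat (divisor_sum 3 (Suc n)) * (1/2 :: complex) ^ Suc n))" by (rule summable_mult)
      then show "summable (\<lambda>n. of_nat (divisor_sum 3 (Suc n)) * (1/2 :: complex) ^ n)" by simp
    qed simp
    from isCont_tendsto_compose[OF this nome_tendsto]
    have "((\<lambda>\<tau>. \<Sum>n. of_nat (divisor_sum 3 (Suc n)) * nome \<tau> ^ n) \<longlongrightarrow> (\<Sum>n. of_nat (divisor_sum 3 (Suc n)) * 0 ^ n)) at_cusp" .
    from tendsto_add[OF tendsto_const[of 1] tendsto_mult[OF tendsto_const[of 240] tendsto_mult[OF nome_tendsto this]]]
    have L: "((\<lambda>\<tau>. 1 + 240 * (nome \<tau> * (\<Sum>n. of_nat (divisor_sum 3 (Suc n)) * nome \<tau> ^ n))) \<longlongrightarrow> 1) at_cusp" by simp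
    have "((\<lambda>\<tau>. 1 + 240 * (nome \<tau> * (\<Sum>n. of_nat (divisor_sum 3 (Suc n)) * nome \<tau> ^ n)) - e4 \<tau>) \<longlongrightarrow> 0) at_cusp"
      using tendsto_diff[OF L e4_tendsto] by simp
    then show "(f \<longlongrightarrow> 0) at_cusp"
    proof (rule Lim_transform_eventually)
      show "\<forall>\<^sub>F \<tau> in at_cusp. 1 + 240 * (nome \<tau> * (\<Sum>n. of_nat (divisor_sum 3 (Suc n)) * nome \<tau> ^ n)) - e4 \<tau> = f \<tau>"
        using eventually_at_cusp_UHP
      proof eventually_elim
        case (elim \<tau>)
        have q: "norm (nome \<tau>) < 1" using elim by (simp add: nome_def norm_exp_eq_Re)
        have nz: "nome \<tau> \<noteq> 0" by (simp add: nome_def)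
        have "summable (\<lambda>n. 1 / nome \<tau> * (of_nat (divisor_sum 3 (Suc n)) * nome \<tau> ^ Suc n))"
          by (rule summable_mult[OF divisor_rearrangement(2)[OF q]])
        then have "summable (\<lambda>n. of_nat (divisor_sum 3 (Suc n)) * nome \<tau> ^ n)" using nz by simp
        from suminf_mult[OF this, of "nome \<tau>"]
        have "nome \<tau> * (\<Sum>n. of_nat (divisor_sum 3 (Suc n)) * nome \<tau> ^ n) = (\<Sum>n. of_nat (divisor_sum 3 (Suc n)) * nome \<tau> ^ Suc n)"
          by (simp add: mult_ac)
        then show ?case using E[of \<tau>] elim by (simp add: f_def E4_def)
      qed
    qed
  qed (use assms in auto)
  then show ?thesis using E[OF assms] by (simp add: f_def)
qed

section \<open>Sums over coprime pairs\<close>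

definition sl2_act :: "int \<Rightarrow> int \<Rightarrow> int \<Rightarrow> int \<Rightarrow> complex \<Rightarrow> complex" where
  "sl2_act a b c d \<tau> = (of_int a * \<tau> + of_int b) / (of_int c * \<tau> + of_int d)"

type_synonym slash_fun = "int \<Rightarrow> int \<Rightarrow> int \<Rightarrow> int \<Rightarrow> complex \<Rightarrow> complex"

definition slash_term :: "nat \<Rightarrow> slash_fun \<Rightarrow> complex \<Rightarrow> int \<times> int \<Rightarrow> complex" where
  "slash_term k f \<tau> = (\<lambda>(c, d). case sl2_upper_row c d of (a, b) \<Rightarrow>
     (of_int c * \<tau> + of_int d) powi (- int k) * f a b c d (sl2_act a b c d \<tau>))"

definition coprime_pairs :: "(int \<times> int) set" where
  "coprime_pairs = {(c, d). coprime c d}"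

text \<open>With \<open>\<gamma>\<close> ranging over representatives of the cosets of translations in \<open>SL\<^sub>2(Z)\<close>, this is half the sum of
  \<open>(c \<tau> + d)\<^sup>-\<^sup>k f\<^sub>\<gamma>(\<gamma> \<tau>)\<close>. Letting the summed function depend on \<open>\<gamma>\<close> is what makes
  Eisenstein series of higher level, and their transforms under the Hecke operator at two, sums of the same kind.\<close>
definition slash_sum :: "nat \<Rightarrow> slash_fun \<Rightarrow> complex \<Rightarrow> complex" where
  "slash_sum k f \<tau> = 1 / 2 * (\<Sum>\<^sub>\<infinity>p\<in>coprime_pairs. slash_term k f \<tau> p)"

text \<open>The first condition makes the terms independent of the chosen coset representative. The last one bounds growth at
  the real line: for theta constants of weight \<open>1/2\<close> the exponent \<open>1/2\<close> would be optimal, but any exponent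
  smaller than \<open>1\<close> gives absolute convergence from weight four on.\<close>
definition slash_family :: "slash_fun \<Rightarrow> bool" where
  "slash_family f \<longleftrightarrow>
     (\<forall>a b c d \<tau>. a * d - b * c = 1 \<longrightarrow> Im \<tau> > 0 \<longrightarrow> f (a + c) (b + d) c d (\<tau> + 1) = f a b c d \<tau>) \<and>
     (\<forall>a b c d. f a b c d holomorphic_on UHP) \<and>
     (\<exists>C. \<forall>a b c d \<tau>. Im \<tau> > 0 \<longrightarrow> norm (f a b c d \<tau>) \<le> C * (1 + Im \<tau> powr (- (3 / 4))))"

lemma sl2_upper_row:
  assumes "coprime c d" "sl2_upper_row c d = (a, b)"
  shows "a * d - b * c = 1"
proof -
  obtain u v where "u * c + v * d = 1" using assms(1) bezout_int[of c d] by auto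
  then have "case (v, - u) of (a, b) \<Rightarrow> a * d - b * c = 1" by simp
  from someI[of "\<lambda>(a, b). a * d - b * c = 1", OF this] show ?thesis
    using assms(2) by (simp add: sl2_upper_row_def)
qed

lemma det_coprime: "a * d - b * c = 1 \<Longrightarrow> coprime c (d::int)"
  by (metis coprimeI dvd_diff dvd_mult dvd_mult2 mult.commute)

lemma slash_family_shift:
  assumes f: "slash_family f" and det: "a * d - b * c = 1" and t: "Im \<tau> > 0"
  shows "f (a + n * c) (b + n * d) c d (\<tau> + of_int n) = f a b c d \<tau>"
proof -
  have inv: "f (a + c) (b + d) c d (\<tau> + 1) = f a b c d \<tau>" if "a * d - b * c = 1" "Im \<tau> > 0" for a b c d \<tau>
    using f that by (simp add: slash_family_def)
  have det': "(a + n * c) * d - (b + n * d) * c = 1" for n using det by (simp add: algebra_simps)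
  show ?thesis
  proof (induction n rule: int_induct[where k = 0])
    case (step1 i)
    then show ?case using inv[OF det'[of i], of "\<tau> + of_int i"] t by (simp add: algebra_simps)
  next
    case (step2 i)
    then show ?case using inv[OF det'[of "i - 1"], of "\<tau> + of_int (i - 1)"] t by (simp add: algebra_simps)
  qed simp
qed

lemma Im_sl2_act:
  assumes "a * d - b * c = 1" "Im \<tau> > 0"
  shows "Im (sl2_act a b c d \<tau>) = Im \<tau> / (norm (of_int c * \<tau> + of_int d))\<^sup>2"
proof -
  have "Im (sl2_act a b c d \<tau>) = ((of_int a * of_int d - of_int b * of_int c) * Im \<tau>) / (norm (of_int c * \<tau> + of_int d))\<^sup>2"
    unfolding sl2_act_def by (simp add: Im_divide cmod_power2 algebra_simps)
  also have "of_int a * of_int d - of_int b * of_int c = (1::real)"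
    using assms(1) by (metis of_int_1 of_int_diff of_int_mult)
  finally show ?thesis by simp
qed

lemma det_nz: "a * d - b * c = 1 \<Longrightarrow> Im \<tau> > 0 \<Longrightarrow> of_int c * \<tau> + of_int d \<noteq> 0"
  by (rule lattice_nz) auto

lemma Im_sl2_act_pos: "a * d - b * c = 1 \<Longrightarrow> Im \<tau> > 0 \<Longrightarrow> Im (sl2_act a b c d \<tau>) > 0"
  using det_nz[of a d b c \<tau>] by (simp add: Im_sl2_act)

lemma slash_term_eq:
  assumes f: "slash_family f" and det: "a * d - b * c = 1" and t: "Im \<tau> > 0"
  shows "slash_term k f \<tau> (c, d) = (of_int c * \<tau> + of_int d) powi (- int k) * f a b c d (sl2_act a b c d \<tau>)"
proof -
  obtain a' b' where row: "sl2_upper_row c d = (a', b')" by (cases "sl2_upper_row c d")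
  have cop: "coprime c d" by (rule det_coprime[OF det])
  have det': "a' * d - b' * c = 1" by (rule sl2_upper_row[OF cop row])
  have "\<exists>n. a = a' + n * c \<and> b = b' + n * d"
  proof (intro exI conjI)
    show "a = a' + (a' * b - a * b') * c" "b = b' + (a' * b - a * b') * d"
      using det det' by algebra+
  qed
  then obtain n where n: "a = a' + n * c" "b = b' + n * d" by blast
  have "sl2_act a b c d \<tau> = sl2_act a' b' c d \<tau> + of_int n"
    using det_nz[OF det t] unfolding n sl2_act_def by (simp add: field_simps)
  then show ?thesis
    using slash_family_shift[OF f det' Im_sl2_act_pos[OF det' t], of n] row
    by (simp add: slash_term_def n)
qed

text \<open>The value \<open>Im (\<gamma> \<tau>) = Im \<tau> / |c \<tau> + d|\<^sup>2\<close> turns the growth bound into \<open>|c \<tau> + d|\<^sup>3\<^sup>/\<^sup>2\<close>,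
  so in weight at least four the terms are of size \<open>|c \<tau> + d|\<^sup>-\<^sup>5\<^sup>/\<^sup>2\<close>. Of the exponent \<open>5/2\<close>, the part \<open>9/4\<close>
  suffices for convergence; the first bound keeps the remaining \<open>1/4\<close> for the limit at the cusp.\<close>
lemma slash_term_bound:
  assumes f: "slash_family f" and k: "k \<ge> 4" and y: "y > 0"
  obtains M :: real where "M \<ge> 0"
    and "\<And>\<tau> p. \<bar>Re \<tau>\<bar> \<le> R \<Longrightarrow> Im \<tau> \<ge> y \<Longrightarrow> p \<in> coprime_pairs \<Longrightarrow>
      norm (slash_term k f \<tau> p) \<le> M * norm (of_int (fst p) * \<tau> + of_int (snd p)) powr (- (1 / 4)) * lattice_weight (9 / 8) p"
    and "\<And>\<tau> p. \<bar>Re \<tau>\<bar> \<le> R \<Longrightarrow> Im \<tau> \<ge> y \<Longrightarrow> p \<in> coprime_pairs \<Longrightarrow>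
      norm (slash_term k f \<tau> p) \<le> M * lattice_weight (9 / 8) p"
proof -
  obtain C where C: "\<And>a b c d \<tau>. Im \<tau> > 0 \<Longrightarrow> norm (f a b c d \<tau>) \<le> C * (1 + Im \<tau> powr (- (3 / 4)))"
    using f unfolding slash_family_def by blast
  have C0: "C \<ge> 0"
  proof (rule ccontr)
    assume "\<not> C \<ge> 0"
    then have "C * (1 + Im \<i> powr (- (3 / 4))) < 0" by simp
    then show False using C[of \<i> 0 0 0 0] norm_ge_zero[of "f 0 0 0 0 \<i>"] by simp
  qed
  obtain K1 where K1: "K1 \<ge> 1" and K1': "\<And>\<tau> c d. \<bar>Re \<tau>\<bar> \<le> R \<Longrightarrow> Im \<tau> \<ge> y \<Longrightarrow> (c, d) \<noteq> (0, 0) \<Longrightarrow>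
     1 \<le> K1 * norm (of_int c * \<tau> + of_int d)"
    by (rule lattice_bound[OF y, of R]) blast
  obtain K2 where K2: "K2 > 0" and K2': "\<And>\<tau> p. \<bar>Re \<tau>\<bar> \<le> R \<Longrightarrow> Im \<tau> \<ge> y \<Longrightarrow> p \<noteq> (0, 0) \<Longrightarrow>
      norm (of_int (fst p) * \<tau> + of_int (snd p)) powr (- (2 * (9 / 8))) \<le> K2 * lattice_weight (9 / 8) p"
    by (rule lattice_term_bound[OF y, of "9 / 8" R]) auto
  define A where "A = C * (K1 powr (real k - 5 / 2) + y powr (- (3 / 4)) * K1 powr (real k - 4))"
  have A0: "A \<ge> 0" using C0 by (simp add: A_def)
  have main: "norm (slash_term k f \<tau> (c, d)) \<le> A * K2 * norm (of_int c * \<tau> + of_int d) powr (- (1 / 4)) * lattice_weight (9 / 8) (c, d)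
      \<and> norm (of_int c * \<tau> + of_int d) powr (- (1 / 4)) \<le> K1 powr (1 / 4)"
    if re: "\<bar>Re \<tau>\<bar> \<le> R" and im: "Im \<tau> \<ge> y" and cop: "coprime c d" for \<tau> c d
  proof
    have cd: "(c, d) \<noteq> (0, 0)" using cop by auto
    have t: "Im \<tau> > 0" using im y by simp
    obtain a b where row: "sl2_upper_row c d = (a, b)" by (cases "sl2_upper_row c d")
    have det: "a * d - b * c = 1" by (rule sl2_upper_row[OF cop row])
    define n where "n = norm (of_int c * \<tau> + of_int d)"
    have n: "n > 0" using det_nz[OF det t] by (simp add: n_def)
    have n1: "1 / n \<le> K1" using K1'[OF re im cd] n by (simp add: n_def field_simps)
    have pw: "n powr (- e) \<le> K1 powr e" if "e \<ge> 0" for e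
    proof -
      have "n powr (- e) = (1 / n) powr e" using n by (simp add: powr_minus_divide powr_divide)
      also have "\<dots> \<le> K1 powr e" using n n1 that by (intro powr_mono2) auto
      finally show ?thesis .
    qed
    show "norm (of_int c * \<tau> + of_int d) powr (- (1 / 4)) \<le> K1 powr (1 / 4)"
      using pw[of "1 / 4"] by (simp add: n_def)
    have imm: "Im (sl2_act a b c d \<tau>) = Im \<tau> / n\<^sup>2" using Im_sl2_act[OF det t] by (simp add: n_def)
    have "norm (slash_term k f \<tau> (c, d)) = n powr (- real k) * norm (f a b c d (sl2_act a b c d \<tau>))"
    proof -
      have "norm ((of_int c * \<tau> + of_int d) powi (- int k)) = n powr (- real k)"
        using n by (simp add: power_int_minus norm_inverse norm_power powr_minus powr_realpow flip: n_def)
      then show ?thesis unfolding slash_term_def using row by (simp add: norm_mult)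
    qed
    also have "\<dots> \<le> n powr (- real k) * (C * (1 + (Im \<tau> / n\<^sup>2) powr (- (3 / 4))))"
      using C[OF Im_sl2_act_pos[OF det t], of a b c d] unfolding imm by (intro mult_left_mono) auto
    also have "(Im \<tau> / n\<^sup>2) powr (- (3 / 4)) = Im \<tau> powr (- (3 / 4)) * n powr (3 / 2)"
    proof -
      have "(n\<^sup>2) powr (- (3 / 4)) = n powr (- (3 / 2))"
        using n powr_powr[of n 2 "- (3 / 4)"] by simp
      then show ?thesis using n t by (simp add: powr_divide powr_minus divide_simps)
    qed
    also have "n powr (- real k) * (C * (1 + Im \<tau> powr (- (3 / 4)) * n powr (3 / 2))) =
        C * (n powr (- real k) + Im \<tau> powr (- (3 / 4)) * n powr (- real k + 3 / 2))"
      unfolding powr_add by (simp add: algebra_simps)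
    also have "\<dots> \<le> C * (n powr (- real k) + y powr (- (3 / 4)) * n powr (- real k + 3 / 2))"
      using C0 im y by (intro mult_left_mono add_left_mono mult_right_mono powr_mono2') auto
    also have "\<dots> = C * (n powr (- (real k - 5 / 2)) + y powr (- (3 / 4)) * n powr (- (real k - 4))) * n powr (- (5 / 2))"
      by (simp add: distrib_right mult.assoc powr_add[symmetric])
    also have "\<dots> \<le> A * n powr (- (5 / 2))"
      unfolding A_def using k C0
      by (intro mult_right_mono mult_left_mono add_mono pw mult_nonneg_nonneg) auto
    also have "n powr (- (5 / 2)) = n powr (- (1 / 4)) * n powr (- (2 * (9 / 8)))"
      by (simp add: powr_add[symmetric])
    also have "A * (n powr (- (1 / 4)) * n powr (- (2 * (9 / 8)))) \<le> A * (n powr (- (1 / 4)) * (K2 * lattice_weight (9 / 8) (c, d)))"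
      using K2'[OF re im cd] A0 by (intro mult_left_mono) (auto simp: n_def)
    finally show "norm (slash_term k f \<tau> (c, d)) \<le> A * K2 * norm (of_int c * \<tau> + of_int d) powr (- (1 / 4)) * lattice_weight (9 / 8) (c, d)"
      by (simp add: n_def mult_ac)
  qed
  define M where "M = A * K2 * (1 + K1 powr (1 / 4))"
  have AK: "A * K2 \<ge> 0" using A0 K2 by simp
  have M1: "A * K2 \<le> M" "A * K2 * K1 powr (1 / 4) \<le> M"
    using AK mult_nonneg_nonneg[OF AK, of "K1 powr (1 / 4)"] by (simp_all add: M_def distrib_left)
  show ?thesis
  proof (rule that[of M])
    show "M \<ge> 0" using AK M1 by linarith
    fix \<tau> :: complex and p :: "int \<times> int"
    assume t: "\<bar>Re \<tau>\<bar> \<le> R" "Im \<tau> \<ge> y" and p: "p \<in> coprime_pairs"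
    obtain c d where cd: "p = (c, d)" "coprime c d" using p by (auto simp: coprime_pairs_def)
    note m = main[OF t cd(2)]
    define n4 where "n4 = norm (of_int c * \<tau> + of_int d) powr (- (1 / 4))"
    have w: "lattice_weight (9 / 8) p \<ge> 0" "n4 \<ge> 0" by (simp_all add: lattice_weight_nonneg n4_def)
    have "A * K2 * n4 * lattice_weight (9 / 8) p \<le> M * n4 * lattice_weight (9 / 8) p"
      using w M1 by (intro mult_right_mono) auto
    then show "norm (slash_term k f \<tau> p) \<le> M * norm (of_int (fst p) * \<tau> + of_int (snd p)) powr (- (1 / 4)) * lattice_weight (9 / 8) p"
      using m by (simp add: cd n4_def)
    have "A * K2 * n4 \<le> A * K2 * K1 powr (1 / 4)" using m AK by (intro mult_left_mono) (auto simp: n4_def)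
    then have "A * K2 * n4 * lattice_weight (9 / 8) p \<le> M * lattice_weight (9 / 8) p"
      using w M1 by (intro mult_right_mono) auto
    then show "norm (slash_term k f \<tau> p) \<le> M * lattice_weight (9 / 8) p"
      using m by (simp add: cd n4_def)
  qed
qed

lemma slash_term_summable:
  assumes f: "slash_family f" and k: "k \<ge> 4" and t: "Im \<tau> > 0"
  shows "slash_term k f \<tau> summable_on coprime_pairs"
proof -
  obtain M where M: "\<And>\<sigma> p. \<bar>Re \<sigma>\<bar> \<le> \<bar>Re \<tau>\<bar> \<Longrightarrow> Im \<sigma> \<ge> Im \<tau> \<Longrightarrow> p \<in> coprime_pairs \<Longrightarrow>
      norm (slash_term k f \<sigma> p) \<le> M * lattice_weight (9 / 8) p"
    by (rule slash_term_bound[OF f k t, of "\<bar>Re \<tau>\<bar>"]) blast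
  have "(\<lambda>p. M * lattice_weight (9 / 8) p) summable_on coprime_pairs"
    by (rule summable_on_cmult_right[OF summable_lattice_weight]) simp
  then have "slash_term k f \<tau> abs_summable_on coprime_pairs"
    by (rule Infinite_Sum.abs_summable_on_comparison_test') (rule M[OF order_refl order_refl])
  then show ?thesis by (rule abs_summable_summable)
qed

lemma slash_sum_holo:
  assumes f: "slash_family f" and k: "k \<ge> 4"
  shows "slash_sum k f holomorphic_on UHP"
proof -
  have "(\<lambda>\<tau>. \<Sum>\<^sub>\<infinity>p\<in>coprime_pairs. slash_term k f \<tau> p) holomorphic_on UHP"
  proof (rule holomorphic_on_infsum)
    fix z assume z: "z \<in> UHP"
    have z2: "Im z / 2 > 0" using z by simp
    obtain M where M: "\<And>\<sigma> p. \<bar>Re \<sigma>\<bar> \<le> \<bar>Re z\<bar> + Im z \<Longrightarrow> Im \<sigma> \<ge> Im z / 2 \<Longrightarrow> p \<in> coprime_pairs \<Longrightarrow>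
        norm (slash_term k f \<sigma> p) \<le> M * lattice_weight (9 / 8) p"
      by (rule slash_term_bound[OF f k z2, of "\<bar>Re z\<bar> + Im z"]) blast
    have s: "(\<lambda>p. M * lattice_weight (9 / 8) p) summable_on coprime_pairs"
      by (rule summable_on_cmult_right[OF summable_lattice_weight]) simp
    show "\<exists>r>0. \<exists>M. M summable_on coprime_pairs \<and> (\<forall>p\<in>coprime_pairs. \<forall>w\<in>cball z r \<inter> UHP. norm (slash_term k f w p) \<le> M p)"
    proof (intro exI[of _ "Im z / 2"] conjI exI[of _ "\<lambda>p. M * lattice_weight (9 / 8) p"] ballI z2 s)
      fix p w assume "p \<in> coprime_pairs" "w \<in> cball z (Im z / 2) \<inter> UHP"
      then show "norm (slash_term k f w p) \<le> M * lattice_weight (9 / 8) p"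
        using half_strip_nbhd[of z w] z by (intro M) auto
    qed
  next
    fix p assume "p \<in> coprime_pairs"
    then obtain c d where p: "p = (c, d)" "coprime c d" by (auto simp: coprime_pairs_def)
    obtain a b where row: "sl2_upper_row c d = (a, b)" by (cases "sl2_upper_row c d")
    have det: "a * d - b * c = 1" by (rule sl2_upper_row[OF p(2) row])
    have fh: "f a b c d holomorphic_on UHP" using f by (simp add: slash_family_def)
    have "(\<lambda>\<tau>. f a b c d (sl2_act a b c d \<tau>)) holomorphic_on UHP"
    proof (rule holomorphic_on_compose_gen[OF _ fh, unfolded o_def])
      show "sl2_act a b c d holomorphic_on UHP"
        unfolding sl2_act_def [abs_def] using det_nz[OF det] by (intro holomorphic_intros) auto
    qed (use Im_sl2_act_pos[OF det] in auto)
    then show "(\<lambda>\<tau>. slash_term k f \<tau> p) holomorphic_on UHP"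
      unfolding slash_term_def p using row det_nz[OF det] by (auto intro!: holomorphic_intros)
  qed auto
  then show ?thesis unfolding slash_sum_def [abs_def] by (intro holomorphic_intros)
qed

lemma filterlim_cusp_reduce: "filterlim (\<lambda>\<tau>. \<tau> + of_int (- \<lfloor>Re \<tau>\<rfloor>)) at_cusp at_cusp"
  unfolding filterlim_filtercomap_iff o_def by simp (rule filterlim_filtercomap)

text \<open>At the cusp only the two terms with \<open>c = 0\<close> survive: for the others \<open>|c \<tau> + d|\<close> is at least \<open>Im \<tau>\<close>. The
  bounds are uniform on vertical strips only, whence the assumption of periodicity.\<close>
lemma slash_sum_tendsto:
  assumes f: "slash_family f" and k: "k \<ge> 4" "even k"
    and per: "\<And>\<tau>. Im \<tau> > 0 \<Longrightarrow> slash_sum k f (\<tau> + 1) = slash_sum k f \<tau>"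
    and l1: "(f 1 0 0 1 \<longlongrightarrow> L) at_cusp" and l2: "(f (- 1) 0 0 (- 1) \<longlongrightarrow> L) at_cusp"
  shows "(slash_sum k f \<longlongrightarrow> L) at_cusp"
proof -
  obtain M where M: "M \<ge> 0" "\<And>\<sigma> p. \<bar>Re \<sigma>\<bar> \<le> 1 \<Longrightarrow> Im \<sigma> \<ge> 1 \<Longrightarrow> p \<in> coprime_pairs \<Longrightarrow>
      norm (slash_term k f \<sigma> p) \<le> M * norm (of_int (fst p) * \<sigma> + of_int (snd p)) powr (- (1 / 4)) * lattice_weight (9 / 8) p"
    by (rule slash_term_bound[OF f k(1), of 1 1]) auto
  define A where "A = coprime_pairs - {(0, 1), (0, - 1)}"
  define W where "W = (\<Sum>\<^sub>\<infinity>p\<in>A. lattice_weight (9 / 8) p)"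
  define g where "g = (\<lambda>\<tau>. 1 / 2 * (f 1 0 0 1 \<tau> + f (- 1) 0 0 (- 1) \<tau>))"
  have bound: "norm (slash_sum k f \<sigma> - g \<sigma>) \<le> M * Im \<sigma> powr (- (1 / 4)) * W"
    if re: "\<bar>Re \<sigma>\<bar> \<le> 1" and im: "Im \<sigma> \<ge> 1" for \<sigma>
  proof -
    have t: "Im \<sigma> > 0" using im by simp
    have s: "slash_term k f \<sigma> summable_on B" if "B \<subseteq> coprime_pairs" for B
      by (rule summable_on_subset_banach[OF slash_term_summable[OF f k(1) t] that])
    have sub: "{(0, 1), (0, - 1)} \<subseteq> coprime_pairs" by (simp add: coprime_pairs_def)
    have "infsum (slash_term k f \<sigma>) ({(0, 1), (0, - 1)} \<union> A) =
        infsum (slash_term k f \<sigma>) {(0, 1), (0, - 1)} + infsum (slash_term k f \<sigma>) A"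
      by (rule infsum_Un_disjoint) (use s sub in \<open>auto simp: A_def\<close>)
    also have "{(0, 1), (0, - 1)} \<union> A = coprime_pairs" using sub by (auto simp: A_def)
    also have "infsum (slash_term k f \<sigma>) {(0, 1), (0, - 1)} = f 1 0 0 1 \<sigma> + f (- 1) 0 0 (- 1) \<sigma>"
      using slash_term_eq[OF f _ t, of 1 1 0 0 k] slash_term_eq[OF f _ t, of "- 1" "- 1" 0 0 k] k(2)
      by (simp add: sl2_act_def power_int_minus)
    finally have e: "slash_sum k f \<sigma> - g \<sigma> = 1 / 2 * infsum (slash_term k f \<sigma>) A"
      by (simp add: slash_sum_def g_def algebra_simps)
    have "norm (slash_sum k f \<sigma> - g \<sigma>) \<le> norm (infsum (slash_term k f \<sigma>) A)"
      unfolding e norm_mult by simp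
    also have "\<dots> \<le> (\<Sum>\<^sub>\<infinity>p\<in>A. M * Im \<sigma> powr (- (1 / 4)) * lattice_weight (9 / 8) p)"
    proof (rule norm_infsum_le[OF has_sum_infsum[OF s] has_sum_infsum])
      show "A \<subseteq> coprime_pairs" by (auto simp: A_def)
      show "(\<lambda>p. M * Im \<sigma> powr (- (1 / 4)) * lattice_weight (9 / 8) p) summable_on A"
        by (rule summable_on_cmult_right[OF summable_lattice_weight]) simp
      fix p assume p: "p \<in> A"
      obtain c d where cd: "p = (c, d)" by (cases p)
      have "c \<noteq> 0" using p by (auto simp: A_def coprime_pairs_def cd)
      then have "1 \<le> \<bar>of_int c :: real\<bar>" by linarith
      then have "1 * Im \<sigma> \<le> \<bar>of_int c\<bar> * Im \<sigma>" using t by (intro mult_right_mono) simp_all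
      also have "\<dots> = \<bar>Im (of_int c * \<sigma> + of_int d)\<bar>" using t by (simp add: abs_mult)
      also have "\<dots> \<le> norm (of_int c * \<sigma> + of_int d)" by (rule abs_Im_le_cmod)
      finally have "norm (of_int c * \<sigma> + of_int d) powr (- (1 / 4)) \<le> Im \<sigma> powr (- (1 / 4))"
        using t by (intro powr_mono2') auto
      then have "M * norm (of_int c * \<sigma> + of_int d) powr (- (1 / 4)) * lattice_weight (9 / 8) p \<le> M * Im \<sigma> powr (- (1 / 4)) * lattice_weight (9 / 8) p"
        using M(1) by (intro mult_right_mono mult_left_mono lattice_weight_nonneg) auto
      moreover have "norm (slash_term k f \<sigma> p) \<le> M * norm (of_int c * \<sigma> + of_int d) powr (- (1 / 4)) * lattice_weight (9 / 8) p"
        using M(2)[OF re im, of p] p by (simp add: A_def cd)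
      ultimately show "norm (slash_term k f \<sigma> p) \<le> M * Im \<sigma> powr (- (1 / 4)) * lattice_weight (9 / 8) p" by linarith
    qed
    also have "\<dots> = M * Im \<sigma> powr (- (1 / 4)) * W" unfolding W_def by (rule infsum_cmult_right')
    finally show ?thesis .
  qed
  define r where "r = (\<lambda>\<tau>::complex. \<tau> + of_int (- \<lfloor>Re \<tau>\<rfloor>))"
  have r: "filterlim r at_cusp at_cusp" unfolding r_def by (rule filterlim_cusp_reduce)
  have "((\<lambda>y::real. y powr (- (1 / 4))) \<longlongrightarrow> 0) at_top" by real_asymp
  then have "((\<lambda>\<tau>. Im \<tau> powr (- (1 / 4))) \<longlongrightarrow> 0) at_cusp"
    by (rule filterlim_compose[OF _ filterlim_filtercomap])
  from tendsto_mult_left_zero[OF tendsto_mult_right_zero[OF this, of M], of W]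
  have lim: "((\<lambda>\<tau>. M * Im \<tau> powr (- (1 / 4)) * W) \<longlongrightarrow> 0) at_cusp" .
  have d: "((\<lambda>\<tau>. slash_sum k f \<tau> - g (r \<tau>)) \<longlongrightarrow> 0) at_cusp"
  proof (rule Lim_null_comparison[OF _ lim])
    show "\<forall>\<^sub>F \<tau> in at_cusp. norm (slash_sum k f \<tau> - g (r \<tau>)) \<le> M * Im \<tau> powr (- (1 / 4)) * W"
      using eventually_filtercomapI[OF eventually_ge_at_top[of 1], of Im]
    proof eventually_elim
      case (elim \<tau>)
      have "\<bar>Re (r \<tau>)\<bar> \<le> 1" unfolding r_def by simp linarith
      moreover have "Im (r \<tau>) = Im \<tau>" by (simp add: r_def)
      moreover have "slash_sum k f (r \<tau>) = slash_sum k f \<tau>"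
        unfolding r_def by (rule periodic_of_int[of "slash_sum k f", OF per]) (use elim in auto)
      ultimately show ?case using bound[of "r \<tau>"] elim by simp
    qed
  qed
  have "(g \<longlongrightarrow> 1 / 2 * (L + L)) at_cusp" unfolding g_def by (intro tendsto_intros l1 l2)
  from filterlim_compose[OF this r] have "((\<lambda>\<tau>. g (r \<tau>)) \<longlongrightarrow> L) at_cusp" by simp
  from tendsto_add[OF d this] show ?thesis by simp
qed

text \<open>For each pair, the terms need to be compared for one choice of completing rows only, since they do not depend on
  that choice.\<close>
lemma slash_sum_reindex:
  assumes f: "slash_family f" "Im \<sigma> > 0" and g: "slash_family g" "Im \<tau> > 0"
    and i: "\<And>p. p \<in> coprime_pairs \<Longrightarrow> i p \<in> coprime_pairs \<and> j (i p) = p"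
    and j: "\<And>p. p \<in> coprime_pairs \<Longrightarrow> j p \<in> coprime_pairs \<and> i (j p) = p"
    and eq: "\<And>c d c' d'. coprime c d \<Longrightarrow> j (c, d) = (c', d') \<Longrightarrow> \<exists>a b a' b'. a * d - b * c = 1 \<and> a' * d' - b' * c' = 1 \<and>
      u * ((of_int c' * \<tau> + of_int d') powi (- int k) * g a' b' c' d' (sl2_act a' b' c' d' \<tau>)) =
      (of_int c * \<sigma> + of_int d) powi (- int k) * f a b c d (sl2_act a b c d \<sigma>)"
  shows "slash_sum k f \<sigma> = u * slash_sum k g \<tau>"
proof -
  have "(\<Sum>\<^sub>\<infinity>p\<in>coprime_pairs. slash_term k f \<sigma> p) = (\<Sum>\<^sub>\<infinity>p\<in>coprime_pairs. u * slash_term k g \<tau> p)"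
  proof (rule infsum_reindex_bij_witness[of _ i j])
    fix p assume p: "p \<in> coprime_pairs"
    then obtain c d where cd: "p = (c, d)" "coprime c d" by (auto simp: coprime_pairs_def)
    obtain c' d' where cd': "j (c, d) = (c', d')" by (cases "j (c, d)")
    obtain a b a' b' where e: "a * d - b * c = 1" "a' * d' - b' * c' = 1"
      "u * ((of_int c' * \<tau> + of_int d') powi (- int k) * g a' b' c' d' (sl2_act a' b' c' d' \<tau>)) =
       (of_int c * \<sigma> + of_int d) powi (- int k) * f a b c d (sl2_act a b c d \<sigma>)"
      using eq[OF cd(2) cd'] by blast
    show "u * slash_term k g \<tau> (j p) = slash_term k f \<sigma> p"
      using slash_term_eq[OF f(1) e(1) f(2), of k] slash_term_eq[OF g(1) e(2) g(2), of k] e(3) by (simp add: cd cd')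
  qed (use i j in auto)
  also have "\<dots> = u * (\<Sum>\<^sub>\<infinity>p\<in>coprime_pairs. slash_term k g \<tau> p)" by (rule infsum_cmult_right')
  finally show ?thesis by (simp add: slash_sum_def)
qed

lemma coprime_shift: "coprime c (c + d) \<longleftrightarrow> coprime c (d::int)" "coprime c (d - c) \<longleftrightarrow> coprime c (d::int)"
  using coprime_iff_gcd_eq_1[of c "d - c"] coprime_iff_gcd_eq_1[of c d] gcd_add2[of c "d - c"]
  by (simp_all add: coprime_iff_gcd_eq_1 gcd.commute)

lemma slash_sum_translate:
  assumes f: "slash_family f" and g: "slash_family g" and t: "Im \<tau> > 0"
    and eq: "\<And>a b c d \<tau>. a * d - b * c = 1 \<Longrightarrow> Im \<tau> > 0 \<Longrightarrow> g a (a + b) c (c + d) \<tau> = f a b c d \<tau>"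
  shows "slash_sum k f (\<tau> + 1) = slash_sum k g \<tau>"
proof -
  have "slash_sum k f (\<tau> + 1) = 1 * slash_sum k g \<tau>"
  proof (rule slash_sum_reindex[OF f _ g t, of _ "\<lambda>(c, d). (c, d - c)" "\<lambda>(c, d). (c, c + d)"])
    fix c d c' d' :: int
    assume cop: "coprime c d" and "(case (c, d) of (c, d) \<Rightarrow> (c, c + d)) = (c', d')"
    then have j': "c' = c" "d' = c + d" by auto
    obtain a b where row: "sl2_upper_row c d = (a, b)" by (cases "sl2_upper_row c d")
    have det: "a * d - b * c = 1" by (rule sl2_upper_row[OF cop row])
    have m: "sl2_act a b c d (\<tau> + 1) = sl2_act a (a + b) c (c + d) \<tau>"
      by (simp add: sl2_act_def algebra_simps)
    have j: "of_int c * (\<tau> + 1) + of_int d = of_int c * \<tau> + of_int (c + d)" by (simp add: algebra_simps)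
    have "g a (a + b) c (c + d) (sl2_act a (a + b) c (c + d) \<tau>) = f a b c d (sl2_act a b c d (\<tau> + 1))"
      unfolding m[symmetric] by (rule eq[OF det]) (use Im_sl2_act_pos[OF det, of "\<tau> + 1"] t in simp)
    then show "\<exists>a b a' b'. a * d - b * c = 1 \<and> a' * d' - b' * c' = 1 \<and>
      1 * ((of_int c' * \<tau> + of_int d') powi (- int k) * g a' b' c' d' (sl2_act a' b' c' d' \<tau>)) =
      (of_int c * (\<tau> + 1) + of_int d) powi (- int k) * f a b c d (sl2_act a b c d (\<tau> + 1))"
      using det unfolding j j' m
      by - (rule exI[of _ a], rule exI[of _ b], rule exI[of _ a], rule exI[of _ "a + b"], simp only: m, simp add: algebra_simps)
  qed (use t coprime_shift in \<open>auto simp: coprime_pairs_def\<close>)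
  then show ?thesis by simp
qed

lemma slash_sum_inversion:
  assumes f: "slash_family f" and g: "slash_family g" and t: "Im \<tau> > 0"
    and eq: "\<And>a b c d \<tau>. a * d - b * c = 1 \<Longrightarrow> Im \<tau> > 0 \<Longrightarrow> g b (- a) d (- c) \<tau> = f a b c d \<tau>"
  shows "slash_sum k f (- 1 / \<tau>) = \<tau> ^ k * slash_sum k g \<tau>"
proof (rule slash_sum_reindex[OF f _ g t, of _ "\<lambda>p. (- snd p, fst p)" "\<lambda>p. (snd p, - fst p)"])
  fix c d c' d' :: int
  assume cop: "coprime c d" and "(snd (c, d), - fst (c, d)) = (c', d')"
  then have j': "c' = d" "d' = - c" by auto
  have nz: "\<tau> \<noteq> 0" using t by auto
  obtain a b where row: "sl2_upper_row c d = (a, b)" by (cases "sl2_upper_row c d")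
  have det: "a * d - b * c = 1" by (rule sl2_upper_row[OF cop row])
  have jj: "of_int c * (- 1 / \<tau>) + of_int d = (of_int d * \<tau> + of_int (- c)) / \<tau>"
    using nz by (simp add: field_simps)
  have "of_int a * (- 1 / \<tau>) + of_int b = (of_int b * \<tau> + of_int (- a)) / \<tau>"
    using nz by (simp add: field_simps)
  then have m: "sl2_act a b c d (- 1 / \<tau>) = sl2_act b (- a) d (- c) \<tau>"
    unfolding sl2_act_def jj using nz by simp
  have "g b (- a) d (- c) (sl2_act b (- a) d (- c) \<tau>) = f a b c d (sl2_act a b c d (- 1 / \<tau>))"
    unfolding m[symmetric] by (rule eq[OF det Im_sl2_act_pos[OF det UHP_inv[OF t]]])
  moreover have "\<tau> ^ k * (of_int d * \<tau> + of_int (- c)) powi (- int k) = (of_int c * (- 1 / \<tau>) + of_int d) powi (- int k)"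
    unfolding jj using nz by (simp add: power_int_minus power_divide field_simps)
  ultimately show "\<exists>a b a' b'. a * d - b * c = 1 \<and> a' * d' - b' * c' = 1 \<and>
      \<tau> ^ k * ((of_int c' * \<tau> + of_int d') powi (- int k) * g a' b' c' d' (sl2_act a' b' c' d' \<tau>)) =
      (of_int c * (- 1 / \<tau>) + of_int d) powi (- int k) * f a b c d (sl2_act a b c d (- 1 / \<tau>))"
    using det unfolding j'
    by - (rule exI[of _ a], rule exI[of _ b], rule exI[of _ b], rule exI[of _ "- a"], simp only: mult.assoc[symmetric], simp add: algebra_simps)
next
  show "Im (- 1 / \<tau>) > 0" by (rule UHP_inv[OF t])
qed (auto simp: coprime_pairs_def coprime_commute)

text \<open>Otherwise add the lower row to the upper one.\<close>
lemma sl2_row_even_b: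
  assumes "coprime c d" "odd d"
  obtains a b where "a * d - (2 * b) * c = (1::int)"
proof -
  obtain a b where row: "sl2_upper_row c d = (a, b)" by (cases "sl2_upper_row c d")
  have det: "a * d - b * c = 1" by (rule sl2_upper_row[OF assms(1) row])
  show ?thesis
  proof (cases "even b")
    case True
    then show ?thesis using det that by (auto elim!: evenE)
  next
    case False
    then have "even (b + d)" using assms(2) by simp
    then obtain b' where "b + d = 2 * b'" by (rule evenE)
    moreover have "(a + c) * d - (b + d) * c = 1" using det by (simp add: algebra_simps)
    ultimately show ?thesis using that by metis
  qed
qed

lemma sl2_row_even_a:
  assumes "coprime c d" "odd c"
  obtains a b where "(2 * a) * d - b * c = (1::int)"
proof -
  obtain a b where row: "sl2_upper_row c d = (a, b)" by (cases "sl2_upper_row c d")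
  have det: "a * d - b * c = 1" by (rule sl2_upper_row[OF assms(1) row])
  show ?thesis
  proof (cases "even a")
    case True
    then show ?thesis using det that by (auto elim!: evenE)
  next
    case False
    then have "even (a + c)" using assms(2) by simp
    then obtain a' where "a + c = 2 * a'" by (rule evenE)
    moreover have "(a + c) * d - (b + d) * c = 1" using det by (simp add: algebra_simps)
    ultimately show ?thesis using that by metis
  qed
qed

lemma coprime_double_iff:
  "odd d \<Longrightarrow> coprime (2 * c) d \<longleftrightarrow> coprime c (d::int)" "odd c \<Longrightarrow> coprime c (2 * d) \<longleftrightarrow> coprime c (d::int)"
  by (simp_all add: coprime_mult_left_iff coprime_mult_right_iff coprime_commute coprime_right_2_iff_odd)

lemma coprime_not_both_even: "coprime c d \<Longrightarrow> even c \<Longrightarrow> odd (d::int)"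
  using coprime_common_divisor[of c d 2] by auto

text \<open>If \<open>d\<close> is odd, substituting \<open>2 \<tau>\<close> turns \<open>(c, d)\<close> into the coprime pair \<open>(2 c, d)\<close>; if \<open>d\<close> is
  even, \<open>c (2 \<tau>) + d = 2 (c \<tau> + d / 2)\<close>. The result is a bijection of the coprime pairs, with inverse
  \<open>lower_halve\<close>.\<close>
definition lower_double :: "int \<times> int \<Rightarrow> int \<times> int" where
  "lower_double p = (if odd (snd p) then (2 * fst p, snd p) else (fst p, snd p div 2))"

definition lower_halve :: "int \<times> int \<Rightarrow> int \<times> int" where
  "lower_halve p = (if even (fst p) then (fst p div 2, snd p) else (fst p, 2 * snd p))"

lemma lower_double_halve:
  assumes "p \<in> coprime_pairs"
  shows "lower_halve p \<in> coprime_pairs" "lower_double (lower_halve p) = p"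
    "lower_double p \<in> coprime_pairs" "lower_halve (lower_double p) = p"
proof -
  obtain c d where p: "p = (c, d)" "coprime c d" using assms by (auto simp: coprime_pairs_def)
  have pq: "even c \<Longrightarrow> odd d" using coprime_not_both_even[OF p(2)] .
  have "coprime (c div 2) d" if "even c" using that pq p(2) coprime_double_iff(1)[of d "c div 2"] by simp
  moreover have "coprime c (d div 2)" if "even d" using that pq p(2) coprime_double_iff(2)[of c "d div 2"] by auto
  ultimately show "lower_halve p \<in> coprime_pairs" "lower_double (lower_halve p) = p"
    "lower_double p \<in> coprime_pairs" "lower_halve (lower_double p) = p"
    using pq p coprime_double_iff by (auto simp: lower_halve_def lower_double_def coprime_pairs_def)
qed

text \<open>With the upper row chosen as in the two hypotheses, \<open>\<gamma>\<close> times the matrix of \<open>\<tau> \<mapsto> 2 \<tau>\<close> is a diagonal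
  matrix times the new matrix of determinant one.\<close>
lemma slash_sum_double:
  assumes f: "slash_family f" and g: "slash_family g" and t: "Im \<tau> > 0"
    and e1: "\<And>a b c d \<tau>. a * d - b * (2 * c) = 1 \<Longrightarrow> Im \<tau> > 0 \<Longrightarrow> g a b (2 * c) d \<tau> = f a (2 * b) c d (2 * \<tau>)"
    and e2: "\<And>a b c d \<tau>. (2 * a) * d - b * c = 1 \<Longrightarrow> Im \<tau> > 0 \<Longrightarrow> g (2 * a) b c d \<tau> = f a b c (2 * d) (\<tau> / 2) / 2 ^ k"
  shows "slash_sum k f (2 * \<tau>) = slash_sum k g \<tau>"
proof -
  have "slash_sum k f (2 * \<tau>) = 1 * slash_sum k g \<tau>"
  proof (rule slash_sum_reindex[OF f _ g t, of _ lower_halve lower_double])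
    fix c d c' d' :: int assume cop: "coprime c d" and j': "lower_double (c, d) = (c', d')"
    show "\<exists>a b a' b'. a * d - b * c = 1 \<and> a' * d' - b' * c' = 1 \<and>
      1 * ((of_int c' * \<tau> + of_int d') powi (- int k) * g a' b' c' d' (sl2_act a' b' c' d' \<tau>)) =
      (of_int c * (2 * \<tau>) + of_int d) powi (- int k) * f a b c d (sl2_act a b c d (2 * \<tau>))"
    proof (cases "odd d")
      case True
      obtain a b where det: "a * d - (2 * b) * c = 1" by (rule sl2_row_even_b[OF cop True])
      have det': "a * d - b * (2 * c) = 1" using det by (simp add: algebra_simps)
      have cd': "c' = 2 * c" "d' = d" using j' True by (auto simp: lower_double_def)
      have j: "of_int c * (2 * \<tau>) + of_int d = of_int (2 * c) * \<tau> + of_int d" by simp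
      have m: "sl2_act a (2 * b) c d (2 * \<tau>) = 2 * sl2_act a b (2 * c) d \<tau>"
        by (simp add: sl2_act_def algebra_simps)
      show ?thesis
        using det det' e1[OF det' Im_sl2_act_pos[OF det' t]] cd'
        by - (rule exI[of _ a], rule exI[of _ "2 * b"], rule exI[of _ a], rule exI[of _ b], simp add: j m del: of_int_mult)
    next
      case False
      then obtain D where D: "d = 2 * D" by (auto elim: evenE)
      have oc: "odd c" using coprime_not_both_even[OF cop] False by blast
      obtain a b where row: "sl2_upper_row c d = (a, b)" by (cases "sl2_upper_row c d")
      have det: "a * d - b * c = 1" by (rule sl2_upper_row[OF cop row])
      have det': "(2 * a) * D - b * c = 1" using det D by (simp add: algebra_simps)
      have cd': "c' = c" "d' = D" using j' False D by (auto simp: lower_double_def)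
      have j: "of_int c * (2 * \<tau>) + of_int (2 * D) = 2 * (of_int c * \<tau> + of_int D)" by (simp add: algebra_simps)
      have m: "sl2_act a b c (2 * D) (2 * \<tau>) = sl2_act (2 * a) b c D \<tau> / 2"
        unfolding sl2_act_def j by (simp add: mult_ac)
      have p: "(2 * z) powi (- int k) = z powi (- int k) / 2 ^ k" for z :: complex
        by (simp add: power_int_minus power_mult_distrib field_simps)
      note jp = j[THEN arg_cong[where f = "\<lambda>z. z powi (- int k)"], unfolded p]
      show ?thesis
        using det det' e2[OF det' Im_sl2_act_pos[OF det' t]] cd'
        by - (rule exI[of _ a], rule exI[of _ b], rule exI[of _ "2 * a"], rule exI[of _ b], simp only: D m jp cd', simp)
    qed
  qed (use t lower_double_halve in auto)
  then show ?thesis by simp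
qed

lemma slash_sum_half:
  assumes f: "slash_family f" and g: "slash_family g" and t: "Im \<tau> > 0"
    and e1: "\<And>a b c d \<tau>. a * d - (2 * b) * c = 1 \<Longrightarrow> Im \<tau> > 0 \<Longrightarrow> g a (2 * b) c d \<tau> = f a b (2 * c) d (\<tau> / 2)"
    and e2: "\<And>a b c d \<tau>. a * (2 * d) - b * c = 1 \<Longrightarrow> Im \<tau> > 0 \<Longrightarrow> g a b c (2 * d) \<tau> = 2 ^ k * f (2 * a) b c d (2 * \<tau>)"
  shows "slash_sum k f (\<tau> / 2) = slash_sum k g \<tau>"
proof -
  have "slash_sum k f (\<tau> / 2) = 1 * slash_sum k g \<tau>"
  proof (rule slash_sum_reindex[OF f _ g t, of _ lower_double lower_halve])
    fix c d c' d' :: int assume cop: "coprime c d" and j': "lower_halve (c, d) = (c', d')"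
    show "\<exists>a b a' b'. a * d - b * c = 1 \<and> a' * d' - b' * c' = 1 \<and>
      1 * ((of_int c' * \<tau> + of_int d') powi (- int k) * g a' b' c' d' (sl2_act a' b' c' d' \<tau>)) =
      (of_int c * (\<tau> / 2) + of_int d) powi (- int k) * f a b c d (sl2_act a b c d (\<tau> / 2))"
    proof (cases "even c")
      case True
      then obtain C where C: "c = 2 * C" by (auto elim: evenE)
      obtain a b where row: "sl2_upper_row c d = (a, b)" by (cases "sl2_upper_row c d")
      have det: "a * d - b * c = 1" by (rule sl2_upper_row[OF cop row])
      have det': "a * d - (2 * b) * C = 1" using det C by (simp add: algebra_simps)
      have cd': "c' = C" "d' = d" using j' C by (auto simp: lower_halve_def)
      have j: "of_int (2 * C) * (\<tau> / 2) + of_int d = of_int C * \<tau> + of_int d" by simp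
      have m: "sl2_act a b (2 * C) d (\<tau> / 2) = sl2_act a (2 * b) C d \<tau> / 2"
        unfolding sl2_act_def j by (simp add: field_simps)
      show ?thesis
        using det det' e1[OF det' Im_sl2_act_pos[OF det' t]] cd'
        by - (rule exI[of _ a], rule exI[of _ b], rule exI[of _ a], rule exI[of _ "2 * b"], simp add: C j m del: of_int_mult times_divide_eq_right)
    next
      case False
      obtain a b where det: "(2 * a) * d - b * c = 1" by (rule sl2_row_even_a[OF cop False])
      have det': "a * (2 * d) - b * c = 1" using det by (simp add: algebra_simps)
      have cd': "c' = c" "d' = 2 * d" using j' False by (auto simp: lower_halve_def)
      have j: "of_int c * (\<tau> / 2) + of_int d = (of_int c * \<tau> + of_int (2 * d)) / 2" by (simp add: field_simps)
      have m: "sl2_act (2 * a) b c d (\<tau> / 2) = 2 * sl2_act a b c (2 * d) \<tau>"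
        unfolding sl2_act_def j by (simp add: field_simps)
      have p: "(z / 2) powi (- int k) = 2 ^ k * z powi (- int k)" for z :: complex
        by (simp add: power_int_minus power_divide field_simps)
      note jp = j[THEN arg_cong[where f = "\<lambda>z. z powi (- int k)"], unfolded p]
      show ?thesis
        using det det' e2[OF det' Im_sl2_act_pos[OF det' t]] cd'
        by - (rule exI[of _ "2 * a"], rule exI[of _ b], rule exI[of _ a], rule exI[of _ b], simp only: m jp cd', simp)
    qed
  qed (use t lower_double_halve in auto)
  then show ?thesis by simp
qed

lemma slash_family_add:
  assumes "slash_family f" "slash_family g"
  shows "slash_family (\<lambda>a b c d \<tau>. f a b c d \<tau> + g a b c d \<tau>)"
proof -
  obtain C1 where C1: "\<And>a b c d \<tau>. Im \<tau> > 0 \<Longrightarrow> norm (f a b c d \<tau>) \<le> C1 * (1 + Im \<tau> powr (- (3 / 4)))"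
    using assms(1) unfolding slash_family_def by blast
  obtain C2 where C2: "\<And>a b c d \<tau>. Im \<tau> > 0 \<Longrightarrow> norm (g a b c d \<tau>) \<le> C2 * (1 + Im \<tau> powr (- (3 / 4)))"
    using assms(2) unfolding slash_family_def by blast
  have "norm (f a b c d \<tau> + g a b c d \<tau>) \<le> (C1 + C2) * (1 + Im \<tau> powr (- (3 / 4)))" if "Im \<tau> > 0" for a b c d \<tau>
    using norm_triangle_ineq[of "f a b c d \<tau>" "g a b c d \<tau>"] C1[OF that, of a b c d] C2[OF that, of a b c d]
    by (simp add: distrib_right)
  then have "\<exists>C. \<forall>a b c d \<tau>. Im \<tau> > 0 \<longrightarrow> norm (f a b c d \<tau> + g a b c d \<tau>) \<le> C * (1 + Im \<tau> powr (- (3 / 4)))"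
    by blast
  then show ?thesis using assms unfolding slash_family_def by (auto intro!: holomorphic_intros)
qed

lemma slash_sum_add:
  assumes "slash_family f" "slash_family g" "k \<ge> 4" "Im \<tau> > 0"
  shows "slash_sum k (\<lambda>a b c d \<tau>. f a b c d \<tau> + g a b c d \<tau>) \<tau> = slash_sum k f \<tau> + slash_sum k g \<tau>"
proof -
  have "slash_term k (\<lambda>a b c d \<tau>. f a b c d \<tau> + g a b c d \<tau>) \<tau> p = slash_term k f \<tau> p + slash_term k g \<tau> p" for p
    unfolding slash_term_def by (simp add: case_prod_unfold algebra_simps)
  then have "slash_sum k (\<lambda>a b c d \<tau>. f a b c d \<tau> + g a b c d \<tau>) \<tau> =
      1 / 2 * (\<Sum>\<^sub>\<infinity>p\<in>coprime_pairs. slash_term k f \<tau> p + slash_term k g \<tau> p)"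
    unfolding slash_sum_def by (intro arg_cong[where f = "\<lambda>x. 1 / 2 * x"] infsum_cong)
  also have "(\<Sum>\<^sub>\<infinity>p\<in>coprime_pairs. slash_term k f \<tau> p + slash_term k g \<tau> p) =
     infsum (slash_term k f \<tau>) coprime_pairs + infsum (slash_term k g \<tau>) coprime_pairs"
    by (intro infsum_add slash_term_summable assms)
  finally show ?thesis by (simp add: slash_sum_def algebra_simps)
qed

lemma slash_sum_cmult: "slash_sum k (\<lambda>a b c d \<tau>. u * f a b c d \<tau>) \<tau> = u * slash_sum k f \<tau>"
proof -
  have "slash_term k (\<lambda>a b c d \<tau>. u * f a b c d \<tau>) \<tau> p = u * slash_term k f \<tau> p" for p
    unfolding slash_term_def by (simp add: case_prod_unfold)
  then have "slash_sum k (\<lambda>a b c d \<tau>. u * f a b c d \<tau>) \<tau> = 1 / 2 * (\<Sum>\<^sub>\<infinity>p\<in>coprime_pairs. u * slash_term k f \<tau> p)"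
    unfolding slash_sum_def by (intro arg_cong[where f = "\<lambda>x. 1 / 2 * x"] infsum_cong)
  also have "(\<Sum>\<^sub>\<infinity>p\<in>coprime_pairs. u * slash_term k f \<tau> p) = u * infsum (slash_term k f \<tau>) coprime_pairs"
    by (rule infsum_cmult_right')
  finally show ?thesis by (simp add: slash_sum_def)
qed

section \<open>Families of theta functions\<close>

lemma exp_le_powr_neg: "v > 0 \<Longrightarrow> exp (- v) \<le> v powr (- (3 / 4))" for v :: real
proof -
  assume v: "v > 0"
  have "v powr (3 / 4) \<le> 1 + v"
  proof (cases "v \<le> 1")
    case True
    then have "v powr (3 / 4) \<le> 1 powr (3 / 4)" using v by (intro powr_mono2) auto
    then show ?thesis using v by simp
  next
    case False
    then have "v powr (3 / 4) \<le> v powr 1" by (intro powr_mono) auto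
    then show ?thesis using v by simp
  qed
  also have "\<dots> \<le> exp v" by (rule exp_ge_add_one_self)
  finally show ?thesis using v by (simp add: exp_minus powr_minus divide_simps)
qed

text \<open>Estimate all but one term by \<open>exp (- v) \<le> v\<^sup>-\<^sup>3\<^sup>/\<^sup>4\<close>; the exponent \<open>3/4\<close> makes the resulting series
  \<open>\<Sum>|n|\<^sup>-\<^sup>3\<^sup>/\<^sup>2\<close> converge.\<close>
lemma quad_series_growth:
  assumes a: "\<And>n. \<alpha> n \<ge> (of_int n)\<^sup>2 / 4"
  obtains C where "\<And>\<tau>. Im \<tau> > 0 \<Longrightarrow> norm (quad_series \<alpha> \<tau>) \<le> C * (1 + Im \<tau> powr (- (3 / 4)))"
proof -
  define w where "w = (\<lambda>n::int. (1 + \<bar>of_int n\<bar>) powr (- (3 / 2)) :: real)"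
  have ws: "w summable_on UNIV" unfolding w_def by (rule summable_int_powr) simp
  define S where "S = infsum w UNIV"
  have S0: "S \<ge> 0" unfolding S_def by (intro infsum_nonneg) (simp add: w_def)
  have "norm (quad_series \<alpha> \<tau>) \<le> (1 + 8 * S) * (1 + Im \<tau> powr (- (3 / 4)))" if t: "Im \<tau> > 0" for \<tau>
  proof -
    define Y where "Y = Im \<tau> powr (- (3 / 4))"
    define M where "M = (\<lambda>n::int. (if n = 0 then 1 else 0) + 8 * Y * w n)"
    have tb: "norm (exp (of_real pi * \<i> * of_real (\<alpha> n) * \<tau>)) \<le> M n" for n
    proof (cases "n = 0")
      case True
      have "- pi * \<alpha> n * Im \<tau> \<le> 0" using a[of n] t True by (simp add: mult_nonneg_nonneg)
      then have "exp (- pi * \<alpha> n * Im \<tau>) \<le> 1" by simp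
      moreover have "0 \<le> 8 * Y * w n" by (simp add: Y_def w_def)
      ultimately have "exp (- pi * \<alpha> n * Im \<tau>) \<le> 1 + 8 * Y * w n" by linarith
      then show ?thesis unfolding norm_quad_term M_def using True by simp
    next
      case False
      define v where "v = ((1 + \<bar>of_int n\<bar>) / 4)\<^sup>2 * Im \<tau>"
      have n1: "\<bar>real_of_int n\<bar> \<ge> 1" using False by linarith
      have v: "v > 0" unfolding v_def using t n1 by (intro mult_pos_pos zero_less_power) auto
      have "((1 + \<bar>real_of_int n\<bar>) / 4)\<^sup>2 \<le> (\<bar>of_int n\<bar> / 2)\<^sup>2" using n1 by (intro power_mono) auto
      also have "\<dots> = (of_int n)\<^sup>2 / 4" by (simp add: power_divide)
      also have "\<dots> \<le> pi * ((of_int n)\<^sup>2 / 4)" using pi_ge_two by (simp add: mult_le_cancel_right1)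
      also have "\<dots> \<le> pi * \<alpha> n" using a[of n] by (intro mult_left_mono) auto
      finally have "v \<le> pi * \<alpha> n * Im \<tau>" unfolding v_def using t by (intro mult_right_mono) auto
      then have "exp (- pi * \<alpha> n * Im \<tau>) \<le> exp (- v)" by simp
      also have "\<dots> \<le> v powr (- (3 / 4))" by (rule exp_le_powr_neg[OF v])
      also have "\<dots> = (((1 + \<bar>of_int n\<bar>) / 4)\<^sup>2) powr (- (3 / 4)) * Y"
        unfolding v_def Y_def by (rule powr_mult)
      also have "(((1 + \<bar>real_of_int n\<bar>) / 4)\<^sup>2) powr (- (3 / 4)) = ((1 + \<bar>of_int n\<bar>) / 4) powr (- (3 / 2))"
        using n1 powr_powr[of "(1 + \<bar>real_of_int n\<bar>) / 4" 2 "- (3 / 4)"] by (simp del: powr_minus)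
      also have "\<dots> = w n / 4 powr (- (3 / 2))" unfolding w_def using n1 by (simp add: powr_divide)
      also have "(4::real) powr (- (3 / 2)) = 1 / 8"
      proof -
        have "(4::real) powr (- (3 / 2)) = 2 powr (2 * (- (3 / 2)))" unfolding powr_powr[symmetric] by simp
        also have "\<dots> = 2 powr (- real 3)" by simp
        also have "\<dots> = 1 / 8" unfolding powr_minus by (subst powr_realpow) auto
        finally show ?thesis .
      qed
      finally show ?thesis unfolding norm_quad_term M_def using False by (simp add: mult_ac)
    qed
    have Ms: "((\<lambda>n. 8 * Y * w n) has_sum (8 * Y * S)) UNIV"
      unfolding S_def by (intro has_sum_cmult_right has_sum_infsum ws)
    have "((\<lambda>n::int. if n = 0 then 1 else 0 :: real) has_sum 1) UNIV"
      using has_sum_finite[of "{0::int}" "\<lambda>n. if n = 0 then 1 else 0 :: real"]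
      by (subst has_sum_cong_neutral[where T = "{0}" and g = "\<lambda>n. if n = 0 then 1 else 0 :: real"]) auto
    from has_sum_add[OF this Ms] have Mh: "(M has_sum (1 + 8 * Y * S)) UNIV" unfolding M_def .
    have "(\<lambda>n. exp (of_real pi * \<i> * of_real (\<alpha> n) * \<tau>)) abs_summable_on UNIV"
      by (rule Infinite_Sum.abs_summable_on_comparison_test'[OF has_sum_imp_summable[OF Mh]]) (rule tb)
    then have "norm (quad_series \<alpha> \<tau>) \<le> 1 + 8 * Y * S"
      unfolding quad_series_def
      by (intro norm_infsum_le[OF has_sum_infsum[OF abs_summable_summable] Mh]) (use tb in auto)
    also have "\<dots> \<le> (1 + 8 * S) * (1 + Y)" using S0 by (simp add: Y_def algebra_simps)
    finally show ?thesis by (simp add: Y_def)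
  qed
  then show ?thesis by (rule that)
qed

text \<open>The two theta constants \<open>\<Sum>n. e(m n\<^sup>2 \<tau>)\<close> and \<open>\<Sum>n. e(m (n + 1/2)\<^sup>2 \<tau>)\<close> of index \<open>m\<close>.\<close>
definition theta0 :: "nat \<Rightarrow> complex \<Rightarrow> complex" where "theta0 m \<tau> = th3 (of_nat (2 * m) * \<tau>)"
definition theta1 :: "nat \<Rightarrow> complex \<Rightarrow> complex" where "theta1 m \<tau> = th2 (of_nat (2 * m) * \<tau>)"

lemma theta0_plus1: "theta0 m (\<tau> + 1) = theta0 m \<tau>"
proof -
  have "th3 (z + of_nat (2 * m)) = th3 z" for z
  proof (induction m)
    case (Suc m)
    have "th3 (z + of_nat (2 * Suc m)) = th3 (z + of_nat (2 * m) + 2)" by (simp add: algebra_simps)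
    then show ?case using Suc by (simp only: th3_plus2)
  qed simp
  from this[of "of_nat (2 * m) * \<tau>"] show ?thesis by (simp add: theta0_def algebra_simps)
qed

lemma th2_plus2: "th2 (\<tau> + 2) = \<i> * th2 \<tau>"
proof -
  have "exp (of_real pi * \<i> / 4) * exp (of_real pi * \<i> / 4) = exp (of_real (pi / 2) * \<i>)"
    by (simp add: mult_exp_exp mult.commute)
  also have "\<dots> = \<i>" by (simp add: exp_eq_polar mult.commute)
  finally have e: "exp (of_real pi * \<i> / 4) * exp (of_real pi * \<i> / 4) = \<i>" .
  have "th2 (\<tau> + 1 + 1) = (exp (of_real pi * \<i> / 4) * exp (of_real pi * \<i> / 4)) * th2 \<tau>"
    by (simp only: th2_plus1 mult.assoc)
  then show ?thesis unfolding e by (simp add: add.assoc)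
qed

lemma theta1_plus1: "theta1 m (\<tau> + 1) = \<i> ^ m * theta1 m \<tau>"
proof -
  have "th2 (z + of_nat (2 * m)) = \<i> ^ m * th2 z" for z
  proof (induction m)
    case (Suc m)
    have "th2 (z + of_nat (2 * Suc m)) = th2 (z + of_nat (2 * m) + 2)" by (simp add: algebra_simps)
    then show ?case using Suc by (simp only: th2_plus2 power_Suc mult.assoc)
  qed simp
  from this[of "of_nat (2 * m) * \<tau>"] show ?thesis by (simp add: theta1_def algebra_simps)
qed

lemma theta_mult_UHP: "m \<ge> 1 \<Longrightarrow> Im \<tau> > 0 \<Longrightarrow> Im (of_nat (2 * m) * \<tau>) > 0"
  by simp

lemma theta0_holo: "m \<ge> 1 \<Longrightarrow> theta0 m holomorphic_on UHP"
  and theta1_holo: "m \<ge> 1 \<Longrightarrow> theta1 m holomorphic_on UHP"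
  unfolding theta0_def [abs_def] theta1_def [abs_def]
  by (rule holomorphic_on_compose_gen[OF _ th3_holo, unfolded o_def] holomorphic_on_compose_gen[OF _ th2_holo, unfolded o_def];
      use theta_mult_UHP in \<open>auto intro!: holomorphic_intros\<close>)+

lemma theta_growth:
  assumes "m \<ge> 1"
  obtains C where "\<And>\<tau>. Im \<tau> > 0 \<Longrightarrow> norm (theta0 m \<tau>) \<le> C * (1 + Im \<tau> powr (- (3 / 4)))"
    and "\<And>\<tau>. Im \<tau> > 0 \<Longrightarrow> norm (theta1 m \<tau>) \<le> C * (1 + Im \<tau> powr (- (3 / 4)))"
proof -
  obtain C1 where C1: "\<And>\<tau>. Im \<tau> > 0 \<Longrightarrow> norm (th3 \<tau>) \<le> C1 * (1 + Im \<tau> powr (- (3 / 4)))"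
    unfolding th3_def by (rule quad_series_growth) auto
  have "(real_of_int n + 1 / 2)\<^sup>2 \<ge> (of_int n)\<^sup>2 / 4" for n
  proof -
    have "n \<ge> 0 \<or> n \<le> - 1" by linarith
    then have "\<bar>real_of_int n\<bar> / 2 \<le> \<bar>real_of_int n + 1 / 2\<bar>" by (auto simp: abs_if)
    then have "(\<bar>real_of_int n\<bar> / 2)\<^sup>2 \<le> \<bar>real_of_int n + 1 / 2\<bar>\<^sup>2" by (rule power_mono) simp
    then show ?thesis by (simp add: power_divide)
  qed
  then obtain C2 where C2: "\<And>\<tau>. Im \<tau> > 0 \<Longrightarrow> norm (th2 \<tau>) \<le> C2 * (1 + Im \<tau> powr (- (3 / 4)))"
    unfolding th2_def by (rule quad_series_growth) auto
  define C where "C = max (max C1 C2) 0"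
  have "C1 * (1 + Im (of_nat (2 * m) * \<tau>) powr (- (3 / 4))) \<le> C * (1 + Im \<tau> powr (- (3 / 4)))"
    "C2 * (1 + Im (of_nat (2 * m) * \<tau>) powr (- (3 / 4))) \<le> C * (1 + Im \<tau> powr (- (3 / 4)))" if t: "Im \<tau> > 0" for \<tau>
  proof -
    have "1 * Im \<tau> \<le> of_nat (2 * m) * Im \<tau>" using t assms by (intro mult_right_mono) auto
    then have "Im (of_nat (2 * m) * \<tau>) powr (- (3 / 4)) \<le> Im \<tau> powr (- (3 / 4))"
      using t by (intro powr_mono2') auto
    then have *: "1 + Im (of_nat (2 * m) * \<tau>) powr (- (3 / 4)) \<le> 1 + Im \<tau> powr (- (3 / 4))" by simp
    show "C1 * (1 + Im (of_nat (2 * m) * \<tau>) powr (- (3 / 4))) \<le> C * (1 + Im \<tau> powr (- (3 / 4)))"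
      by (rule mult_mono[OF _ *]) (auto simp: C_def)
    show "C2 * (1 + Im (of_nat (2 * m) * \<tau>) powr (- (3 / 4))) \<le> C * (1 + Im \<tau> powr (- (3 / 4)))"
      by (rule mult_mono[OF _ *]) (auto simp: C_def)
  qed
  then show ?thesis
    using order_trans[OF C1[OF theta_mult_UHP[OF assms]]] order_trans[OF C2[OF theta_mult_UHP[OF assms]]]
    by (intro that[of C]) (auto simp: theta0_def theta1_def)
qed

lemma slash_family_theta0:
  assumes m: "m \<ge> 1" and K: "\<And>a b c d. norm (A a b c d) \<le> K"
    and inv: "\<And>a b c d. a * d - b * c = 1 \<Longrightarrow> A (a + c) (b + d) c d = A a b c d"
  shows "slash_family (\<lambda>a b c d \<tau>. A a b c d * theta0 m \<tau>)"
proof -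
  obtain C where C: "\<And>\<tau>. Im \<tau> > 0 \<Longrightarrow> norm (theta0 m \<tau>) \<le> C * (1 + Im \<tau> powr (- (3 / 4)))"
    by (rule theta_growth[OF m]) blast
  have "norm (A a b c d * theta0 m \<tau>) \<le> (K * C) * (1 + Im \<tau> powr (- (3 / 4)))" if "Im \<tau> > 0" for a b c d \<tau>
    using mult_mono[OF K[of a b c d] C[OF that]] order_trans[OF norm_ge_zero K] by (simp add: norm_mult mult.assoc)
  then have "\<exists>C. \<forall>a b c d \<tau>. Im \<tau> > 0 \<longrightarrow> norm (A a b c d * theta0 m \<tau>) \<le> C * (1 + Im \<tau> powr (- (3 / 4)))"
    by blast
  then show ?thesis unfolding slash_family_def
    using inv theta0_holo[OF m] by (auto simp: theta0_plus1 intro!: holomorphic_intros)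
qed

lemma slash_family_theta1:
  assumes m: "m \<ge> 1" and K: "\<And>a b c d. norm (B a b c d) \<le> K"
    and inv: "\<And>a b c d. a * d - b * c = 1 \<Longrightarrow> B (a + c) (b + d) c d * \<i> ^ m = B a b c d"
  shows "slash_family (\<lambda>a b c d \<tau>. B a b c d * theta1 m \<tau>)"
proof -
  obtain C where C: "\<And>\<tau>. Im \<tau> > 0 \<Longrightarrow> norm (theta1 m \<tau>) \<le> C * (1 + Im \<tau> powr (- (3 / 4)))"
    by (rule theta_growth[OF m]) blast
  have "norm (B a b c d * theta1 m \<tau>) \<le> (K * C) * (1 + Im \<tau> powr (- (3 / 4)))" if "Im \<tau> > 0" for a b c d \<tau>
    using mult_mono[OF K[of a b c d] C[OF that]] order_trans[OF norm_ge_zero K] by (simp add: norm_mult mult.assoc)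
  then have "\<exists>C. \<forall>a b c d \<tau>. Im \<tau> > 0 \<longrightarrow> norm (B a b c d * theta1 m \<tau>) \<le> C * (1 + Im \<tau> powr (- (3 / 4)))"
    by blast
  moreover have "B (a + c) (b + d) c d * theta1 m (\<tau> + 1) = B a b c d * theta1 m \<tau>" if "a * d - b * c = 1" for a b c d \<tau>
    using inv[OF that] by (simp add: theta1_plus1 flip: mult.assoc)
  ultimately show ?thesis unfolding slash_family_def
    using theta1_holo[OF m] by (auto intro!: holomorphic_intros)
qed

lemma slash_family_theta:
  assumes "m \<ge> 1" "n \<ge> 1" "\<And>a b c d. norm (A a b c d) \<le> K" "\<And>a b c d. norm (B a b c d) \<le> K"
    and "\<And>a b c d. a * d - b * c = 1 \<Longrightarrow> A (a + c) (b + d) c d = A a b c d"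
    and "\<And>a b c d. a * d - b * c = 1 \<Longrightarrow> B (a + c) (b + d) c d * \<i> ^ n = B a b c d"
    and f: "\<And>a b c d \<tau>. f a b c d \<tau> = A a b c d * theta0 m \<tau> + B a b c d * theta1 n \<tau>"
  shows "slash_family f"
proof -
  have "f = (\<lambda>a b c d \<tau>. A a b c d * theta0 m \<tau> + B a b c d * theta1 n \<tau>)" using f by (intro ext)
  then show ?thesis
    using slash_family_add[OF slash_family_theta0[of m A K] slash_family_theta1[of n B K]] assms(1-6) by simp
qed

lemma slash_family_cmult:
  assumes "slash_family f"
  shows "slash_family (\<lambda>a b c d \<tau>. u * f a b c d \<tau>)"
proof -
  obtain C where C: "\<And>a b c d \<tau>. Im \<tau> > 0 \<Longrightarrow> norm (f a b c d \<tau>) \<le> C * (1 + Im \<tau> powr (- (3 / 4)))"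
    using assms unfolding slash_family_def by blast
  have "norm (u * f a b c d \<tau>) \<le> (norm u * C) * (1 + Im \<tau> powr (- (3 / 4)))" if "Im \<tau> > 0" for a b c d \<tau>
    using mult_left_mono[OF C[OF that], of "norm u"] by (simp add: norm_mult mult.assoc)
  then have "\<exists>C. \<forall>a b c d \<tau>. Im \<tau> > 0 \<longrightarrow> norm (u * f a b c d \<tau>) \<le> C * (1 + Im \<tau> powr (- (3 / 4)))"
    by blast
  then show ?thesis using assms unfolding slash_family_def by (auto intro!: holomorphic_intros)
qed

lemma slash_family_translate:
  assumes "slash_family f"
  shows "slash_family (\<lambda>a b c d. f a (b - a) c (d - c))"
proof -
  have "f (a + c) (b + d - (a + c)) c (d - c) (\<tau> + 1) = f a (b - a) c (d - c) \<tau>"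
    if "a * d - b * c = 1" "Im \<tau> > 0" for a b c d \<tau>
  proof -
    have "a * (d - c) - (b - a) * c = 1" using that by (simp add: algebra_simps)
    moreover have "b + d - (a + c) = b - a + (d - c)" by simp
    ultimately show ?thesis using assms that unfolding slash_family_def by metis
  qed
  moreover obtain C where "\<And>a b c d \<tau>. Im \<tau> > 0 \<Longrightarrow> norm (f a b c d \<tau>) \<le> C * (1 + Im \<tau> powr (- (3 / 4)))"
    using assms unfolding slash_family_def by blast
  moreover have "f a b c d holomorphic_on UHP" for a b c d
    using assms unfolding slash_family_def by blast
  ultimately show ?thesis unfolding slash_family_def by blast
qed

lemma det_parity:
  assumes "a * d - b * c = (1::int)"
  shows "even c \<Longrightarrow> odd a \<and> odd d" "even d \<Longrightarrow> odd b \<and> odd c" "even a \<Longrightarrow> odd b \<and> odd c" "even b \<Longrightarrow> odd a \<and> odd d"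
proof -
  have "odd (a * d - b * c)" using assms by simp
  then show "even c \<Longrightarrow> odd a \<and> odd d" "even d \<Longrightarrow> odd b \<and> odd c" "even a \<Longrightarrow> odd b \<and> odd c" "even b \<Longrightarrow> odd a \<and> odd d"
    by auto
qed

definition parity_sign :: "int \<Rightarrow> complex" where "parity_sign a = (if even a then 1 else - 1)"

lemma i_powi_double: "\<i> powi (2 * n) = parity_sign n"
proof -
  have "\<i> powi (2 * n) = (- 1) powi n" using power_int_mult[of \<i> 2 n] by simp
  then show ?thesis by (simp add: parity_sign_def power_int_minus_left)
qed

lemma i_powi_cong: "m = n + 4 * q \<Longrightarrow> \<i> powi m = \<i> powi n"
  using i_powi_double[of "2 * q"] by (simp add: power_int_add parity_sign_def)

lemma i_powi_half: "m = n + 2 + 4 * q \<Longrightarrow> \<i> powi m = - (\<i> powi n)"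
  using i_powi_cong[of m "n + 2" q] by (simp add: power_int_add)

lemma norm_i_powi: "norm (\<i> powi n) = 1"
  by (simp add: norm_power_int)

text \<open>The theta series of index one with characteristic \<open>p/2\<close>, normalized by the power of \<open>\<i>\<close> that makes it
  invariant under replacing \<open>\<tau>\<close> by \<open>\<tau> + 1\<close> and \<open>r\<close> by \<open>r - p\<close> simultaneously.\<close>
definition twisted_theta :: "int \<Rightarrow> int \<Rightarrow> complex \<Rightarrow> complex" where
  "twisted_theta p r \<tau> = \<i> powi (p * r) * (if even p then theta0 1 \<tau> else theta1 1 \<tau>)"

text \<open>Two families of level one, the two families to which the Jacobi-Eisenstein series of index two and four belong,
  and the mixed family with its transform under inversion, which arise when the Hecke operator is applied.\<close>
definition const1_fam :: slash_fun where "const1_fam a b c d \<tau> = theta0 1 \<tau>"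
definition const2_fam :: slash_fun where "const2_fam a b c d \<tau> = theta0 2 \<tau>"
definition mixed_fam :: slash_fun where "mixed_fam a b c d = twisted_theta (- c) a"
definition dual_fam :: slash_fun where "dual_fam a b c d = twisted_theta d (- b)"
definition jacobi2_fam :: slash_fun where "jacobi2_fam a b c d \<tau> = (if even c then theta0 2 \<tau> else parity_sign a * theta1 2 \<tau>)"
definition jacobi4_fam :: slash_fun where "jacobi4_fam a b c d \<tau> = (if even c then theta0 4 \<tau> else theta1 4 \<tau>)"

lemma odd_square_mod4: "odd c \<Longrightarrow> \<exists>q. c * c = 1 + 4 * (q::int)"
  by (elim oddE) (auto simp: algebra_simps intro!: exI[of _ "b * b + b" for b])

lemma const1_fam: "slash_family const1_fam"
  by (rule slash_family_theta[of 1 1 "\<lambda>_ _ _ _. 1" 1 "\<lambda>_ _ _ _. 0"]) (auto simp: const1_fam_def)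

lemma const2_fam: "slash_family const2_fam"
  by (rule slash_family_theta[of 2 1 "\<lambda>_ _ _ _. 1" 1 "\<lambda>_ _ _ _. 0"]) (auto simp: const2_fam_def)

lemma twisted_theta_coeff_shift: 
  "even p \<Longrightarrow> \<i> powi (p * (r + p)) = \<i> powi (p * r)" "odd p \<Longrightarrow> \<i> powi (p * (r - p)) * \<i> = \<i> powi (p * r)"
proof -
  show "\<i> powi (p * (r + p)) = \<i> powi (p * r)" if ev: "even p"
  proof -
    obtain s where "p = 2 * s" using ev by (rule evenE)
    then show ?thesis by (intro i_powi_cong[of _ _ "s * s"]) (simp add: algebra_simps)
  qed
  show "\<i> powi (p * (r - p)) * \<i> = \<i> powi (p * r)" if od: "odd p"
  proof -
    obtain q where q: "p * p = 1 + 4 * q" using odd_square_mod4[OF od] by blast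
    have "\<i> powi (p * (r - p)) * \<i> = \<i> powi (p * (r - p) + 1)" by (simp add: power_int_add)
    also have "\<dots> = \<i> powi (p * r)" using q by (intro i_powi_cong[of _ _ "- q"]) (simp add: algebra_simps)
    finally show ?thesis .
  qed
qed

lemma mixed_fam: "slash_family mixed_fam"
proof (rule slash_family_theta[of 1 1 "\<lambda>a b c d. if even c then \<i> powi (- c * a) else 0" 1 "\<lambda>a b c d. if even c then 0 else \<i> powi (- c * a)"])
  fix a b c d :: int
  show "(if even c then \<i> powi (- c * (a + c)) else 0) = (if even c then \<i> powi (- c * a) else 0)"
    using twisted_theta_coeff_shift(1)[of "- c" "a + c"] by simp
  show "(if even c then 0 else \<i> powi (- c * (a + c))) * \<i> ^ 1 = (if even c then 0 else \<i> powi (- c * a))"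
    using twisted_theta_coeff_shift(2)[of "- c" "a"] by simp
qed (simp_all add: mixed_fam_def twisted_theta_def norm_i_powi)

lemma dual_fam: "slash_family dual_fam"
proof (rule slash_family_theta[of 1 1 "\<lambda>a b c d. if even d then \<i> powi (d * (- b)) else 0" 1 "\<lambda>a b c d. if even d then 0 else \<i> powi (d * (- b))"])
  fix a b c d :: int
  show "(if even d then \<i> powi (d * (- (b + d))) else 0) = (if even d then \<i> powi (d * (- b)) else 0)"
    using twisted_theta_coeff_shift(1)[of d "- b - d"] by simp
  show "(if even d then 0 else \<i> powi (d * (- (b + d)))) * \<i> ^ 1 = (if even d then 0 else \<i> powi (d * (- b)))"
    using twisted_theta_coeff_shift(2)[of d "- b"] by simp
qed (simp_all add: dual_fam_def twisted_theta_def norm_i_powi)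

lemma jacobi2_fam: "slash_family jacobi2_fam"
  by (rule slash_family_theta[of 2 2 "\<lambda>a b c d. if even c then 1 else 0" 1 "\<lambda>a b c d. if even c then 0 else parity_sign a"])
    (auto simp: jacobi2_fam_def parity_sign_def)

lemma jacobi4_fam: "slash_family jacobi4_fam"
  by (rule slash_family_theta[of 4 4 "\<lambda>a b c d. if even c then 1 else 0" 1 "\<lambda>a b c d. if even c then 0 else 1"])
    (auto simp: jacobi4_fam_def)

section \<open>A linear relation between theta families\<close>

text \<open>For fixed \<open>\<tau>\<close>, the theta functions of index one form a space of dimension two, so their values at any three
  half-periods satisfy a linear relation, with coefficients that are values of theta constants at \<open>\<tau>\<close>. The
  two relations here are instances, for the transforms of one theta function under \<open>\<gamma>\<close>. In a proof
  following the generators of \<open>SL\<^sub>2(Z)\<close> instead, the two relations are needed together, because a translation interchanges them.\<close>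
definition theta_rel :: "int \<Rightarrow> int \<Rightarrow> int \<Rightarrow> int \<Rightarrow> complex \<Rightarrow> bool" where
  "theta_rel a b c d \<tau> \<longleftrightarrow> (let \<mu> = sl2_act a b c d \<tau> in
     th2 \<tau> ^ 2 * twisted_theta d (- b) \<mu> = th3 \<tau> ^ 2 * theta0 1 \<mu> - th4 \<tau> ^ 2 * twisted_theta (- c) a \<mu> \<and>
     \<i> * th2 \<tau> ^ 2 * twisted_theta (d - c) (a - b) \<mu> = th4 \<tau> ^ 2 * theta0 1 \<mu> - th3 \<tau> ^ 2 * twisted_theta (- c) a \<mu>)"

lemma theta_rel_one:
  assumes "Im \<tau> > 0" "a = 1 \<or> a = - 1"
  shows "theta_rel a 0 0 a \<tau>"
proof -
  have "sl2_act a 0 0 a \<tau> = \<tau>" using assms(2) by (auto simp: sl2_act_def)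
  then show ?thesis
    using assms(2) unfolding theta_rel_def Let_def th2_sq[OF assms(1)] th3_sq[OF assms(1)] th4_sq[OF assms(1)]
    by (auto simp: twisted_theta_def theta0_def theta1_def algebra_simps power2_eq_square)
qed

text \<open>The two exponents of \<open>\<i>\<close> differ by \<open>2 (a d + b c) = 2 + 4 b c\<close>.\<close>
lemma twisted_theta_half_turn:
  assumes "a * d - b * c = 1"
  shows "twisted_theta (c + d) (- a - b) \<mu> = - twisted_theta (d - c) (a - b) \<mu>" "twisted_theta (- c - d) (b + a) \<mu> = - twisted_theta (d - c) (a - b) \<mu>"
proof -
  have da: "a * d = 1 + b * c" using assms by simp
  have "\<i> powi ((d - c) * (a - b)) = - (\<i> powi ((c + d) * (- a - b)))"
    by (rule i_powi_half[of _ _ "b * c"]) (use da in \<open>simp add: algebra_simps\<close>)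
  moreover have "(c + d) * (- a - b) = (- c - d) * (b + a)" by (simp add: algebra_simps)
  ultimately show "twisted_theta (c + d) (- a - b) \<mu> = - twisted_theta (d - c) (a - b) \<mu>" "twisted_theta (- c - d) (b + a) \<mu> = - twisted_theta (d - c) (a - b) \<mu>"
    unfolding twisted_theta_def by auto
qed

lemma theta_rel_translate:
  assumes "a * d - b * c = 1" "Im \<tau> > 0"
  shows "theta_rel a (a + b) c (c + d) \<tau> \<longleftrightarrow> theta_rel a b c d (\<tau> + 1)"
proof -
  have mu: "sl2_act a (a + b) c (c + d) \<tau> = sl2_act a b c d (\<tau> + 1)"
    by (simp add: sl2_act_def algebra_simps)
  have th3': "th3 (\<tau> + 1) = th4 \<tau>" and th4': "th4 (\<tau> + 1) = th3 \<tau>"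
    using th4_plus1 by (simp_all add: th4_def)
  show ?thesis
    using twisted_theta_half_turn(1)[OF assms(1), of "sl2_act a b c d (\<tau> + 1)"]
    unfolding theta_rel_def mu Let_def th2_plus1_sq th3' th4'
    by (auto simp: algebra_simps)
qed

text \<open>Inversion interchanges \<open>th2\<close> and \<open>th4\<close>. The first relation then is the old one with two terms interchanged,
  and the second is a combination of the two old ones, by Jacobi's identity.\<close>
lemma theta_rel_inversion:
  assumes "a * d - b * c = 1" "Im \<tau> > 0" and rel: "theta_rel a b c d (- 1 / \<tau>)"
  shows "theta_rel b (- a) d (- c) \<tau>"
proof -
  have nz: "\<tau> \<noteq> 0" using assms(2) by auto
  have jj: "of_int c * (- 1 / \<tau>) + of_int d = (of_int d * \<tau> + of_int (- c)) / \<tau>"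
    using nz by (simp add: field_simps)
  have "of_int a * (- 1 / \<tau>) + of_int b = (of_int b * \<tau> + of_int (- a)) / \<tau>"
    using nz by (simp add: field_simps)
  then have mu: "sl2_act a b c d (- 1 / \<tau>) = sl2_act b (- a) d (- c) \<tau>"
    unfolding sl2_act_def jj using nz by simp
  define \<mu> where "\<mu> = sl2_act b (- a) d (- c) \<tau>"
  define A B C where "A = th2 \<tau> ^ 2" and "B = th3 \<tau> ^ 2" and "C = th4 \<tau> ^ 2"
  have sq: "th2 (- 1 / \<tau>) ^ 2 = (- \<i> * \<tau>) * C" "th3 (- 1 / \<tau>) ^ 2 = (- \<i> * \<tau>) * B" "th4 (- 1 / \<tau>) ^ 2 = (- \<i> * \<tau>) * A"
    unfolding A_def B_def C_def th2_inversion[OF assms(2)] th3_inversion[OF assms(2)] th4_inversion[OF assms(2)] power_mult_distrib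
    by simp_all
  define x where "x = - \<i> * \<tau>"
  have xnz: "x \<noteq> 0" using nz by (simp add: x_def)
  have "x * (C * twisted_theta d (- b) \<mu>) = x * (B * theta0 1 \<mu> - A * twisted_theta (- c) a \<mu>)"
    "x * (\<i> * C * twisted_theta (d - c) (a - b) \<mu>) = x * (A * theta0 1 \<mu> - B * twisted_theta (- c) a \<mu>)"
    using rel unfolding theta_rel_def mu Let_def sq \<mu>_def[symmetric] x_def[symmetric] by (simp_all add: algebra_simps)
  then have r1: "C * twisted_theta d (- b) \<mu> = B * theta0 1 \<mu> - A * twisted_theta (- c) a \<mu>"
    and r2: "\<i> * C * twisted_theta (d - c) (a - b) \<mu> = A * theta0 1 \<mu> - B * twisted_theta (- c) a \<mu>"
    using xnz by (simp_all only: mult_cancel_left) simp_all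
  have jac: "B ^ 2 = A ^ 2 + C ^ 2"
    using jacobi_theta_identity[OF assms(2)] by (simp add: A_def B_def C_def flip: power_mult)
  have Cnz: "C \<noteq> 0" using theta_nz[OF assms(2)] by (simp add: C_def)
  have e1: "twisted_theta (- d) b \<mu> = twisted_theta d (- b) \<mu>" by (simp add: twisted_theta_def)
  have e2: "twisted_theta (- c - d) (b + a) \<mu> = - twisted_theta (d - c) (a - b) \<mu>" by (rule twisted_theta_half_turn(2)[OF assms(1)])
  have "C * (\<i> * A * (- twisted_theta (d - c) (a - b) \<mu>)) = - A * (\<i> * C * twisted_theta (d - c) (a - b) \<mu>)" by simp
  also have "\<dots> = C ^ 2 * theta0 1 \<mu> - B * (C * twisted_theta d (- b) \<mu>)"
    unfolding r1 r2 using jac by algebra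
  also have "\<dots> = C * (C * theta0 1 \<mu> - B * twisted_theta d (- b) \<mu>)" by (simp add: algebra_simps power2_eq_square)
  finally have "\<i> * A * (- twisted_theta (d - c) (a - b) \<mu>) = C * theta0 1 \<mu> - B * twisted_theta d (- b) \<mu>"
    using Cnz by (simp only: mult_cancel_left) simp
  moreover have "A * twisted_theta (- c) a \<mu> = B * theta0 1 \<mu> - C * twisted_theta d (- b) \<mu>" unfolding r1 by simp
  ultimately show ?thesis
    unfolding theta_rel_def Let_def \<mu>_def[symmetric] A_def[symmetric] B_def[symmetric] C_def[symmetric] e1
    using e2 by simp
qed

lemma theta_rel_translate_int:
  assumes "a * d - b * c = 1"
  shows "(\<forall>\<tau>\<in>UHP. theta_rel a (b + n * a) c (d + n * c) \<tau>) \<longleftrightarrow> (\<forall>\<tau>\<in>UHP. theta_rel a b c d \<tau>)"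
proof -
  have step: "(\<forall>\<tau>\<in>UHP. theta_rel a (b + (i + 1) * a) c (d + (i + 1) * c) \<tau>) \<longleftrightarrow> (\<forall>\<tau>\<in>UHP. theta_rel a (b + i * a) c (d + i * c) \<tau>)" for i
  proof -
    have det: "a * (d + i * c) - (b + i * a) * c = 1" using assms by (simp add: algebra_simps)
    have e: "b + (i + 1) * a = a + (b + i * a)" "d + (i + 1) * c = c + (d + i * c)" by (simp_all add: algebra_simps)
    have t: "theta_rel a (b + (i + 1) * a) c (d + (i + 1) * c) \<tau> \<longleftrightarrow> theta_rel a (b + i * a) c (d + i * c) (\<tau> + 1)" if "Im \<tau> > 0" for \<tau>
      unfolding e by (rule theta_rel_translate[OF det that])
    show ?thesis
    proof
      assume *: "\<forall>\<tau>\<in>UHP. theta_rel a (b + (i + 1) * a) c (d + (i + 1) * c) \<tau>"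
      show "\<forall>\<tau>\<in>UHP. theta_rel a (b + i * a) c (d + i * c) \<tau>"
      proof
        fix \<tau> assume "\<tau> \<in> UHP"
        then show "theta_rel a (b + i * a) c (d + i * c) \<tau>" using t[of "\<tau> - 1"] * by simp
      qed
    qed (use t in auto)
  qed
  show ?thesis
  proof (induction n rule: int_induct[where k = 0])
    case (step1 i)
    then show ?case using step[of i] by blast
  next
    case (step2 i)
    then show ?case using step[of "i - 1"] by simp
  qed simp
qed

text \<open>Euclid's algorithm on the lower row: translations reduce \<open>d\<close> modulo \<open>c\<close>, an inversion then makes the lower
  left entry smaller.\<close>
lemma theta_rel_all:
  assumes "a * d - b * c = 1" "Im \<tau> > 0"
  shows "theta_rel a b c d \<tau>"
proof -
  have "\<forall>\<tau>\<in>UHP. theta_rel a b c d \<tau>"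
    using assms(1)
  proof (induction "nat \<bar>c\<bar>" arbitrary: a b c d rule: less_induct)
    case less
    show ?case
    proof (cases "c = 0")
      case True
      then have ad: "a * d = 1" using less.prems by simp
      then have a: "a = 1 \<or> a = - 1" "d = a" by (auto simp: zmult_eq_1_iff)
      have "\<forall>\<tau>\<in>UHP. theta_rel a 0 0 a \<tau>" using theta_rel_one a(1) by auto
      moreover have "b = 0 + (a * b) * a" using a(1) by auto
      ultimately show ?thesis
        using theta_rel_translate_int[of a a 0 0 "a * b"] a True by auto
    next
      case False
      define n where "n = d div c"
      define d' where "d' = d mod c"
      define b' where "b' = b - n * a"
      have d: "d = d' + n * c" by (simp add: d'_def n_def)
      have b: "b = b' + n * a" by (simp add: b'_def)
      have det: "a * d' - b' * c = 1" using less.prems unfolding d b by (simp add: algebra_simps)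
      have det2: "(- b') * c - a * (- d') = 1" using det by simp
      have lt: "nat \<bar>- d'\<bar> < nat \<bar>c\<bar>" using False abs_mod_less[of c d] by (simp add: d'_def)
      have "\<forall>\<tau>\<in>UHP. theta_rel (- b') a (- d') c \<tau>" by (rule less.hyps[OF lt det2])
      then have "\<forall>\<tau>\<in>UHP. theta_rel a (- (- b')) c (- (- d')) \<tau>"
        using theta_rel_inversion[OF det2] UHP_inv by blast
      then show ?thesis unfolding b d using theta_rel_translate_int[OF det] by simp
    qed
  qed
  then show ?thesis using assms(2) by simp
qed

section \<open>Hecke relations\<close>

lemma slash_sum_cong_at:
  assumes t: "Im \<tau> > 0"
    and eq: "\<And>a b c d. a * d - b * c = 1 \<Longrightarrow> f a b c d (sl2_act a b c d \<tau>) = g a b c d (sl2_act a b c d \<tau>)"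
  shows "slash_sum k f \<tau> = slash_sum k g \<tau>"
proof -
  have "slash_term k f \<tau> p = slash_term k g \<tau> p" if p: "p \<in> coprime_pairs" for p
  proof -
    obtain c d where cd: "p = (c, d)" "coprime c d" using p by (auto simp: coprime_pairs_def)
    obtain a b where row: "sl2_upper_row c d = (a, b)" by (cases "sl2_upper_row c d")
    have det: "a * d - b * c = 1" by (rule sl2_upper_row[OF cd(2) row])
    show ?thesis using eq[OF det] row by (simp add: slash_term_def cd)
  qed
  then show ?thesis unfolding slash_sum_def by (intro arg_cong[where f = "\<lambda>x. 1 / 2 * x"] infsum_cong)
qed

lemma det_parity_cases:
  assumes "a * d - b * c = (1::int)"
  shows "(even c \<and> odd a \<and> odd d) \<or> (odd c \<and> even d \<and> odd b) \<or>
    (odd c \<and> odd d \<and> odd a \<and> even b) \<or> (odd c \<and> odd d \<and> even a \<and> odd b)"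
proof -
  have "odd (a * d - b * c)" using assms by simp
  then show ?thesis by auto
qed

lemma theta0_double: "theta0 m (2 * \<tau>) = theta0 (2 * m) \<tau>" and theta1_double: "theta1 m (2 * \<tau>) = theta1 (2 * m) \<tau>"
  by (simp_all add: theta0_def theta1_def mult_ac)

lemma theta0_2_half: "theta0 2 (\<tau> / 2) = theta0 1 \<tau>"
  using theta0_double[of 1 "\<tau> / 2"] by simp

lemma theta0_1_half: "Im \<tau> > 0 \<Longrightarrow> theta0 1 (\<tau> / 2) = theta0 2 \<tau> + theta1 2 \<tau>"
  using th3_split[of \<tau>] by (simp add: theta0_def theta1_def)

definition const1_fam_double :: "nat \<Rightarrow> slash_fun" where
  "const1_fam_double k a b c d \<tau> = (if even c then theta0 2 \<tau> else (theta0 2 \<tau> + parity_sign a * theta1 2 \<tau>) / 2 ^ k)"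

definition mixed_fam_half :: "nat \<Rightarrow> slash_fun" where
  "mixed_fam_half k a b c d \<tau> =
    (if even d then 2 ^ k * parity_sign a * theta1 2 \<tau>
     else if even c then theta0 2 \<tau> + parity_sign b * theta1 2 \<tau>
     else parity_sign a * theta1 2 \<tau> - theta0 2 \<tau>)"

definition jacobi2_fam_half :: "nat \<Rightarrow> slash_fun" where
  "jacobi2_fam_half k a b c d \<tau> = (if even d then 2 ^ k * theta1 4 \<tau> else theta0 1 \<tau>)"

definition const2_fam_double :: "nat \<Rightarrow> slash_fun" where
  "const2_fam_double k a b c d \<tau> = (if even c then theta0 4 \<tau> else theta0 1 \<tau> / 2 ^ k)"

lemma const1_fam_double: "slash_family (const1_fam_double k)"
  by (rule slash_family_theta[of 2 2 "\<lambda>a b c d. if even c then 1 else 1 / 2 ^ k" 1 "\<lambda>a b c d. if even c then 0 else parity_sign a / 2 ^ k"])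
    (auto simp: const1_fam_double_def parity_sign_def norm_divide norm_power divide_simps)

lemma mixed_fam_half: "slash_family (mixed_fam_half k)"
proof (rule slash_family_theta[of 2 2 "\<lambda>a b c d. if even d then 0 else if even c then 1 else - 1" "2 ^ k"
      "\<lambda>a b c d. if even d then 2 ^ k * parity_sign a else if even c then parity_sign b else parity_sign a"])
  fix a b c d :: int
  assume "a * d - b * c = 1"
  from det_parity_cases[OF this] show "(if even d then 2 ^ k * parity_sign (a + c) else if even c then parity_sign (b + d) else parity_sign (a + c)) * \<i>\<^sup>2 =
    (if even d then 2 ^ k * parity_sign a else if even c then parity_sign b else parity_sign a)"
    by (elim disjE conjE) (simp_all add: parity_sign_def)
qed (auto simp: mixed_fam_half_def parity_sign_def norm_mult norm_power)

lemma jacobi2_fam_half: "slash_family (jacobi2_fam_half k)"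
  by (rule slash_family_theta[of 1 4 "\<lambda>a b c d. if even d then 0 else 1" "2 ^ k" "\<lambda>a b c d. if even d then 2 ^ k else 0"])
    (auto simp: jacobi2_fam_half_def norm_power)

lemma const2_fam_double: "slash_family (const2_fam_double k)"
proof -
  have "slash_family (\<lambda>a b c d \<tau>. (if even c then 1 else 0) * theta0 4 \<tau>)"
    by (rule slash_family_theta0[of 4 _ 1]) auto
  moreover have "slash_family (\<lambda>a b c d \<tau>. (if even c then 0 else 1 / 2 ^ k) * theta0 1 \<tau>)"
    by (rule slash_family_theta0[of 1 _ 1]) (auto simp: norm_divide norm_power divide_simps)
  ultimately have "slash_family (\<lambda>a b c d \<tau>. (if even c then 1 else 0) * theta0 4 \<tau> + (if even c then 0 else 1 / 2 ^ k) * theta0 1 \<tau>)"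
    by (rule slash_family_add)
  also have "(\<lambda>a b c d \<tau>. (if even c then 1 else 0) * theta0 4 \<tau> + (if even c then 0 else 1 / 2 ^ k) * theta0 1 \<tau>) = const2_fam_double k"
    by (intro ext) (simp add: const2_fam_double_def)
  finally show ?thesis .
qed

lemma parity_sign_simps [simp]: "parity_sign (2 * a) = 1" "parity_sign (- a) = parity_sign a" "odd a \<Longrightarrow> parity_sign a = - 1" "even a \<Longrightarrow> parity_sign a = 1"
  by (simp_all add: parity_sign_def)

lemma slash_sum_const1_fam_double: "Im \<tau> > 0 \<Longrightarrow> slash_sum k const1_fam (2 * \<tau>) = slash_sum k (const1_fam_double k) \<tau>"
proof (rule slash_sum_double[OF const1_fam const1_fam_double])
  fix a b c d :: int and \<tau> :: complex assume det: "2 * a * d - b * c = 1" and t: "Im \<tau> > 0"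
  then have "odd c" using det_parity(3)[of "2 * a" d b c] by simp
  then show "const1_fam_double k (2 * a) b c d \<tau> = const1_fam a b c (2 * d) (\<tau> / 2) / 2 ^ k"
    by (simp add: const1_fam_double_def const1_fam_def theta0_1_half[OF t, unfolded One_nat_def])
qed (simp_all add: const1_fam_double_def const1_fam_def theta0_double)

lemma slash_sum_const2_fam_double: "Im \<tau> > 0 \<Longrightarrow> slash_sum k const2_fam (2 * \<tau>) = slash_sum k (const2_fam_double k) \<tau>"
proof (rule slash_sum_double[OF const2_fam const2_fam_double])
  fix a b c d :: int and \<tau> :: complex assume det: "2 * a * d - b * c = 1" and t: "Im \<tau> > 0"
  then have "odd c" using det_parity(3)[of "2 * a" d b c] by simp
  then show "const2_fam_double k (2 * a) b c d \<tau> = const2_fam a b c (2 * d) (\<tau> / 2) / 2 ^ k"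
    by (simp add: const2_fam_double_def const2_fam_def theta0_2_half)
qed (simp_all add: const2_fam_double_def const2_fam_def theta0_double)

lemma slash_sum_jacobi2_fam_half: "Im \<tau> > 0 \<Longrightarrow> slash_sum k jacobi2_fam (\<tau> / 2) = slash_sum k (jacobi2_fam_half k) \<tau>"
proof (rule slash_sum_half[OF jacobi2_fam jacobi2_fam_half])
  fix a b c d :: int and \<tau> :: complex assume t: "Im \<tau> > 0"
  show "jacobi2_fam_half k a (2 * b) c d \<tau> = jacobi2_fam a b (2 * c) d (\<tau> / 2)" if "a * d - 2 * b * c = 1"
    using det_parity(4)[OF that] by (simp add: jacobi2_fam_half_def jacobi2_fam_def theta0_2_half)
  show "jacobi2_fam_half k a b c (2 * d) \<tau> = 2 ^ k * jacobi2_fam (2 * a) b c d (2 * \<tau>)" if "a * (2 * d) - b * c = 1"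
    using det_parity(2)[OF that] by (simp add: jacobi2_fam_half_def jacobi2_fam_def theta1_double)
qed

lemma slash_sum_mixed_fam_half: "Im \<tau> > 0 \<Longrightarrow> slash_sum k mixed_fam (\<tau> / 2) = slash_sum k (mixed_fam_half k) \<tau>"
proof (rule slash_sum_half[OF mixed_fam mixed_fam_half])
  fix a b c d :: int and \<tau> :: complex assume t: "Im \<tau> > 0"
  show "mixed_fam_half k a (2 * b) c d \<tau> = mixed_fam a b (2 * c) d (\<tau> / 2)" if "a * d - 2 * b * c = 1"
  proof -
    have "\<i> powi (- (2 * c) * a) = parity_sign (c * a)" proof -
      have "- (2 * c) * a = 2 * (- (c * a))" by simp
      then show ?thesis by (simp only: i_powi_double) simp
    qed
    then show ?thesis
      using det_parity(4)[OF that] by (auto simp: mixed_fam_half_def mixed_fam_def twisted_theta_def theta0_1_half[OF t, unfolded One_nat_def] parity_sign_def)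
  qed
  show "mixed_fam_half k a b c (2 * d) \<tau> = 2 ^ k * mixed_fam (2 * a) b c d (2 * \<tau>)" if "a * (2 * d) - b * c = 1"
  proof -
    have "\<i> powi (- c * (2 * a)) = parity_sign (c * a)" proof -
      have "- c * (2 * a) = 2 * (- (c * a))" by simp
      then show ?thesis by (simp only: i_powi_double) simp
    qed
    then show ?thesis
      using det_parity(2)[OF that] by (auto simp: mixed_fam_half_def mixed_fam_def twisted_theta_def theta1_double parity_sign_def)
  qed
qed

lemma slash_sum_half_plus1:
  assumes f: "slash_family f" and half: "\<And>\<tau>. Im \<tau> > 0 \<Longrightarrow> slash_sum k g (\<tau> / 2) = slash_sum k f \<tau>" and t: "Im \<tau> > 0"
  shows "slash_sum k g ((\<tau> + 1) / 2) = slash_sum k (\<lambda>a b c d. f a (b - a) c (d - c)) \<tau>"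
proof -
  have "slash_sum k g ((\<tau> + 1) / 2) = slash_sum k f (\<tau> + 1)" using half[of "\<tau> + 1"] t by simp
  also have "\<dots> = slash_sum k (\<lambda>a b c d. f a (b - a) c (d - c)) \<tau>"
    by (rule slash_sum_translate[OF f slash_family_translate[OF f] t]) simp
  finally show ?thesis .
qed

lemma slash_sum_mixed_fam_half_plus1:
  "Im \<tau> > 0 \<Longrightarrow> slash_sum k mixed_fam ((\<tau> + 1) / 2) = slash_sum k (\<lambda>a b c d. mixed_fam_half k a (b - a) c (d - c)) \<tau>"
  by (rule slash_sum_half_plus1[OF mixed_fam_half slash_sum_mixed_fam_half])

lemma slash_sum_jacobi2_fam_half_plus1:
  "Im \<tau> > 0 \<Longrightarrow> slash_sum k jacobi2_fam ((\<tau> + 1) / 2) = slash_sum k (\<lambda>a b c d. jacobi2_fam_half k a (b - a) c (d - c)) \<tau>"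
  by (rule slash_sum_half_plus1[OF jacobi2_fam_half slash_sum_jacobi2_fam_half])

text \<open>Term by term: according to the parities of \<open>c\<close> and \<open>d\<close>, the three transforms on the right contribute
  \<open>2\<^sup>k\<close> once and \<open>1\<close> twice to the same theta constant, while the other theta constants cancel.\<close>
lemma hecke_relation_jacobi2:
  assumes t: "Im \<tau> > 0" and k: "k \<ge> 4"
  shows "(2 ^ k + 2) * slash_sum k jacobi2_fam \<tau> =
    2 ^ k * slash_sum k const1_fam (2 * \<tau>) + (slash_sum k mixed_fam (\<tau> / 2) + slash_sum k mixed_fam ((\<tau> + 1) / 2))"
proof -
  note fams = const1_fam_double[of k] mixed_fam_half[of k] slash_family_translate[OF mixed_fam_half[of k]]
  have "(2 ^ k + 2) * slash_sum k jacobi2_fam \<tau> = slash_sum k (\<lambda>a b c d \<tau>. (2 ^ k + 2) * jacobi2_fam a b c d \<tau>) \<tau>"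
    by (rule slash_sum_cmult[symmetric])
  also have "\<dots> = slash_sum k (\<lambda>a b c d \<tau>. 2 ^ k * const1_fam_double k a b c d \<tau> +
      (mixed_fam_half k a b c d \<tau> + mixed_fam_half k a (b - a) c (d - c) \<tau>)) \<tau>"
  proof (rule slash_sum_cong_at[OF t])
    fix a b c d :: int assume det: "a * d - b * c = 1"
    define \<mu> where "\<mu> = sl2_act a b c d \<tau>"
    show "(2 ^ k + 2) * jacobi2_fam a b c d \<mu> = 2 ^ k * const1_fam_double k a b c d \<mu> +
      (mixed_fam_half k a b c d \<mu> + mixed_fam_half k a (b - a) c (d - c) \<mu>)"
      using det_parity_cases[OF det]
      by (elim disjE conjE) (simp_all add: jacobi2_fam_def const1_fam_double_def mixed_fam_half_def parity_sign_def algebra_simps add_divide_distrib diff_divide_distrib)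
  qed
  also have "\<dots> = 2 ^ k * slash_sum k (const1_fam_double k) \<tau> + (slash_sum k (mixed_fam_half k) \<tau> + slash_sum k (\<lambda>a b c d. mixed_fam_half k a (b - a) c (d - c)) \<tau>)"
    by (subst slash_sum_add; (intro slash_family_cmult slash_family_add fams k t)?)
      (subst slash_sum_add; (intro fams k t)?; simp add: slash_sum_cmult)
  finally show ?thesis
    using slash_sum_const1_fam_double[OF t] slash_sum_mixed_fam_half[OF t] slash_sum_mixed_fam_half_plus1[OF t] by simp
qed

lemma hecke_relation_jacobi4:
  assumes t: "Im \<tau> > 0" and k: "k \<ge> 4"
  shows "2 * slash_sum k const1_fam \<tau> + 2 ^ k * slash_sum k jacobi4_fam \<tau> =
    (slash_sum k jacobi2_fam (\<tau> / 2) + slash_sum k jacobi2_fam ((\<tau> + 1) / 2)) + 2 ^ k * slash_sum k const2_fam (2 * \<tau>)"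
proof -
  note fams = const1_fam jacobi4_fam const2_fam_double[of k] jacobi2_fam_half[of k] slash_family_translate[OF jacobi2_fam_half[of k]]
  have "2 * slash_sum k const1_fam \<tau> + 2 ^ k * slash_sum k jacobi4_fam \<tau> = slash_sum k (\<lambda>a b c d \<tau>. 2 * const1_fam a b c d \<tau> + 2 ^ k * jacobi4_fam a b c d \<tau>) \<tau>"
    by (subst slash_sum_add; (intro slash_family_cmult fams k t)?) (simp add: slash_sum_cmult)
  also have "\<dots> = slash_sum k (\<lambda>a b c d \<tau>.
      (jacobi2_fam_half k a b c d \<tau> + jacobi2_fam_half k a (b - a) c (d - c) \<tau>) + 2 ^ k * const2_fam_double k a b c d \<tau>) \<tau>"
  proof (rule slash_sum_cong_at[OF t])
    fix a b c d :: int assume det: "a * d - b * c = 1"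
    define \<mu> where "\<mu> = sl2_act a b c d \<tau>"
    show "2 * const1_fam a b c d \<mu> + 2 ^ k * jacobi4_fam a b c d \<mu> =
      (jacobi2_fam_half k a b c d \<mu> + jacobi2_fam_half k a (b - a) c (d - c) \<mu>) + 2 ^ k * const2_fam_double k a b c d \<mu>"
      using det_parity_cases[OF det]
      by (elim disjE conjE) (simp_all add: const1_fam_def jacobi4_fam_def const2_fam_double_def jacobi2_fam_half_def algebra_simps)
  qed
  also have "\<dots> = (slash_sum k (jacobi2_fam_half k) \<tau> + slash_sum k (\<lambda>a b c d. jacobi2_fam_half k a (b - a) c (d - c)) \<tau>) + 2 ^ k * slash_sum k (const2_fam_double k) \<tau>"
    by (subst slash_sum_add; (intro slash_family_cmult slash_family_add fams k t)?)
      (subst slash_sum_add; (intro fams k t)?; simp add: slash_sum_cmult)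
  finally show ?thesis
    using slash_sum_const2_fam_double[OF t] slash_sum_jacobi2_fam_half[OF t] slash_sum_jacobi2_fam_half_plus1[OF t] by simp
qed

lemma theta_relation_sum:
  assumes t: "Im \<tau> > 0" and k: "k \<ge> 4"
  shows "th2 \<tau> ^ 2 * slash_sum k dual_fam \<tau> = th3 \<tau> ^ 2 * slash_sum k const1_fam \<tau> - th4 \<tau> ^ 2 * slash_sum k mixed_fam \<tau>"
proof -
  define A B C where "A = th2 \<tau> ^ 2" and "B = th3 \<tau> ^ 2" and "C = th4 \<tau> ^ 2"
  have "A * slash_sum k dual_fam \<tau> = slash_sum k (\<lambda>a b c d \<tau>. A * dual_fam a b c d \<tau>) \<tau>"
    by (rule slash_sum_cmult[symmetric])
  also have "\<dots> = slash_sum k (\<lambda>a b c d \<tau>. B * const1_fam a b c d \<tau> + (- C) * mixed_fam a b c d \<tau>) \<tau>"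
  proof (rule slash_sum_cong_at[OF t])
    fix a b c d :: int assume det: "a * d - b * c = 1"
    show "A * dual_fam a b c d (sl2_act a b c d \<tau>) = B * const1_fam a b c d (sl2_act a b c d \<tau>) + (- C) * mixed_fam a b c d (sl2_act a b c d \<tau>)"
      using theta_rel_all[OF det t] by (simp add: theta_rel_def Let_def A_def B_def C_def dual_fam_def const1_fam_def mixed_fam_def)
  qed
  also have "\<dots> = B * slash_sum k const1_fam \<tau> + (- C) * slash_sum k mixed_fam \<tau>"
    by (subst slash_sum_add; (intro slash_family_cmult const1_fam mixed_fam k t)?) (simp only: slash_sum_cmult)
  finally show ?thesis by (simp add: A_def B_def C_def)
qed

section \<open>Jacobi-Eisenstein series at one half\<close>

lemma theta0_eq: "theta0 m \<tau> = (\<Sum>\<^sub>\<infinity>n::int. exp (2 * of_real pi * \<i> * of_nat m * (of_int n)\<^sup>2 * \<tau>))"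
  unfolding theta0_def th3_def quad_series_def by (intro infsum_cong arg_cong[where f = exp]) simp

lemma theta1_eq: "theta1 m \<tau> = (\<Sum>\<^sub>\<infinity>n::int. exp (2 * of_real pi * \<i> * of_nat m * (of_int n + 1 / 2)\<^sup>2 * \<tau>))"
  unfolding theta1_def th2_def quad_series_def by (intro infsum_cong arg_cong[where f = exp]) (simp add: of_real_add)

text \<open>With \<open>j = c \<tau> + d\<close> and \<open>\<mu> = \<gamma> \<tau>\<close>, the relation \<open>1 / j = a - c \<mu>\<close> turns the exponent into
  \<open>m ((l - c/2)\<^sup>2 \<mu> + l a - c a / 4)\<close>, and the middle term is an integer.\<close>
lemma jacobi_inner_sum:
  fixes a b c d :: int and m :: nat
  assumes det: "a * d - b * c = 1" and t: "Im \<tau> > 0"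
  defines "j \<equiv> of_int c * \<tau> + of_int d"
  shows "(\<Sum>\<^sub>\<infinity>l::int. exp (2 * of_real pi * \<i> * of_nat m *
            (of_int l ^ 2 * ((of_int a * \<tau> + of_int b) / j) + 2 * of_int l * (1 / 2 / j) - of_int c * (1 / 2) ^ 2 / j))) =
         exp (of_int (- (int m * c * a)) * (of_real pi * \<i> / 2)) * (if even c then theta0 m (sl2_act a b c d \<tau>) else theta1 m (sl2_act a b c d \<tau>))"
proof -
  define \<mu> where "\<mu> = sl2_act a b c d \<tau>"
  have mu: "\<mu> = (of_int a * \<tau> + of_int b) / j" by (simp add: \<mu>_def sl2_act_def j_def)
  have jnz: "j \<noteq> 0" unfolding j_def by (rule det_nz[OF det t])
  have "of_int a * j - of_int c * (of_int a * \<tau> + of_int b) = (of_int (a * d - b * c) :: complex)"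
    by (simp add: j_def algebra_simps)
  then have ij: "1 / j = of_int a - of_int c * \<mu>"
    unfolding det \<mu>_def sl2_act_def j_def[symmetric] using jnz by (simp add: field_simps)
  define e where "e = exp (of_int (- (int m * c * a)) * (of_real pi * \<i> / 2))"
  have tm: "exp (2 * of_real pi * \<i> * of_nat m *
            (of_int l ^ 2 * ((of_int a * \<tau> + of_int b) / j) + 2 * of_int l * (1 / 2 / j) - of_int c * (1 / 2) ^ 2 / j)) =
     e * exp (2 * of_real pi * \<i> * of_nat m * (of_int l - of_int c / 2)\<^sup>2 * \<mu>)" for l
  proof -
    have "of_int l ^ 2 * ((of_int a * \<tau> + of_int b) / j) + 2 * of_int l * (1 / 2 / j) - of_int c * (1 / 2) ^ 2 / j =
        of_int l ^ 2 * \<mu> + of_int l * (1 / j) - of_int c / 4 * (1 / j)"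
      by (simp add: mu power2_eq_square)
    also have "\<dots> = (of_int l - of_int c / 2)\<^sup>2 * \<mu> + of_int (l * a) - of_int (c * a) / 4"
      unfolding ij by (simp add: power2_eq_square field_simps)
    finally have X: "of_int l ^ 2 * ((of_int a * \<tau> + of_int b) / j) + 2 * of_int l * (1 / 2 / j) - of_int c * (1 / 2) ^ 2 / j =
        (of_int l - of_int c / 2)\<^sup>2 * \<mu> + of_int (l * a) - of_int (c * a) / 4" .
    define Q where "Q = (of_int l - of_int c / 2)\<^sup>2 * \<mu>"
    have "2 * of_real pi * \<i> * of_nat m * (Q + of_int (l * a) - of_int (c * a) / 4) =
      of_int (- (int m * c * a)) * (of_real pi * \<i> / 2) + of_int (2 * (int m * l * a)) * (of_real pi * \<i>) +
      2 * of_real pi * \<i> * of_nat m * Q"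
      by (simp add: field_simps)
    moreover have "exp (of_int (2 * (int m * l * a)) * (of_real pi * \<i>)) = (1 :: complex)"
      using exp_integer_2pi[of "of_int (int m * l * a)"] by (simp add: mult_ac)
    ultimately show ?thesis unfolding X Q_def[symmetric] mult.assoc[of _ _ \<mu>] by (simp only: exp_add e_def mult_1_right)
  qed
  have "(\<Sum>\<^sub>\<infinity>l::int. exp (2 * of_real pi * \<i> * of_nat m * (of_int l - of_int c / 2)\<^sup>2 * \<mu>)) = (if even c then theta0 m \<mu> else theta1 m \<mu>)"
  proof (cases "even c")
    case True
    then obtain s where s: "c = 2 * s" by (rule evenE)
    have "(\<Sum>\<^sub>\<infinity>l::int. exp (2 * of_real pi * \<i> * of_nat m * (of_int l - of_int c / 2)\<^sup>2 * \<mu>)) =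
      (\<Sum>\<^sub>\<infinity>l::int. exp (2 * of_real pi * \<i> * of_nat m * (of_int (l + (- s)))\<^sup>2 * \<mu>))" by (simp add: s)
    also have "\<dots> = theta0 m \<mu>" unfolding theta0_eq by (rule infsum_int_shift)
    finally show ?thesis using True by simp
  next
    case False
    then obtain s where s: "c = 2 * s + 1" by (rule oddE)
    have "of_int l - of_int c / 2 = (of_int (l + (- s - 1)) + 1 / 2 :: complex)" for l by (simp add: s field_simps)
    then have "(\<Sum>\<^sub>\<infinity>l::int. exp (2 * of_real pi * \<i> * of_nat m * (of_int l - of_int c / 2)\<^sup>2 * \<mu>)) =
      (\<Sum>\<^sub>\<infinity>l::int. exp (2 * of_real pi * \<i> * of_nat m * (of_int (l + (- s - 1)) + 1 / 2)\<^sup>2 * \<mu>))" by presburger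
    also have "\<dots> = theta1 m \<mu>" unfolding theta1_eq by (rule infsum_int_shift)
    finally show ?thesis using False by simp
  qed
  then show ?thesis unfolding tm \<mu>_def[symmetric] e_def[symmetric] by (simp add: infsum_cmult_right')
qed

lemma jacobi_eisenstein_half:
  assumes t: "Im \<tau> > 0"
    and f: "\<And>a b c d \<mu>. f a b c d \<mu> = exp (of_int (- (int m * c * a)) * (of_real pi * \<i> / 2)) * (if even c then theta0 m \<mu> else theta1 m \<mu>)"
  shows "jacobi_eisenstein k m \<tau> (1 / 2) = slash_sum k f \<tau>"
proof -
  have "(\<Sum>\<^sub>\<infinity>l::int.
       (let (a, b) = sl2_upper_row c d; j = of_int c * \<tau> + of_int d in
          j powi (- int k) *
          exp (2 * of_real pi * \<i> * of_nat m *
            (of_int l ^ 2 * ((of_int a * \<tau> + of_int b) / j)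
             + 2 * of_int l * (1 / 2 / j)
             - of_int c * (1 / 2) ^ 2 / j)))) = slash_term k f \<tau> (c, d)" if "coprime c d" for c d
  proof -
    obtain a b where row: "sl2_upper_row c d = (a, b)" by (cases "sl2_upper_row c d")
    have det: "a * d - b * c = 1" by (rule sl2_upper_row[OF that row])
    show ?thesis
      unfolding row Let_def prod.case infsum_cmult_right' jacobi_inner_sum[OF det t] slash_term_def f by simp
  qed
  then show ?thesis
    unfolding jacobi_eisenstein_def slash_sum_def coprime_pairs_def
    by (intro arg_cong[where f = "\<lambda>x. 1 / 2 * x"] infsum_cong) auto
qed

lemma exp_half_turns: "exp (of_int (2 * n) * (of_real pi * \<i> / 2)) = parity_sign n"
proof -
  have "exp (of_int (2 * n) * (of_real pi * \<i> / 2)) = exp (of_int n * (of_real pi * \<i>))" by simp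
  also have "\<dots> = exp (of_real pi * \<i>) powi n" by (simp only: exp_power_int)
  also have "exp (of_real pi * \<i>) = - 1" by (rule exp_pi_i)
  finally show ?thesis by (simp add: power_int_minus_left parity_sign_def)
qed

lemma jacobi_eisenstein_index_2: "Im \<tau> > 0 \<Longrightarrow> jacobi_eisenstein k 2 \<tau> (1 / 2) = slash_sum k jacobi2_fam \<tau>"
proof (rule jacobi_eisenstein_half)
  fix a b c d :: int and \<mu> :: complex
  have "exp (of_int (- (int 2 * c * a)) * (of_real pi * \<i> / 2)) = parity_sign (c * a)"
    using exp_half_turns[of "- (c * a)"] by (simp add: mult_ac)
  then show "jacobi2_fam a b c d \<mu> = exp (of_int (- (int 2 * c * a)) * (of_real pi * \<i> / 2)) * (if even c then theta0 2 \<mu> else theta1 2 \<mu>)"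
    by (simp add: jacobi2_fam_def parity_sign_def)
qed

lemma jacobi_eisenstein_index_4: "Im \<tau> > 0 \<Longrightarrow> jacobi_eisenstein k 4 \<tau> (1 / 2) = slash_sum k jacobi4_fam \<tau>"
proof (rule jacobi_eisenstein_half)
  fix a b c d :: int and \<mu> :: complex
  have "exp (of_int (- (int 4 * c * a)) * (of_real pi * \<i> / 2)) = parity_sign (2 * (c * a))"
    using exp_half_turns[of "- (2 * (c * a))"] by (simp add: mult_ac)
  then show "jacobi4_fam a b c d \<mu> = exp (of_int (- (int 4 * c * a)) * (of_real pi * \<i> / 2)) * (if even c then theta0 4 \<mu> else theta1 4 \<mu>)"
    by (simp add: jacobi4_fam_def)
qed

section \<open>Evaluation of the sums\<close>

lemma theta0_tendsto: "m \<ge> 1 \<Longrightarrow> (theta0 m \<longlongrightarrow> 1) at_cusp"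
  unfolding theta0_def [abs_def]
  using filterlim_compose[OF th3_tendsto filterlim_cusp_mult[of "real (2 * m)"]] by simp

lemma slash_sum_level_one:
  assumes f: "slash_family f" and k: "k = 4 * n" "n \<ge> 1" "n < 3"
    and const: "\<And>a b c d. f a b c d = theta0 m" "m \<ge> 1" and t: "Im \<tau> > 0"
  shows "slash_sum k f \<tau> = e4 \<tau> ^ n"
proof -
  have k4: "k \<ge> 4" "even k" using k by auto
  define D where "D = (\<lambda>\<tau>. slash_sum k f \<tau> - e4 \<tau> ^ n)"
  have T: "slash_sum k f (\<tau> + 1) = slash_sum k f \<tau>" if "Im \<tau> > 0" for \<tau>
    by (rule slash_sum_translate[OF f f that]) (simp add: const)
  have S: "slash_sum k f (- 1 / \<tau>) = \<tau> ^ k * slash_sum k f \<tau>" if "Im \<tau> > 0" for \<tau>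
    by (rule slash_sum_inversion[OF f f that]) (simp add: const)
  have "D \<tau> = 0"
  proof (rule level_one_weight_vanish[OF _ _ _ _ k(3) t])
    show "D holomorphic_on UHP"
      unfolding D_def by (intro holomorphic_intros slash_sum_holo[OF f k4(1)] e4_holo)
    show "D (\<tau> + 1) = D \<tau>" if "Im \<tau> > 0" for \<tau> by (simp add: D_def T[OF that] e4_plus1)
    show "D (- 1 / \<tau>) = \<tau> ^ (4 * n) * D \<tau>" if "Im \<tau> > 0" for \<tau>
      unfolding D_def S[OF that] e4_inversion[OF that] k(1)[symmetric] by (simp add: power_mult_distrib right_diff_distrib flip: power_mult k(1))
    have "(slash_sum k f \<longlongrightarrow> 1) at_cusp"
      by (rule slash_sum_tendsto[OF f k4 T]) (simp_all add: const(1) theta0_tendsto[OF const(2)])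
    from tendsto_diff[OF this tendsto_power[OF e4_tendsto, of n]] show "(D \<longlongrightarrow> 0) at_cusp"
      by (simp add: D_def)
  qed
  then show ?thesis by (simp add: D_def)
qed

text \<open>The value of the mixed sum in weight four, and its transform under inversion. As polynomials in the theta constants
  they satisfy the same relation as the sums.\<close>
definition mixed_form :: "complex \<Rightarrow> complex" where "mixed_form \<tau> = (th3 \<tau> ^ 6 * th4 \<tau> ^ 2 + th4 \<tau> ^ 6 * th3 \<tau> ^ 2) / 2"
definition dual_form :: "complex \<Rightarrow> complex" where "dual_form \<tau> = (th3 \<tau> ^ 6 * th2 \<tau> ^ 2 + th2 \<tau> ^ 6 * th3 \<tau> ^ 2) / 2"

lemma mixed_form_inversion: "Im \<tau> > 0 \<Longrightarrow> mixed_form (- 1 / \<tau>) = \<tau> ^ 4 * dual_form \<tau>"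
proof -
  assume t: "Im \<tau> > 0"
  have "mixed_form (- 1 / \<tau>) = csqrt (- \<i> * \<tau>) ^ (2 * 4) * dual_form \<tau>"
    unfolding mixed_form_def dual_form_def th2_inversion[OF t] th3_inversion[OF t] th4_inversion[OF t]
    by (simp add: power_mult_distrib eval_nat_numeral algebra_simps)
  then show ?thesis unfolding csqrt_power minus_i_powers .
qed

lemma form_relation:
  assumes "Im \<tau> > 0"
  shows "th2 \<tau> ^ 2 * dual_form \<tau> = th3 \<tau> ^ 2 * e4 \<tau> - th4 \<tau> ^ 2 * mixed_form \<tau>"
proof -
  define u v w where "u = th2 \<tau> ^ 2" and "v = th3 \<tau> ^ 2" and "w = th4 \<tau> ^ 2"
  have jac: "v ^ 2 = u ^ 2 + w ^ 2"
    using jacobi_theta_identity[OF assms] by (simp add: u_def v_def w_def flip: power_mult)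
  have "dual_form \<tau> = (v ^ 3 * u + u ^ 3 * v) / 2" "mixed_form \<tau> = (v ^ 3 * w + w ^ 3 * v) / 2" "e4 \<tau> = (u ^ 4 + v ^ 4 + w ^ 4) / 2"
    by (simp_all add: dual_form_def mixed_form_def e4_def u_def v_def w_def flip: power_mult)
  moreover have "u * (v ^ 3 * u + u ^ 3 * v) = v * (u ^ 4 + v ^ 4 + w ^ 4) - w * (v ^ 3 * w + w ^ 3 * v)"
    using jac by algebra
  ultimately have "u * dual_form \<tau> = v * e4 \<tau> - w * mixed_form \<tau>" by algebra
  then show ?thesis by (simp add: u_def v_def w_def)
qed

lemma exp_quarter_power: "exp (of_real pi * \<i> * \<tau> / 4) ^ 24 = nome \<tau> ^ 3"
proof -
  have "exp (of_real pi * \<i> * \<tau> / 4) ^ 24 = exp (of_nat 24 * (of_real pi * \<i> * \<tau> / 4))" by (rule exp_of_nat_mult[symmetric])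
  also have "\<dots> = exp (of_nat 3 * (2 * of_real pi * \<i> * \<tau>))" by (simp add: mult_ac)
  also have "\<dots> = nome \<tau> ^ 3" unfolding nome_def by (rule exp_of_nat_mult)
  finally show ?thesis .
qed

text \<open>Let \<open>D\<close> be the difference of the two sides. By the linear relation, inversion takes \<open>D\<close> to
  \<open>- \<tau>\<^sup>k (th4\<^sup>2 / th2\<^sup>2) D\<close>, that is, \<open>D / th2\<^sup>2\<close> transforms under \<open>SL\<^sub>2(Z)\<close> by a root of unity with weight \<open>k - 1\<close>.
  A twelfth power removes the root of unity, and division by \<open>\<Delta>\<^sup>k\<^sup>-\<^sup>1\<close> the weight.\<close>
lemma slash_sum_mixed_fam:
  assumes k: "k = 4 * n" "n \<ge> 1" "n < 3" and t: "Im \<tau> > 0"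
  shows "slash_sum k mixed_fam \<tau> = mixed_form \<tau> * e4 \<tau> ^ (n - 1)"
proof -
  have k4: "k \<ge> 4" "even k" using k by auto
  obtain n' where n': "n = Suc n'" using k(2) by (cases n) auto
  define D where "D = (\<lambda>\<tau>. slash_sum k mixed_fam \<tau> - mixed_form \<tau> * e4 \<tau> ^ n')"
  define h where "h = (\<lambda>\<tau>. D \<tau> ^ 12 / (th2 \<tau> ^ 24 * Delta \<tau> ^ (k - 1)))"
  have FT: "slash_sum k mixed_fam (\<tau> + 1) = slash_sum k mixed_fam \<tau>" if "Im \<tau> > 0" for \<tau>
    by (rule slash_sum_translate[OF mixed_fam mixed_fam that]) (simp add: mixed_fam_def)
  have FS: "slash_sum k mixed_fam (- 1 / \<tau>) = \<tau> ^ k * slash_sum k dual_fam \<tau>" if "Im \<tau> > 0" for \<tau>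
    by (rule slash_sum_inversion[OF mixed_fam dual_fam that]) (simp add: mixed_fam_def dual_fam_def twisted_theta_def)
  have Dhol: "D holomorphic_on UHP"
    unfolding D_def mixed_form_def by (intro holomorphic_intros slash_sum_holo[OF mixed_fam k4(1)] e4_holo th3_holo th4_holo) auto
  have DT: "D (\<tau> + 1) = D \<tau>" if "Im \<tau> > 0" for \<tau>
    unfolding D_def FT[OF that] e4_plus1 mixed_form_def th3_plus1 th4_plus1 by (simp add: add.commute)
  have DS: "th2 \<tau> ^ 2 * D (- 1 / \<tau>) = - (\<tau> ^ k * th4 \<tau> ^ 2 * D \<tau>)" if "Im \<tau> > 0" for \<tau>
  proof -
    have P: "slash_sum k const1_fam \<tau> = e4 \<tau> ^ n"
      by (rule slash_sum_level_one[OF const1_fam k, of 1]) (use that in \<open>auto simp: const1_fam_def fun_eq_iff\<close>)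
    have tk: "\<tau> ^ k = \<tau> ^ 4 * (\<tau> ^ 4) ^ n'" by (simp add: k(1) n' power_add power_mult)
    have "D (- 1 / \<tau>) = \<tau> ^ k * (slash_sum k dual_fam \<tau> - dual_form \<tau> * e4 \<tau> ^ n')"
      unfolding D_def FS[OF that] mixed_form_inversion[OF that] e4_inversion[OF that] power_mult_distrib
      by (simp add: tk algebra_simps)
    then have "th2 \<tau> ^ 2 * D (- 1 / \<tau>) = \<tau> ^ k * (th2 \<tau> ^ 2 * slash_sum k dual_fam \<tau> - th2 \<tau> ^ 2 * dual_form \<tau> * e4 \<tau> ^ n')"
      by (simp only: right_diff_distrib mult_ac)
    also have "\<dots> = - (\<tau> ^ k * th4 \<tau> ^ 2 * D \<tau>)"
      unfolding theta_relation_sum[OF that k4(1)] form_relation[OF that] P n' by (simp add: D_def algebra_simps)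
    finally show ?thesis .
  qed
  have "h \<tau> = 0"
  proof (rule level_one_vanish[OF _ _ _ _ t])
    show "h holomorphic_on UHP" unfolding h_def
      using Delta_nz theta_nz(1) by (intro holomorphic_intros Dhol Delta_holo th2_holo) auto
    have "th2 (\<tau> + 1) ^ 24 = th2 \<tau> ^ 24" for \<tau>
      using arg_cong[OF th2_plus1_8[of \<tau>], of "\<lambda>x. x ^ 3"] by (simp flip: power_mult)
    then show "h (\<tau> + 1) = h \<tau>" if "Im \<tau> > 0" for \<tau> using that by (simp add: h_def DT Delta_plus1)
    show "h (- 1 / \<tau>) = h \<tau>" if s: "Im \<tau> > 0" for \<tau>
    proof -
      note nz = UHP_nz[OF s] theta_nz[OF s] Delta_nz[OF s]
      have "th2 (- 1 / \<tau>) ^ 24 = csqrt (- \<i> * \<tau>) ^ (2 * 12) * th4 \<tau> ^ 24"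
        unfolding th2_inversion[OF s] power_mult_distrib by simp
      then have t2: "th2 (- 1 / \<tau>) ^ 24 = \<tau> ^ 12 * th4 \<tau> ^ 24" unfolding csqrt_power minus_i_powers .
      have "(th2 \<tau> ^ 2 * D (- 1 / \<tau>)) ^ 12 = (\<tau> ^ k * th4 \<tau> ^ 2 * D \<tau>) ^ 12"
        unfolding DS[OF s] by simp
      then have d: "th2 \<tau> ^ 24 * D (- 1 / \<tau>) ^ 12 = (\<tau> ^ 12) ^ k * th4 \<tau> ^ 24 * D \<tau> ^ 12"
        by (simp add: power_mult_distrib mult.commute flip: power_mult)
      have "(\<tau> ^ 12) ^ k = \<tau> ^ 12 * (\<tau> ^ 12) ^ (k - 1)"
        using k4(1) by (simp flip: power_Suc)
      then have "D (- 1 / \<tau>) ^ 12 * (th2 \<tau> ^ 24 * Delta \<tau> ^ (k - 1)) = D \<tau> ^ 12 * (\<tau> ^ 12 * th4 \<tau> ^ 24 * (\<tau> ^ 12 * Delta \<tau>) ^ (k - 1))"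
        using d by (simp add: power_mult_distrib mult_ac)
      then show ?thesis unfolding h_def t2 Delta_inversion[OF s] using nz by (simp add: frac_eq_eq)
    qed
    have "(slash_sum k mixed_fam \<longlongrightarrow> 1) at_cusp"
      by (rule slash_sum_tendsto[OF mixed_fam k4 FT])
        (use theta0_tendsto[of 1] in \<open>simp_all add: mixed_fam_def twisted_theta_def [abs_def]\<close>)
    moreover have "((\<lambda>\<tau>. mixed_form \<tau> * e4 \<tau> ^ n') \<longlongrightarrow> (1 ^ 6 * 1 ^ 2 + 1 ^ 6 * 1 ^ 2) / 2 * 1 ^ n') at_cusp"
      unfolding mixed_form_def by (intro tendsto_intros th3_tendsto th4_tendsto e4_tendsto) auto
    ultimately have "(D \<longlongrightarrow> 1 - (1 ^ 6 * 1 ^ 2 + 1 ^ 6 * 1 ^ 2) / 2 * 1 ^ n') at_cusp"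
      unfolding D_def by (rule tendsto_diff)
    then have lim: "(D \<longlongrightarrow> 0) at_cusp" by simp
    obtain L where L: "((\<lambda>\<tau>. D \<tau> / nome \<tau>) \<longlongrightarrow> L) at_cusp"
      using cusp_order_one[OF Dhol DT lim] by blast
    have e: "10 - k \<ge> 2" "k \<le> 8" using k by auto
    have "((\<lambda>\<tau>. (D \<tau> / nome \<tau>) ^ 12 * (nome \<tau> / Delta \<tau>) ^ (k - 1) / (th2 \<tau> / exp (of_real pi * \<i> * \<tau> / 4)) ^ 24 * nome \<tau> ^ (10 - k))
        \<longlongrightarrow> L ^ 12 * 1 ^ (k - 1) / 2 ^ 24 * 0 ^ (10 - k)) at_cusp"
      by (intro tendsto_intros L Delta_tendsto nome_tendsto th2_tendsto) auto
    moreover have "(D \<tau> / nome \<tau>) ^ 12 * (nome \<tau> / Delta \<tau>) ^ (k - 1) / (th2 \<tau> / exp (of_real pi * \<i> * \<tau> / 4)) ^ 24 * nome \<tau> ^ (10 - k) = h \<tau>" for \<tau>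
    proof -
      have q: "nome \<tau> \<noteq> 0" by (simp add: nome_def)
      \<comment> \<open>The zero of \<open>D\<^sup>1\<^sup>2\<close> has order \<open>12\<close>, that of the denominator \<open>3 + (k - 1)\<close>; so \<open>k < 10\<close> is what is used.\<close>
      have "nome \<tau> ^ (k - 1) * nome \<tau> ^ 3 * nome \<tau> ^ (10 - k) = nome \<tau> ^ 12"
      proof -
        have "k - 1 + 3 + (10 - k) = 12" using e k4 by linarith
        then show ?thesis by (simp only: power_add[symmetric])
      qed
      moreover have "A / Q * (R / B) / (C / S) * U = A / (C * B) * (R * S * U / Q)" for A B C Q R S U :: complex
        by (simp add: divide_inverse mult_ac)
      ultimately show ?thesis using q unfolding h_def power_divide exp_quarter_power by simp
    qed
    ultimately show "(h \<longlongrightarrow> 0) at_cusp" using e by (simp add: power_0_left)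
  qed
  then show ?thesis using Delta_nz[OF t] theta_nz(1)[OF t] by (simp add: h_def D_def n')
qed

section \<open>Landen transformations and the identity\<close>

lemma theta_half:
  assumes "Im \<tau> > 0"
  shows "th3 (\<tau> / 2) ^ 2 = th3 \<tau> ^ 2 + th2 \<tau> ^ 2" "th4 (\<tau> / 2) ^ 2 = th3 \<tau> ^ 2 - th2 \<tau> ^ 2"
    "th2 (\<tau> / 2) ^ 4 = 4 * th2 \<tau> ^ 2 * th3 \<tau> ^ 2"
proof -
  have "th2 (\<tau> / 2) ^ 2 = 2 * th2 \<tau> * th3 \<tau>" using th2_sq[of "\<tau> / 2"] assms by simp
  then have "(th2 (\<tau> / 2) ^ 2) ^ 2 = (2 * th2 \<tau> * th3 \<tau>) ^ 2" by simp
  then show "th2 (\<tau> / 2) ^ 4 = 4 * th2 \<tau> ^ 2 * th3 \<tau> ^ 2" by (simp add: power_mult_distrib)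
qed (use th3_sq[of "\<tau> / 2"] th4_sq[of "\<tau> / 2"] assms in simp_all)

lemma theta_half_plus1:
  assumes "Im \<tau> > 0"
  shows "th3 ((\<tau> + 1) / 2) ^ 2 = th4 \<tau> ^ 2 + \<i> * th2 \<tau> ^ 2" "th4 ((\<tau> + 1) / 2) ^ 2 = th4 \<tau> ^ 2 - \<i> * th2 \<tau> ^ 2"
    "th2 ((\<tau> + 1) / 2) ^ 4 = 4 * \<i> * th2 \<tau> ^ 2 * th4 \<tau> ^ 2"
  using theta_half[of "\<tau> + 1"] assms by (simp_all add: th2_plus1_sq th3_plus1)

lemma theta_double:
  assumes "Im \<tau> > 0"
  shows "th3 (2 * \<tau>) ^ 2 = (th3 \<tau> ^ 2 + th4 \<tau> ^ 2) / 2" "th2 (2 * \<tau>) ^ 2 = (th3 \<tau> ^ 2 - th4 \<tau> ^ 2) / 2"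
    "th4 (2 * \<tau>) ^ 4 = th3 \<tau> ^ 2 * th4 \<tau> ^ 2"
proof -
  show *: "th3 (2 * \<tau>) ^ 2 = (th3 \<tau> ^ 2 + th4 \<tau> ^ 2) / 2" "th2 (2 * \<tau>) ^ 2 = (th3 \<tau> ^ 2 - th4 \<tau> ^ 2) / 2"
    using th3_sq[OF assms] th4_sq[OF assms] by simp_all
  have "th4 (2 * \<tau>) ^ 4 = (th3 (2 * \<tau>) ^ 2) ^ 2 - (th2 (2 * \<tau>) ^ 2) ^ 2"
    using jacobi_theta_identity[of "2 * \<tau>"] assms by (simp flip: power_mult)
  then show "th4 (2 * \<tau>) ^ 4 = th3 \<tau> ^ 2 * th4 \<tau> ^ 2"
    unfolding * by (simp add: power2_eq_square field_simps)
qed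

lemma e4_squares: "e4 \<tau> = ((th2 \<tau> ^ 4) ^ 2 + (th3 \<tau> ^ 2) ^ 4 + (th4 \<tau> ^ 2) ^ 4) / 2"
  "e4 \<tau> = ((th2 \<tau> ^ 2) ^ 4 + (th3 \<tau> ^ 2) ^ 4 + (th4 \<tau> ^ 4) ^ 2) / 2"
  "e4 \<tau> = ((th2 \<tau> ^ 2) ^ 4 + (th3 \<tau> ^ 2) ^ 4 + (th4 \<tau> ^ 2) ^ 4) / 2"
  "mixed_form \<tau> = ((th3 \<tau> ^ 2) ^ 3 * th4 \<tau> ^ 2 + (th4 \<tau> ^ 2) ^ 3 * th3 \<tau> ^ 2) / 2"
  by (simp_all add: e4_def mixed_form_def flip: power_mult)

lemma e4_double:
  assumes "Im \<tau> > 0"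
  shows "16 * e4 (2 * \<tau>) = (th3 \<tau> ^ 2) ^ 4 + 14 * (th3 \<tau> ^ 2) ^ 2 * (th4 \<tau> ^ 2) ^ 2 + (th4 \<tau> ^ 2) ^ 4"
  unfolding e4_squares(2) theta_double[OF assms] by (simp add: eval_nat_numeral field_simps)

lemma e4_half:
  assumes "Im \<tau> > 0"
  shows "e4 (\<tau> / 2) = (th2 \<tau> ^ 2) ^ 4 + 14 * (th2 \<tau> ^ 2) ^ 2 * (th3 \<tau> ^ 2) ^ 2 + (th3 \<tau> ^ 2) ^ 4"
    "e4 ((\<tau> + 1) / 2) = (th2 \<tau> ^ 2) ^ 4 - 14 * (th2 \<tau> ^ 2) ^ 2 * (th4 \<tau> ^ 2) ^ 2 + (th4 \<tau> ^ 2) ^ 4"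
    "mixed_form (\<tau> / 2) = (th3 \<tau> ^ 2) ^ 4 - (th2 \<tau> ^ 2) ^ 4"
    "mixed_form ((\<tau> + 1) / 2) = (th4 \<tau> ^ 2) ^ 4 - (th2 \<tau> ^ 2) ^ 4"
proof -
  show "e4 (\<tau> / 2) = (th2 \<tau> ^ 2) ^ 4 + 14 * (th2 \<tau> ^ 2) ^ 2 * (th3 \<tau> ^ 2) ^ 2 + (th3 \<tau> ^ 2) ^ 4"
    unfolding e4_squares(1) theta_half[OF assms] by (simp add: eval_nat_numeral field_simps)
  show "e4 ((\<tau> + 1) / 2) = (th2 \<tau> ^ 2) ^ 4 - 14 * (th2 \<tau> ^ 2) ^ 2 * (th4 \<tau> ^ 2) ^ 2 + (th4 \<tau> ^ 2) ^ 4"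
    unfolding e4_squares(1) theta_half_plus1[OF assms] by (simp add: eval_nat_numeral field_simps)
  show "mixed_form (\<tau> / 2) = (th3 \<tau> ^ 2) ^ 4 - (th2 \<tau> ^ 2) ^ 4"
    unfolding e4_squares(4) theta_half[OF assms] by (simp add: eval_nat_numeral field_simps)
  show "mixed_form ((\<tau> + 1) / 2) = (th4 \<tau> ^ 2) ^ 4 - (th2 \<tau> ^ 2) ^ 4"
    unfolding e4_squares(4) theta_half_plus1[OF assms] by (simp add: eval_nat_numeral field_simps)
qed

lemma jacobi_squares:
  assumes "Im \<tau> > 0"
  shows "(th3 \<tau> ^ 2) ^ 2 = (th2 \<tau> ^ 2) ^ 2 + (th4 \<tau> ^ 2) ^ 2"
  using jacobi_theta_identity[OF assms] by (simp flip: power_mult)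

lemma slash_sum_const1_fam_const2_fam:
  assumes "k = 4 * n" "n \<ge> 1" "n < 3" "Im \<tau> > 0"
  shows "slash_sum k const1_fam \<tau> = e4 \<tau> ^ n" "slash_sum k const2_fam \<tau> = e4 \<tau> ^ n"
  by (rule slash_sum_level_one[OF const1_fam, where m = 1] slash_sum_level_one[OF const2_fam, where m = 2];
      use assms in \<open>auto simp: const1_fam_def const2_fam_def fun_eq_iff\<close>)+

text \<open>The first Hecke relation, with all terms on the right known, written in \<open>u = th2\<^sup>2\<close>, \<open>v = th3\<^sup>2\<close>, \<open>w = th4\<^sup>2\<close>,
  where \<open>v\<^sup>2 = u\<^sup>2 + w\<^sup>2\<close>.\<close>
lemma jacobi2_weight_4:
  assumes t: "Im \<tau> > 0"
  shows "slash_sum 4 jacobi2_fam \<tau> = (th3 \<tau> ^ 2) ^ 2 * (th4 \<tau> ^ 2) ^ 2"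
proof -
  define u v w where "u = th2 \<tau> ^ 2" and "v = th3 \<tau> ^ 2" and "w = th4 \<tau> ^ 2"
  have jac: "v ^ 2 = u ^ 2 + w ^ 2" using jacobi_squares[OF t] by (simp add: u_def v_def w_def)
  have "18 * slash_sum 4 jacobi2_fam \<tau> = 16 * e4 (2 * \<tau>) + (mixed_form (\<tau> / 2) + mixed_form ((\<tau> + 1) / 2))"
    using hecke_relation_jacobi2[OF t, of 4] slash_sum_const1_fam_const2_fam(1)[of 4 1 "2 * \<tau>"]
      slash_sum_mixed_fam[of 4 1 "\<tau> / 2"] slash_sum_mixed_fam[of 4 1 "(\<tau> + 1) / 2"] t by simp
  also have "\<dots> = 18 * (v ^ 2 * w ^ 2)"
    unfolding e4_double[OF t] e4_half[OF t] u_def[symmetric] v_def[symmetric] w_def[symmetric]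
    using jac by algebra
  finally show ?thesis by (simp add: v_def w_def)
qed

text \<open>The second Hecke relation; the values of the index two sum at \<open>\<tau>/2\<close> and \<open>(\<tau> + 1)/2\<close> are \<open>w\<^sup>4\<close> and \<open>v\<^sup>4\<close>.\<close>
lemma jacobi4_weight_4:
  assumes t: "Im \<tau> > 0"
  shows "slash_sum 4 jacobi4_fam \<tau> = (th3 \<tau> ^ 2) ^ 2 * (th4 \<tau> ^ 2) ^ 2"
proof -
  define u v w where "u = th2 \<tau> ^ 2" and "v = th3 \<tau> ^ 2" and "w = th4 \<tau> ^ 2"
  have jac: "v ^ 2 = u ^ 2 + w ^ 2" using jacobi_squares[OF t] by (simp add: u_def v_def w_def)
  have half: "Im (\<tau> / 2) > 0" "Im ((\<tau> + 1) / 2) > 0" using t by simp_all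
  have i2: "(w + \<i> * u) ^ 2 * (w - \<i> * u) ^ 2 = (w ^ 2 + u ^ 2) ^ 2"
    by (simp add: power2_eq_square algebra_simps)
  have "2 * e4 \<tau> + 16 * slash_sum 4 jacobi4_fam \<tau> = ((v + u) ^ 2 * (v - u) ^ 2 + (w + \<i> * u) ^ 2 * (w - \<i> * u) ^ 2) + 16 * e4 (2 * \<tau>)"
    using hecke_relation_jacobi4[OF t, of 4] slash_sum_const1_fam_const2_fam(1)[of 4 1 \<tau>] slash_sum_const1_fam_const2_fam(2)[of 4 1 "2 * \<tau>"] t
    unfolding jacobi2_weight_4[OF half(1)] jacobi2_weight_4[OF half(2)] theta_half[OF t] theta_half_plus1[OF t] u_def v_def w_def
    by simp
  then have "16 * slash_sum 4 jacobi4_fam \<tau> = 16 * (v ^ 2 * w ^ 2)"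
    unfolding e4_double[OF t] e4_squares(3)[of \<tau>] i2 u_def[symmetric] v_def[symmetric] w_def[symmetric]
    using jac by algebra
  then show ?thesis by (simp add: v_def w_def)
qed

lemma jacobi2_weight_8:
  assumes t: "Im \<tau> > 0"
  shows "43 * slash_sum 8 jacobi2_fam \<tau> = (th3 \<tau> ^ 2) ^ 2 * (th4 \<tau> ^ 2) ^ 2 * (13 * (th2 \<tau> ^ 4) ^ 2 + 43 * (th3 \<tau> ^ 2) ^ 2 * (th4 \<tau> ^ 2) ^ 2)"
proof -
  define u v w where "u = th2 \<tau> ^ 2" and "v = th3 \<tau> ^ 2" and "w = th4 \<tau> ^ 2"
  have jac: "v ^ 2 = u ^ 2 + w ^ 2" using jacobi_squares[OF t] by (simp add: u_def v_def w_def)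
  have "258 * slash_sum 8 jacobi2_fam \<tau> = (16 * e4 (2 * \<tau>)) ^ 2 + (mixed_form (\<tau> / 2) * e4 (\<tau> / 2) + mixed_form ((\<tau> + 1) / 2) * e4 ((\<tau> + 1) / 2))"
    using hecke_relation_jacobi2[OF t, of 8] slash_sum_const1_fam_const2_fam(1)[of 8 2 "2 * \<tau>"]
      slash_sum_mixed_fam[of 8 2 "\<tau> / 2"] slash_sum_mixed_fam[of 8 2 "(\<tau> + 1) / 2"] t by (simp add: power_mult_distrib)
  also have "\<dots> = 6 * (v ^ 2 * w ^ 2 * (13 * u ^ 4 + 43 * v ^ 2 * w ^ 2))"
    unfolding e4_double[OF t] e4_half[OF t] u_def[symmetric] v_def[symmetric] w_def[symmetric]
    using jac by algebra
  also have "u ^ 4 = (th2 \<tau> ^ 4) ^ 2" by (simp add: u_def flip: power_mult)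
  finally show ?thesis by (simp add: v_def w_def)
qed

lemma jacobi2_minus_jacobi4_weight_8:
  assumes t: "Im \<tau> > 0"
  shows "16 * 43 * (slash_sum 8 jacobi2_fam \<tau> - slash_sum 8 jacobi4_fam \<tau>) = 135 * (th2 \<tau> ^ 2) ^ 4 * (th3 \<tau> ^ 2) ^ 2 * (th4 \<tau> ^ 2) ^ 2"
proof -
  define u v w where "u = th2 \<tau> ^ 2" and "v = th3 \<tau> ^ 2" and "w = th4 \<tau> ^ 2"
  have jac: "v ^ 2 = u ^ 2 + w ^ 2" using jacobi_squares[OF t] by (simp add: u_def v_def w_def)
  have half: "Im (\<tau> / 2) > 0" "Im ((\<tau> + 1) / 2) > 0" using t by simp_all
  have "43 * slash_sum 8 jacobi2_fam (\<tau> / 2) = (v + u) ^ 2 * (v - u) ^ 2 * (13 * (4 * u * v) ^ 2 + 43 * (v + u) ^ 2 * (v - u) ^ 2)"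
    unfolding jacobi2_weight_8[OF half(1)] theta_half[OF t] u_def v_def w_def by simp
  also have "\<dots> = w ^ 4 * (208 * u ^ 2 * v ^ 2 + 43 * w ^ 4)" using jac by algebra
  finally have h1: "43 * slash_sum 8 jacobi2_fam (\<tau> / 2) = w ^ 4 * (208 * u ^ 2 * v ^ 2 + 43 * w ^ 4)" .
  have i2: "(w + \<i> * u) ^ 2 * (w - \<i> * u) ^ 2 = (w ^ 2 + u ^ 2) ^ 2" "(4 * \<i> * u * w) ^ 2 = - 16 * u ^ 2 * w ^ 2"
    by (simp_all add: power2_eq_square algebra_simps)
  have "43 * slash_sum 8 jacobi2_fam ((\<tau> + 1) / 2) = (w + \<i> * u) ^ 2 * (w - \<i> * u) ^ 2 * (13 * (4 * \<i> * u * w) ^ 2 + 43 * ((w + \<i> * u) ^ 2 * (w - \<i> * u) ^ 2))"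
    unfolding jacobi2_weight_8[OF half(2)] theta_half_plus1[OF t] u_def v_def w_def by (simp only: mult.assoc)
  also have "\<dots> = v ^ 4 * (43 * v ^ 4 - 208 * u ^ 2 * w ^ 2)" unfolding i2 using jac by algebra
  finally have h2: "43 * slash_sum 8 jacobi2_fam ((\<tau> + 1) / 2) = v ^ 4 * (43 * v ^ 4 - 208 * u ^ 2 * w ^ 2)" .
  define x y where "x = slash_sum 8 jacobi2_fam \<tau>" and "y = slash_sum 8 jacobi4_fam \<tau>"
  have h0: "43 * x = v ^ 2 * w ^ 2 * (13 * u ^ 4 + 43 * v ^ 2 * w ^ 2)"
    unfolding x_def jacobi2_weight_8[OF t] u_def v_def w_def by (simp flip: power_mult)
  have "2 * e4 \<tau> ^ 2 + 256 * y = (slash_sum 8 jacobi2_fam (\<tau> / 2) + slash_sum 8 jacobi2_fam ((\<tau> + 1) / 2)) + (16 * e4 (2 * \<tau>)) ^ 2"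
    using hecke_relation_jacobi4[OF t, of 8] slash_sum_const1_fam_const2_fam(1)[of 8 2 \<tau>] slash_sum_const1_fam_const2_fam(2)[of 8 2 "2 * \<tau>"] t
    by (simp add: y_def power_mult_distrib)
  then have "43 * (2 * e4 \<tau> ^ 2 + 256 * y) = 43 * slash_sum 8 jacobi2_fam (\<tau> / 2) + 43 * slash_sum 8 jacobi2_fam ((\<tau> + 1) / 2) + 43 * (16 * e4 (2 * \<tau>)) ^ 2"
    by (simp only: distrib_left)
  then have "43 * (u ^ 4 + v ^ 4 + w ^ 4) ^ 2 / 2 + 43 * 256 * y =
      w ^ 4 * (208 * u ^ 2 * v ^ 2 + 43 * w ^ 4) + v ^ 4 * (43 * v ^ 4 - 208 * u ^ 2 * w ^ 2) + 43 * (v ^ 4 + 14 * v ^ 2 * w ^ 2 + w ^ 4) ^ 2"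
    unfolding h1 h2 e4_double[OF t] e4_squares(3)[of \<tau>] u_def[symmetric] v_def[symmetric] w_def[symmetric]
    by (simp add: power_divide distrib_left)
  then have "43 * (u ^ 4 + v ^ 4 + w ^ 4) ^ 2 + 2 * 43 * 256 * y =
      2 * (w ^ 4 * (208 * u ^ 2 * v ^ 2 + 43 * w ^ 4) + v ^ 4 * (43 * v ^ 4 - 208 * u ^ 2 * w ^ 2) + 43 * (v ^ 4 + 14 * v ^ 2 * w ^ 2 + w ^ 4) ^ 2)"
    by (simp add: field_simps)
  then have "32 * (16 * 43 * (x - y)) = 32 * (135 * u ^ 4 * v ^ 2 * w ^ 2)"
    using h0 jac by algebra
  then have "16 * 43 * (x - y) = 135 * u ^ 4 * v ^ 2 * w ^ 2" by (simp only: mult_cancel_left) simp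
  then show ?thesis by (simp only: x_def y_def u_def v_def w_def)
qed

theorem mainTheorem10:
  fixes \<tau> :: complex
  assumes "Im \<tau> > 0"
  shows "theta10 \<tau> ^ 24 =
           E4 \<tau> ^ 3 - jacobi_eisenstein 4 4 \<tau> (1 / 2) ^ 3
           - 3 * 2 ^ 4 * eta \<tau> ^ 12 * theta10 \<tau> ^ 4 * E4 \<tau>
       \<and> theta10 \<tau> ^ 24 =
           E4 \<tau> ^ 3 - jacobi_eisenstein 4 4 \<tau> (1 / 2) ^ 3
           - 688 / 45 * E4 \<tau> * (jacobi_eisenstein 8 2 \<tau> (1 / 2) - jacobi_eisenstein 8 4 \<tau> (1 / 2))"
proof -
  define a b where "a = th2 \<tau> ^ 4" and "b = th4 \<tau> ^ 4"
  define s where "s = b * (a + b)"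
  have v: "th3 \<tau> ^ 4 = a + b" using jacobi_theta_identity[OF assms] by (simp add: a_def b_def)
  have "e4 \<tau> = (a ^ 2 + (th3 \<tau> ^ 4) ^ 2 + b ^ 2) / 2" by (simp add: e4_def a_def b_def flip: power_mult)
  then have E: "E4 \<tau> = a ^ 2 + s"
    unfolding E4_eq_e4[OF assms] v s_def by algebra
  have J: "jacobi_eisenstein 4 4 \<tau> (1 / 2) = s"
    unfolding jacobi_eisenstein_index_4[OF assms] jacobi4_weight_4[OF assms] s_def v[symmetric] by (simp add: b_def flip: power_mult)
  have T: "theta10 \<tau> ^ 4 = a" "theta10 \<tau> ^ 24 = a ^ 6" by (simp_all add: theta10_eq_th2 a_def flip: power_mult)
  have "16 * eta \<tau> ^ 12 = (2 * eta \<tau> ^ 3) ^ 4" by (simp add: power_mult_distrib flip: power_mult)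
  also have "\<dots> = a * s"
    unfolding theta_product_eta[OF assms, symmetric] power_mult_distrib s_def v[symmetric] by (simp add: a_def b_def)
  finally have eta: "16 * eta \<tau> ^ 12 = a * s" .
  have D: "16 * 43 * (jacobi_eisenstein 8 2 \<tau> (1 / 2) - jacobi_eisenstein 8 4 \<tau> (1 / 2)) = 135 * (a ^ 2 * s)"
    unfolding jacobi_eisenstein_index_2[OF assms] jacobi_eisenstein_index_4[OF assms] jacobi2_minus_jacobi4_weight_8[OF assms] s_def v[symmetric]
    by (simp add: a_def b_def flip: power_mult)
  have main: "a ^ 6 = (a ^ 2 + s) ^ 3 - s ^ 3 - 3 * (a ^ 2 * s) * (a ^ 2 + s)"
    by (simp add: eval_nat_numeral algebra_simps)
  have e1: "3 * 2 ^ 4 * eta \<tau> ^ 12 * theta10 \<tau> ^ 4 * E4 \<tau> = 3 * (a ^ 2 * s) * (a ^ 2 + s)"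
    unfolding T E using eta by algebra
  have "688 / 45 * (jacobi_eisenstein 8 2 \<tau> (1 / 2) - jacobi_eisenstein 8 4 \<tau> (1 / 2)) = 3 * (a ^ 2 * s)"
    using D by (simp add: field_simps)
  moreover have "688 / 45 * (a ^ 2 + s) * y = (688 / 45 * y) * (a ^ 2 + s)" for y by simp
  ultimately have e2: "688 / 45 * E4 \<tau> * (jacobi_eisenstein 8 2 \<tau> (1 / 2) - jacobi_eisenstein 8 4 \<tau> (1 / 2)) = 3 * (a ^ 2 * s) * (a ^ 2 + s)"
    unfolding E by (simp only:)
  show ?thesis unfolding e1 e2 unfolding T J E using main by simp
qed

end
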